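(* Let $n\in\{1,2\}$, $s\in(0,\frac12)\cup(\frac12,1)$, $L>0$, $\delta>0$, $\alpha\in(\max(0,2s-1),1]$, and, if $n=2$, $\theta\in[0,1]$. Let $\Omega_n=[-L,L]^n$ and $\Omega_n^\delta=(-L-\delta,L+\delta)^n$. Let $g\in L^\infty(\mathbb{R}^n)$ have bounded support and satisfy $g=0$ in $\Omega_n$, and let $u:\mathbb{R}^n\to\mathbb{R}$ satisfy $u=g$ in $\Omega_n^c=\mathbb{R}^n\setminus\Omega_n$ and $u\in C^{1,\alpha}(\bar\Omega_n^\delta)$. Let $(-\Delta)^s$ be the integral fractional Laplacian and let $(-\Delta)^s_h$ be the discrete operator on the grid of mesh size $h=2L/N$ defined in the context (for dimension $n$). Then there is a constant $C>0$, independent of $h$, such that for all $N\in\mathbb{N}$ with $4h<\delta$, $$\|((-\Delta)^s-(-\Delta)^s_h)u\|_\infty\le C h^{1+\alpha-2s},\qquad \|((-\Delta)^s-(-\Delta)^s_h)u\|_2\le C h^{1+\alpha-2s},$$ where the norms are the discrete $l^\infty$ and $l^2$ norms over the interior grid points.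
   Context: **Integral fractional Laplacian.** For $s\in(0,1)$, $(-\Delta)^s u(\mathbf{x})=c_{n,s}\,\mathrm{P.V.}\int_{\mathbb{R}^n}\frac{u(\mathbf{x})-u(\mathbf{y})}{|\mathbf{x}-\mathbf{y}|^{n+2s}}\,d\mathbf{y}$ with $c_{n,s}=\frac{2^{2s}s\Gamma(n/2+s)}{\pi^{n/2}\Gamma(1-s)}$. For negative index $s'<0$ put $c_{n,s'}=-\frac{2^{2s'}s'\Gamma(n/2+s')}{\pi^{n/2}\Gamma(1-s')}$. **Norms.** Interior grid points are those with all indices in $\{1,\dots,N-1\}$. For a grid function $v$ on the interior grid points, $\|v\|_\infty=\max|v|$ and $\|v\|_2=(h^n\sum |v|^2)^{1/2}$. **Discretization, $n=1$.** $h=2L/N$, $x_i=-L+ih$ ($i\in\mathbb{Z}$), $u_i=u(x_i)$, $\bar\phi_1(y)=1-|y|/h$ for $|y|<h$ and $0$ otherwise; $I_i=[x_{i-1},x_{i+1}]\cap\Omega_1$ and $\phi_i(x)=\bar\phi_1(x-x_i)\chi_{I_i}(x)$ for $0\le i\le N$. For $k\in\mathbb{Z}$, $\bar\omega_k=c_{1,s-1}\int_{-h}^{h}|kh-y|^{1-2s}\bar\phi_1(y)\,dy$. For $0\le i\le N$, $R_i=c_{1,s-1}\int_{\mathbb{R}}|x_i-y|^{1-2s}\big(u_0\phi_0(y)+u_N\phi_N(y)+g(y)\big)dy$. For any sequence $v$, $(-\Delta)_h v_i=-\frac{v_{i-1}-2v_i+v_{i+1}}{h^2}$. Put $w_k=(-\Delta)_h\bar\omega_k$.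 For $1\le i\le N-1$, $$(-\Delta)^s_h u_i=\sum_{j=1}^{N-1}w_{j-i}u_j+(-\Delta)_hR_i .$$ **Discretization, $n=2$.** $h=2L/N$, $(x_i,y_j)=(-L+ih,-L+jh)$, $u_{i,j}=u(x_i,y_j)$, $\bar\phi_2(x,y)=(1-|x|/h)(1-|y|/h)$ on $(-h,h)^2$ and $0$ otherwise; $I_{i,j}=([x_{i-1},x_{i+1}]\times[y_{j-1},y_{j+1}])\cap\Omega_2$ and $\phi_{i,j}(x,y)=\bar\phi_2(x-x_i,y-y_j)\chi_{I_{i,j}}(x,y)$ for $0\le i,j\le N$. For $k,l\in\mathbb{Z}$, $\bar\omega_{k,l}=c_{2,s-1}\int_{-h}^h\int_{-h}^h|(kh,lh)+(\xi,\eta)|^{-2s}\bar\phi_2(\xi,\eta)\,d\xi d\eta$. For $0\le i,j\le N$, $$R_{i,j}=c_{2,s-1}\iint_{\mathbb{R}^2}|(x_i,y_j)-(\xi,\eta)|^{-2s}g\,d\xi d\eta+c_{2,s-1}\!\!\sum_{\substack{0\le p,q\le N\\ pq(p-N)(q-N)=0}}\iint_{\mathbb{R}^2}|(x_i,y_j)-(\xi,\eta)|^{-2s}u_{p,q}\phi_{p,q}\,d\xi d\eta .$$ For any double sequence $v$, $(-\Delta)_{h,1}v_{i,j}=-\frac{v_{i-1,j}+v_{i+1,j}+v_{i,j+1}+v_{i,j-1}-4v_{i,j}}{h^2}$ and $(-\Delta)_{h,2}v_{i,j}=-\frac{v_{i-1,j-1}+v_{i+1,j-1}+v_{i-1,j+1}+v_{i+1,j+1}-4v_{i,j}}{2h^2}$.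 Put $w_{k,l}=(\theta(-\Delta)_{h,1}+(1-\theta)(-\Delta)_{h,2})\bar\omega_{k,l}$. For $1\le i,j\le N-1$, $$(-\Delta)^s_hu_{i,j}=\sum_{p=1}^{N-1}\sum_{q=1}^{N-1}w_{p-i,q-j}u_{p,q}+(\theta(-\Delta)_{h,1}+(1-\theta)(-\Delta)_{h,2})R_{i,j}.$$ *)

theory Defs
  imports "HOL-Analysis.Analysis"
begin

section \<open>Function spaces and domains\<close>

definition cube :: "real \<Rightarrow> 'a::euclidean_space set" where
  "cube L = cbox (- (L *\<^sub>R One)) (L *\<^sub>R One)"

definition open_cube :: "real \<Rightarrow> 'a::euclidean_space set" where
  "open_cube r = box (- (r *\<^sub>R One)) (r *\<^sub>R One)"

text \<open>Elements of the space of essentially bounded functions are represented by functions, and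
  all properties that only make sense up to null sets are stated almost everywhere.
  Measurability and integrals are with respect to \<open>lebesgue\<close> (the completed measure).\<close>

definition Linfty :: "('a::euclidean_space \<Rightarrow> real) \<Rightarrow> bool" where
  "Linfty g \<longleftrightarrow> g \<in> borel_measurable lebesgue \<and> (\<exists>M. AE x in lebesgue. \<bar>g x\<bar> \<le> M)"

definition bounded_support :: "('a::euclidean_space \<Rightarrow> real) \<Rightarrow> bool" where
  "bounded_support g \<longleftrightarrow> (\<exists>r. AE x in lebesgue. norm x > r \<longrightarrow> g x = 0)"

text \<open>The space of functions in \<open>C\<^sup>1(U)\<close> with finite \<open>C\<^sup>1\<^sup>,\<^sup>\<alpha>\<close> norm on \<open>closure U\<close>, for open \<open>U\<close>.
  Since the gradient \<open>G\<close> is uniformly continuous on \<open>U\<close>, it extends to \<open>closure U\<close> with the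
  same Hoelder constant; so it is enough to speak about \<open>G\<close> on \<open>U\<close>.\<close>

definition C1_holder_closure :: "real \<Rightarrow> 'a::euclidean_space set \<Rightarrow> ('a \<Rightarrow> real) \<Rightarrow> bool" where
  "C1_holder_closure \<alpha> U u \<longleftrightarrow>
     continuous_on (closure U) u \<and> bounded (u ` closure U) \<and>
     (\<exists>G K. (\<forall>x\<in>U. GDERIV u x :> G x) \<and> bounded (G ` U) \<and>
            (\<forall>x\<in>U. \<forall>y\<in>U. norm (G x - G y) \<le> K * dist x y powr \<alpha>))"

section \<open>The integral fractional Laplacian\<close>

definition frac_const :: "nat \<Rightarrow> real \<Rightarrow> real" where
  "frac_const n s =
     (if s < 0 then - (2 powr (2 * s) * s * Gamma (real n / 2 + s) / (pi powr (real n / 2) * Gamma (1 - s)))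
      else 2 powr (2 * s) * s * Gamma (real n / 2 + s) / (pi powr (real n / 2) * Gamma (1 - s)))"

definition frac_laplacian :: "real \<Rightarrow> ('a::euclidean_space \<Rightarrow> real) \<Rightarrow> 'a \<Rightarrow> real" where
  "frac_laplacian s u x = frac_const DIM('a) s *
     Lim (at_right 0) (\<lambda>\<epsilon>. LINT y:{y. \<epsilon> < dist x y}|lebesgue.
        (u x - u y) / norm (x - y) powr (real DIM('a) + 2 * s))"

section \<open>Discrete norms\<close>

text \<open>The inserted \<open>0\<close> only matters for an empty grid (\<open>N = 1\<close>), whose norm is \<open>0\<close>.\<close>

definition grid_norm_inf :: "'i set \<Rightarrow> ('i \<Rightarrow> real) \<Rightarrow> real" where
  "grid_norm_inf I v = Max (insert 0 ((\<lambda>i. \<bar>v i\<bar>) ` I))"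

definition grid_norm_2 :: "nat \<Rightarrow> real \<Rightarrow> 'i set \<Rightarrow> ('i \<Rightarrow> real) \<Rightarrow> real" where
  "grid_norm_2 n h I v = sqrt (h ^ n * (\<Sum>i\<in>I. \<bar>v i\<bar>\<^sup>2))"

definition mesh :: "real \<Rightarrow> nat \<Rightarrow> real" where
  "mesh L N = 2 * L / real N"

definition node :: "real \<Rightarrow> nat \<Rightarrow> int \<Rightarrow> real" where
  "node L N i = - L + of_int i * mesh L N"

section \<open>Discretization in one dimension\<close>

definition interior1 :: "nat \<Rightarrow> int set" where
  "interior1 N = {1..int N - 1}"

definition hat1 :: "real \<Rightarrow> real \<Rightarrow> real" where
  "hat1 h y = (if \<bar>y\<bar> < h then 1 - \<bar>y\<bar> / h else 0)"

definition phi1 :: "real \<Rightarrow> nat \<Rightarrow> int \<Rightarrow> real \<Rightarrow> real" where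
  "phi1 L N i x = hat1 (mesh L N) (x - node L N i) *
     indicator ({node L N (i - 1)..node L N (i + 1)} \<inter> cube L) x"

definition omega1 :: "real \<Rightarrow> real \<Rightarrow> int \<Rightarrow> real" where
  "omega1 s h k = frac_const 1 (s - 1) *
     (LINT y:{-h..h}|lebesgue. \<bar>of_int k * h - y\<bar> powr (1 - 2 * s) * hat1 h y)"

definition R1 :: "real \<Rightarrow> real \<Rightarrow> nat \<Rightarrow> (real \<Rightarrow> real) \<Rightarrow> (real \<Rightarrow> real) \<Rightarrow> int \<Rightarrow> real" where
  "R1 s L N g u i = frac_const 1 (s - 1) *
     (LINT y|lebesgue. \<bar>node L N i - y\<bar> powr (1 - 2 * s) *
        (u (node L N 0) * phi1 L N 0 y + u (node L N (int N)) * phi1 L N (int N) y + g y))"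

definition lap1 :: "real \<Rightarrow> (int \<Rightarrow> real) \<Rightarrow> int \<Rightarrow> real" where
  "lap1 h v i = - ((v (i - 1) - 2 * v i + v (i + 1)) / h\<^sup>2)"

definition disc_frac_laplacian1 ::
    "real \<Rightarrow> real \<Rightarrow> nat \<Rightarrow> (real \<Rightarrow> real) \<Rightarrow> (real \<Rightarrow> real) \<Rightarrow> int \<Rightarrow> real" where
  "disc_frac_laplacian1 s L N g u i =
     (\<Sum>j\<in>interior1 N. lap1 (mesh L N) (omega1 s (mesh L N)) (j - i) * u (node L N j))
     + lap1 (mesh L N) (R1 s L N g u) i"

definition error1 ::
    "real \<Rightarrow> real \<Rightarrow> nat \<Rightarrow> (real \<Rightarrow> real) \<Rightarrow> (real \<Rightarrow> real) \<Rightarrow> int \<Rightarrow> real" where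
  "error1 s L N g u i = frac_laplacian s u (node L N i) - disc_frac_laplacian1 s L N g u i"

section \<open>Discretization in two dimensions\<close>

definition node2 :: "real \<Rightarrow> nat \<Rightarrow> int \<times> int \<Rightarrow> real \<times> real" where
  "node2 L N = (\<lambda>(i, j). (node L N i, node L N j))"

definition interior2 :: "nat \<Rightarrow> (int \<times> int) set" where
  "interior2 N = {1..int N - 1} \<times> {1..int N - 1}"

definition boundary2 :: "nat \<Rightarrow> (int \<times> int) set" where
  "boundary2 N = {(p, q). p \<in> {0..int N} \<and> q \<in> {0..int N} \<and> p * q * (p - int N) * (q - int N) = 0}"

definition hat2 :: "real \<Rightarrow> real \<times> real \<Rightarrow> real" where
  "hat2 h = (\<lambda>(x, y). if \<bar>x\<bar> < h \<and> \<bar>y\<bar> < h then (1 - \<bar>x\<bar> / h) * (1 - \<bar>y\<bar> / h) else 0)"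

definition phi2 :: "real \<Rightarrow> nat \<Rightarrow> int \<times> int \<Rightarrow> real \<times> real \<Rightarrow> real" where
  "phi2 L N = (\<lambda>(i, j) z. hat2 (mesh L N) (z - node2 L N (i, j)) *
     indicator (({node L N (i - 1)..node L N (i + 1)} \<times> {node L N (j - 1)..node L N (j + 1)}) \<inter> cube L) z)"

definition omega2 :: "real \<Rightarrow> real \<Rightarrow> int \<times> int \<Rightarrow> real" where
  "omega2 s h = (\<lambda>(k, l). frac_const 2 (s - 1) *
     (LINT z:{-h..h} \<times> {-h..h}|lebesgue.
        norm ((of_int k * h, of_int l * h) + z) powr (- 2 * s) * hat2 h z))"

definition R2 ::
    "real \<Rightarrow> real \<Rightarrow> nat \<Rightarrow> (real \<times> real \<Rightarrow> real) \<Rightarrow> (real \<times> real \<Rightarrow> real) \<Rightarrow> int \<times> int \<Rightarrow> real" where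
  "R2 s L N g u ij =
     frac_const 2 (s - 1) * (LINT z|lebesgue. norm (node2 L N ij - z) powr (- 2 * s) * g z)
     + frac_const 2 (s - 1) * (\<Sum>pq\<in>boundary2 N.
         LINT z|lebesgue. norm (node2 L N ij - z) powr (- 2 * s) * (u (node2 L N pq) * phi2 L N pq z))"

definition lap2_1 :: "real \<Rightarrow> (int \<times> int \<Rightarrow> real) \<Rightarrow> int \<times> int \<Rightarrow> real" where
  "lap2_1 h v = (\<lambda>(i, j).
     - ((v (i - 1, j) + v (i + 1, j) + v (i, j + 1) + v (i, j - 1) - 4 * v (i, j)) / h\<^sup>2))"

definition lap2_2 :: "real \<Rightarrow> (int \<times> int \<Rightarrow> real) \<Rightarrow> int \<times> int \<Rightarrow> real" where
  "lap2_2 h v = (\<lambda>(i, j).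
     - ((v (i - 1, j - 1) + v (i + 1, j - 1) + v (i - 1, j + 1) + v (i + 1, j + 1) - 4 * v (i, j))
        / (2 * h\<^sup>2)))"

definition lap2 :: "real \<Rightarrow> real \<Rightarrow> (int \<times> int \<Rightarrow> real) \<Rightarrow> int \<times> int \<Rightarrow> real" where
  "lap2 \<theta> h v ij = \<theta> * lap2_1 h v ij + (1 - \<theta>) * lap2_2 h v ij"

definition disc_frac_laplacian2 ::
    "real \<Rightarrow> real \<Rightarrow> real \<Rightarrow> nat \<Rightarrow> (real \<times> real \<Rightarrow> real) \<Rightarrow> (real \<times> real \<Rightarrow> real) \<Rightarrow> int \<times> int \<Rightarrow> real" where
  "disc_frac_laplacian2 \<theta> s L N g u = (\<lambda>(i, j).
     (\<Sum>p\<in>{1..int N - 1}. \<Sum>q\<in>{1..int N - 1}.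
        lap2 \<theta> (mesh L N) (omega2 s (mesh L N)) (p - i, q - j) * u (node2 L N (p, q)))
     + lap2 \<theta> (mesh L N) (R2 s L N g u) (i, j))"

definition error2 ::
    "real \<Rightarrow> real \<Rightarrow> real \<Rightarrow> nat \<Rightarrow> (real \<times> real \<Rightarrow> real) \<Rightarrow> (real \<times> real \<Rightarrow> real) \<Rightarrow> int \<times> int \<Rightarrow> real" where
  "error2 \<theta> s L N g u ij = frac_laplacian s u (node2 L N ij) - disc_frac_laplacian2 \<theta> s L N g u ij"

end

theory Submission
  imports Defs
begin

text \<open>The discrete operator is minus the convolution with a second difference quotient \<open>Q\<close> (along an isotropic
  stencil of width \<open>h\<close>) of the Riesz kernel \<open>|z| powr (2 - n - 2 * s)\<close>, applied to the interpolant \<open>U\<close> of \<open>u\<close>.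
  Since \<open>Q\<close> is integrable, even and has integral zero, the error at a node \<open>x\<close> is the sum of the
  integral of \<open>(c |z| powr (- n - 2 * s) - Q z) * D z\<close>, where \<open>D z = u x - (u (x + z) + u (x - z)) / 2\<close>
  is \<open>O(|z| powr (1 + \<alpha>))\<close>, and of the convolution of \<open>Q\<close> with the interpolation error \<open>U - u\<close>, which is
  \<open>O(h powr (1 + \<alpha>))\<close> on the cube and zero outside. By isotropy of the stencil the bracket
  decays like \<open>|z| powr (- n - 2 * s - 2)\<close> for \<open>h = 1\<close>, so for \<open>h = 1\<close> all integrals are finite;
  the substitution \<open>z = h \<zeta>\<close> gives the factor \<open>h powr (1 + \<alpha> - 2 * s)\<close>.\<close>

section \<open>Affine substitutions and powers of the norm\<close>

text \<open>Isotropy of the stencil decides whether the constant is finite. At infinity a second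
  difference quotient of the Riesz kernel has a main term of order
  \<open>|z| powr (- n - 2 * s)\<close>. Unless this is the Laplacian of the kernel, it survives in
  the bracket, and its product with \<open>|z| powr (1 + \<alpha>)\<close> is not integrable at
  infinity because \<open>1 + \<alpha> > 2 * s\<close>. The same inequality gives integrability at
  0. Once the main terms cancel, \<open>1 + \<alpha> \<le> 2 < 2 + 2 * s\<close> settles infinity.
  The Riesz kernel alone is not integrable (for \<open>n = 1\<close> and \<open>s < 1/2\<close> it
  even grows), so the zero integral of \<open>Q\<close> cannot be obtained by translating its terms
  one by one; homogeneity has to be used. \<open>D\<close> is small of order
  \<open>1 + \<alpha>\<close> on the whole space although \<open>u\<close> has no regularity far
  away: nodes have distance at least \<open>\<delta>\<close> from that region, and there boundedness
  is enough. The coefficient in the bracket is that of the Laplacian of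
  \<open>|z| powr (2 - n - 2 * s)\<close>; multiplied by the constant for \<open>s - 1\<close> it
  must give the constant for \<open>s\<close>. This is a Gamma identity, whose pole for
  \<open>n = 1\<close> is at \<open>s = 1/2\<close>.\<close>

lemma scale_translate_lebesgue:
  fixes t :: "'a::euclidean_space"
  assumes "c \<noteq> 0"
  shows "lebesgue = density (distr lebesgue lebesgue (\<lambda>x. t + c *\<^sub>R x)) (\<lambda>_. ennreal (\<bar>c\<bar> ^ DIM('a)))"
    and "(\<lambda>x. t + c *\<^sub>R x) \<in> lebesgue \<rightarrow>\<^sub>M lebesgue"
proof -
  \<comment> \<open>A scalar multiple is a diagonal map with equal entries, the form in which
    \<open>lebesgue_affine_euclidean\<close> computes the Jacobian.\<close>
  have eq: "(\<lambda>x. t + c *\<^sub>R x) = (\<lambda>x. t + (\<Sum>j\<in>Basis. (c * (x \<bullet> j)) *\<^sub>R j))"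
    by (simp add: scaleR_sum_right[symmetric] scaleR_scaleR[symmetric] euclidean_representation del: scaleR_scaleR)
  show "lebesgue = density (distr lebesgue lebesgue (\<lambda>x. t + c *\<^sub>R x)) (\<lambda>_. ennreal (\<bar>c\<bar> ^ DIM('a)))"
    unfolding eq using lebesgue_affine_euclidean[of "\<lambda>_. c" t] assms by (simp add: ennreal_power)
  show "(\<lambda>x. t + c *\<^sub>R x) \<in> lebesgue \<rightarrow>\<^sub>M lebesgue"
    unfolding eq using lebesgue_affine_measurable[of "\<lambda>_. c" t] assms by simp
qed

lemma borel_measurable_scale_translate:
  fixes f :: "'a::euclidean_space \<Rightarrow> 'b::topological_space"
  assumes "f \<in> borel_measurable lebesgue" "c \<noteq> 0"
  shows "(\<lambda>x. f (t + c *\<^sub>R x)) \<in> borel_measurable lebesgue"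
  using measurable_compose[OF scale_translate_lebesgue(2)[OF assms(2), of t] assms(1)] .

text \<open>The density above is a nonzero constant and affects no null set, so it remains to pull
  the statement back along the map.\<close>

lemma AE_scale_translate:
  fixes t :: "'a::euclidean_space"
  assumes "AE x in lebesgue. P x" "c \<noteq> 0"
  shows "AE x in lebesgue. P (t + c *\<^sub>R x)"
proof -
  have "AE x in density (distr lebesgue lebesgue (\<lambda>x. t + c *\<^sub>R x)) (\<lambda>_. ennreal (\<bar>c\<bar> ^ DIM('a))). P x"
    using assms(1) by (subst scale_translate_lebesgue(1)[OF assms(2), of t, symmetric])
  then have "AE x in distr lebesgue lebesgue (\<lambda>x. t + c *\<^sub>R x). P x"
    using assms(2) by (subst (asm) AE_density) auto
  then show ?thesis
    by (rule AE_distrD[OF scale_translate_lebesgue(2)[OF assms(2)]])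
qed

lemma integrable_scale_translate:
  fixes f :: "'a::euclidean_space \<Rightarrow> real"
  assumes f: "integrable lebesgue f" and c: "c \<noteq> 0"
  shows "integrable lebesgue (\<lambda>x. f (t + c *\<^sub>R x))"
proof -
  let ?T = "\<lambda>x. t + c *\<^sub>R x"
  have m: "f \<in> borel_measurable lebesgue" using f by auto
  have "integrable (density (distr lebesgue lebesgue ?T) (\<lambda>_. ennreal (\<bar>c\<bar> ^ DIM('a)))) f"
    using f scale_translate_lebesgue(1)[OF c, of t] by simp
  then have "integrable (distr lebesgue lebesgue ?T) (\<lambda>x. \<bar>c\<bar> ^ DIM('a) *\<^sub>R f x)"
    using m by (subst (asm) integrable_density) auto
  then have "integrable (distr lebesgue lebesgue ?T) f"
    using c by simp
  then show ?thesis
    by (rule integrable_distr[OF scale_translate_lebesgue(2)[OF c]])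
qed

text \<open>Measurability is enough: if \<open>f\<close> is not integrable, neither is its
  composition with the affine map, and both integrals are 0 by convention.\<close>

lemma integral_scale_translate:
  fixes f :: "'a::euclidean_space \<Rightarrow> real"
  assumes f: "f \<in> borel_measurable lebesgue" and c: "c \<noteq> 0"
  shows "(LINT x|lebesgue. f x) = \<bar>c\<bar> ^ DIM('a) * (LINT x|lebesgue. f (t + c *\<^sub>R x))"
proof -
  let ?T = "\<lambda>x. t + c *\<^sub>R x"
  have "(LINT x|lebesgue. f x) = (LINT x|density (distr lebesgue lebesgue ?T) (\<lambda>_. ennreal (\<bar>c\<bar> ^ DIM('a))). f x)"
    using scale_translate_lebesgue(1)[OF c, of t] by simp
  also have "\<dots> = (LINT x|distr lebesgue lebesgue ?T. \<bar>c\<bar> ^ DIM('a) *\<^sub>R f x)"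
    using f by (subst integral_density) auto
  also have "\<dots> = (LINT x|lebesgue. \<bar>c\<bar> ^ DIM('a) *\<^sub>R f (?T x))"
    using f by (subst integral_distr[OF scale_translate_lebesgue(2)[OF c]]) auto
  finally show ?thesis by simp
qed

section \<open>Integrability of powers of the norm\<close>

lemma norm_powr_integrable_shells:
  fixes q \<rho> r :: real
  assumes \<rho>: "0 < \<rho>" and r: "0 < r" and lt1: "\<rho> powr (q + DIM('a)) < 1"
  shows "integrable lebesgue (\<lambda>z::'a::euclidean_space. norm z powr q *
     indicator (\<Union>k::nat. {z. \<rho> ^ k * r \<le> norm z \<and> norm z \<le> 2 * \<rho> ^ k * r}) z)"
proof -
  \<comment> \<open>Geometric shells replace polar coordinates: the integral over \<open>A k\<close>
    is at most a constant times the \<open>k\<close>-th power of \<open>\<rho> powr (q + n)\<close>,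
    a geometric series with ratio below 1. Leaving \<open>\<rho>\<close> free covers shells that
    shrink to 0 (\<open>1/2\<close>) and shells that grow to infinity (\<open>2\<close>).\<close>
  define A where "A k = {z::'a. \<rho> ^ k * r \<le> norm z \<and> norm z \<le> 2 * \<rho> ^ k * r}" for k :: nat
  \<comment> \<open>\<open>max 1 (2 powr q)\<close> absorbs the variation of
    \<open>norm z powr q\<close> across a shell for either sign of \<open>q\<close>; the volume of
    the shell is bounded by that of the ball of its outer radius.\<close>
  define C where "C = max 1 (2 powr q) * r powr q * unit_ball_vol DIM('a) * (2 * r) ^ DIM('a)"
  have [measurable]: "A k \<in> sets borel" for k
    unfolding A_def by measurable
  have C0: "0 \<le> C" unfolding C_def using r by (auto intro!: mult_nonneg_nonneg simp: max_def)
  have pt: "norm z powr q \<le> max 1 (2 powr q) * (\<rho> ^ k * r) powr q" if "z \<in> A k" for z :: 'a and k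
  proof -
    have p: "0 < \<rho> ^ k * r" using \<rho> r by simp
    have z: "\<rho> ^ k * r \<le> norm z" "norm z \<le> 2 * (\<rho> ^ k * r)" using that by (auto simp: A_def)
    show ?thesis
    proof (cases "0 \<le> q")
      case True
      then have "norm z powr q \<le> (2 * (\<rho> ^ k * r)) powr q" using z p by (intro powr_mono2) auto
      also have "\<dots> = 2 powr q * (\<rho> ^ k * r) powr q" using p by (simp add: powr_mult)
      also have "\<dots> \<le> max 1 (2 powr q) * (\<rho> ^ k * r) powr q" by (intro mult_right_mono) auto
      finally show ?thesis .
    next
      case False
      then have "norm z powr q \<le> (\<rho> ^ k * r) powr q" using z p by (intro powr_mono2') auto
      also have "\<dots> \<le> max 1 (2 powr q) * (\<rho> ^ k * r) powr q"
        using mult_right_mono[of 1 "max 1 (2 powr q)" "(\<rho> ^ k * r) powr q"] by simp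
      finally show ?thesis .
    qed
  qed
  have shell: "(\<integral>\<^sup>+z. ennreal (norm z powr q * indicator (A k) z) \<partial>lborel) \<le> ennreal (C * (\<rho> powr (q + DIM('a))) ^ k)" for k
  proof -
    let ?m = "max 1 (2 powr q) * (\<rho> ^ k * r) powr q"
    have "(\<integral>\<^sup>+z. ennreal (norm z powr q * indicator (A k) z) \<partial>lborel)
       \<le> (\<integral>\<^sup>+z. ennreal ?m * indicator (cball (0::'a) (2 * \<rho> ^ k * r)) z \<partial>lborel)"
      using pt[of _ k] by (intro nn_integral_mono) (auto simp: indicator_def A_def intro!: ennreal_leI)
    also have "\<dots> = ennreal ?m * ennreal (unit_ball_vol DIM('a) * (2 * \<rho> ^ k * r) ^ DIM('a))"
      using \<rho> r by (simp add: nn_integral_cmult_indicator emeasure_cball)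
    also have "\<dots> = ennreal (?m * (unit_ball_vol DIM('a) * (2 * \<rho> ^ k * r) ^ DIM('a)))"
      using \<rho> r by (simp add: ennreal_mult' max_def)
    also have "?m * (unit_ball_vol DIM('a) * (2 * \<rho> ^ k * r) ^ DIM('a)) = C * (\<rho> powr (q + DIM('a))) ^ k"
    proof -
      have "(\<rho> ^ k * r) powr q = (\<rho> powr q) ^ k * r powr q"
        using \<rho> r by (simp add: powr_mult powr_realpow[symmetric] powr_powr mult.commute)
      moreover have "(2 * \<rho> ^ k * r) ^ DIM('a) = (2 * r) ^ DIM('a) * (\<rho> ^ DIM('a)) ^ k"
        by (simp add: power_mult_distrib power_mult[symmetric] mult.commute mult.left_commute)
      moreover have "\<rho> powr (q + DIM('a)) = \<rho> powr q * \<rho> ^ DIM('a)"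
        using \<rho> by (simp add: powr_add powr_realpow)
      ultimately show ?thesis by (simp add: C_def power_mult_distrib)
    qed
    finally show ?thesis .
  qed
  have "(\<integral>\<^sup>+z. ennreal (norm z powr q * indicator (\<Union>k. A k) z) \<partial>lborel)
     \<le> (\<integral>\<^sup>+z. (\<Sum>k. ennreal (norm z powr q * indicator (A k) z)) \<partial>lborel)"
  proof (rule nn_integral_mono)
    fix z :: 'a
    \<comment> \<open>Shells may overlap, so only an inequality is claimed; a single shell
      containing \<open>z\<close> already gives it.\<close>
    show "ennreal (norm z powr q * indicator (\<Union>k. A k) z) \<le> (\<Sum>k. ennreal (norm z powr q * indicator (A k) z))"
    proof (cases "z \<in> (\<Union>k. A k)")
      case True
      then obtain k where k: "z \<in> A k" by auto
      then have "indicator (\<Union>k. A k) z = (indicator (A k) z :: real)" by (auto simp: indicator_def)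
      moreover have "(\<Sum>k\<in>{k}. ennreal (norm z powr q * indicator (A k) z)) \<le> (\<Sum>k. ennreal (norm z powr q * indicator (A k) z))"
        by (rule sum_le_suminf) auto
      ultimately show ?thesis by (simp only: sum.insert sum.empty finite.intros empty_iff not_False_eq_True add_0_right)
    qed auto
  qed
  also have "\<dots> = (\<Sum>k. (\<integral>\<^sup>+z. ennreal (norm z powr q * indicator (A k) z) \<partial>lborel))"
    by (rule nn_integral_suminf) auto
  also have "\<dots> \<le> (\<Sum>k. ennreal (C * (\<rho> powr (q + DIM('a))) ^ k))"
    by (intro suminf_le shell) auto
  also have "\<dots> < \<infinity>"
    using lt1 C0 by (subst suminf_ennreal2) (auto intro!: summable_mult summable_geometric)
  finally have "integrable lborel (\<lambda>z::'a. norm z powr q * indicator (\<Union>k. A k) z)"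
    by (intro integrableI_bounded) (auto simp: abs_mult)
  then show ?thesis
    unfolding A_def[symmetric] by (subst integrable_completion) auto
qed

text \<open>Shells of ratio 1/2 exhaust the punctured ball, and the ratio of their series is below 1
  because \<open>q + n > 0\<close>. The centre lies in no shell, but \<open>0 powr q = 0\<close>
  there.\<close>

lemma norm_powr_integrable_ball:
  fixes q r :: real
  assumes r: "0 < r" and q: "- real DIM('a) < q"
  shows "integrable lebesgue (\<lambda>z::'a::euclidean_space. norm z powr q * indicator (cball 0 r) z)"
proof (rule Bochner_Integration.integrable_bound)
  show "integrable lebesgue (\<lambda>z::'a. norm z powr q *
     indicator (\<Union>k::nat. {z. (1/2) ^ k * r \<le> norm z \<and> norm z \<le> 2 * (1/2) ^ k * r}) z)"
    by (rule norm_powr_integrable_shells[OF _ r]) (use q powr01_less_one[of "1/2" "q + DIM('a)"] in simp_all)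
  have "\<exists>k. (1/2) ^ k * r \<le> norm z \<and> norm z \<le> 2 * (1/2) ^ k * r" if "z \<noteq> 0" "norm z \<le> r" for z :: 'a
  proof -
    have "\<exists>k. (1/2::real) ^ k < norm z / r" by (rule real_arch_pow_inv) (use that r in auto)
    then have ex: "\<exists>k. (1/2) ^ k * r \<le> norm z"
      using r by (auto simp: pos_less_divide_eq intro: less_imp_le)
    \<comment> \<open>Minimality of \<open>k\<close> supplies the outer bound of the shell; for
      \<open>k = 0\<close> that bound comes from the ball.\<close>
    define k where "k = (LEAST k. (1/2) ^ k * r \<le> norm z)"
    have k: "(1/2) ^ k * r \<le> norm z" unfolding k_def by (rule LeastI_ex[OF ex])
    have "norm z \<le> 2 * (1/2) ^ k * r"
    proof (cases k)
      case 0 then show ?thesis using that r by simp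
    next
      case (Suc m)
      then have "\<not> (1/2) ^ m * r \<le> norm z" using not_less_Least[of m "\<lambda>k. (1/2) ^ k * r \<le> norm z"] k_def by auto
      then show ?thesis using Suc by simp
    qed
    then show ?thesis using k by blast
  qed
  then show "AE z::'a in lebesgue. norm (norm z powr q * indicator (cball 0 r) z) \<le> norm (norm z powr q *
     indicator (\<Union>k::nat. {z. (1/2) ^ k * r \<le> norm z \<and> norm z \<le> 2 * (1/2) ^ k * r}) z)"
    by (intro AE_I2) (auto simp: indicator_def)
qed (intro measurable_completion borel_measurable_times borel_measurable_indicator, auto)

text \<open>Shells of ratio 2 starting at radius \<open>r\<close>; now
  \<open>2 powr (q + n) < 1\<close> because \<open>q + n < 0\<close>.\<close>

lemma norm_powr_integrable_outside:
  fixes q r :: real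
  assumes r: "0 < r" and q: "q < - real DIM('a)"
  shows "integrable lebesgue (\<lambda>z::'a::euclidean_space. norm z powr q * indicator {z. r \<le> norm z} z)"
proof (rule Bochner_Integration.integrable_bound)
  show "integrable lebesgue (\<lambda>z::'a. norm z powr q *
     indicator (\<Union>k::nat. {z. 2 ^ k * r \<le> norm z \<and> norm z \<le> 2 * 2 ^ k * r}) z)"
    by (rule norm_powr_integrable_shells[OF _ r]) (use q in \<open>auto intro!: powr_less_one\<close>)
  have "\<exists>k. 2 ^ k * r \<le> norm z \<and> norm z \<le> 2 * 2 ^ k * r" if "r \<le> norm z" for z :: 'a
  proof -
    have "\<exists>k. norm z / (2 * r) < 2 ^ k" by (rule real_arch_pow) auto
    then have ex: "\<exists>k. norm z \<le> 2 * 2 ^ k * r"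
      using r by (auto simp: pos_divide_less_eq mult_ac intro: less_imp_le)
    define k where "k = (LEAST k. norm z \<le> 2 * 2 ^ k * r)"
    have k: "norm z \<le> 2 * 2 ^ k * r" unfolding k_def by (rule LeastI_ex[OF ex])
    have "2 ^ k * r \<le> norm z"
    proof (cases k)
      case 0 then show ?thesis using that r by simp
    next
      case (Suc m)
      then have "\<not> norm z \<le> 2 * 2 ^ m * r" using not_less_Least[of m "\<lambda>k. norm z \<le> 2 * 2 ^ k * r"] k_def by auto
      then show ?thesis using Suc by simp
    qed
    then show ?thesis using k by blast
  qed
  then show "AE z::'a in lebesgue. norm (norm z powr q * indicator {z. r \<le> norm z} z) \<le> norm (norm z powr q *
     indicator (\<Union>k::nat. {z. 2 ^ k * r \<le> norm z \<and> norm z \<le> 2 * 2 ^ k * r}) z)"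
    by (intro AE_I2) (auto simp: indicator_def)
qed (auto intro!: measurable_completion)

lemma integrable_norm_powr_bounds:
  fixes f :: "'a::euclidean_space \<Rightarrow> real"
  assumes f: "f \<in> borel_measurable lebesgue" and "0 < r" "- real DIM('a) < p" "q < - real DIM('a)"
    and near: "AE z in lebesgue. norm z \<le> r \<longrightarrow> \<bar>f z\<bar> \<le> C * norm z powr p"
    and far: "AE z in lebesgue. r \<le> norm z \<longrightarrow> \<bar>f z\<bar> \<le> D * norm z powr q"
  shows "integrable lebesgue f"
proof (rule Bochner_Integration.integrable_bound)
  have "integrable lebesgue (\<lambda>z::'a. norm z powr p * indicator (cball 0 r) z)"
    "integrable lebesgue (\<lambda>z::'a. norm z powr q * indicator {z. r \<le> norm z} z)"
    using norm_powr_integrable_ball norm_powr_integrable_outside assms by blast+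
  then show "integrable lebesgue (\<lambda>z::'a. \<bar>C\<bar> * (norm z powr p * indicator (cball 0 r) z)
      + \<bar>D\<bar> * (norm z powr q * indicator {z. r \<le> norm z} z))"
    by simp
  show "AE z in lebesgue. norm (f z) \<le> norm (\<bar>C\<bar> * (norm z powr p * indicator (cball 0 r) z)
      + \<bar>D\<bar> * (norm z powr q * indicator {z. r \<le> norm z} z))"
    using near far
  proof eventually_elim
    case (elim z)
    have "C * norm z powr p \<le> \<bar>C\<bar> * norm z powr p" "D * norm z powr q \<le> \<bar>D\<bar> * norm z powr q"
      by (auto intro!: mult_right_mono)
    moreover have "0 \<le> \<bar>C\<bar> * norm z powr p" "0 \<le> \<bar>D\<bar> * norm z powr q" by auto
    ultimately show ?case using elim by (auto simp: indicator_def)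
  qed
qed (use f in auto)

section \<open>Second differences of powers of the norm\<close>

text \<open>Order four is what the second difference requires: there \<open>x\<close> has the size
  of \<open>norm v / norm z\<close>, and the error has to be of the fourth power of this
  ratio.\<close>

lemma one_plus_powr_taylor:
  fixes \<beta> :: real
  shows "\<exists>C\<ge>0. \<forall>x. \<bar>x\<bar> \<le> 1/2 \<longrightarrow>
    \<bar>(1 + x) powr \<beta> - (1 + \<beta> * x + \<beta> * (\<beta> - 1) / 2 * x ^ 2 + \<beta> * (\<beta> - 1) * (\<beta> - 2) / 6 * x ^ 3)\<bar> \<le> C * x ^ 4"
proof -
  define d :: "nat \<Rightarrow> real \<Rightarrow> real" where "d m t = (\<Prod>i<m. \<beta> - real i) * (1 + t) powr (\<beta> - real m)" for m t
  \<comment> \<open>Lagrange remainder: fourth derivative over 4!. For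
    \<open>\<bar>t\<bar> \<le> 1/2\<close> the base \<open>1 + t\<close> lies between 1/2 and 2, and
    the absolute value in the exponent serves both signs of \<open>\<beta> - 4\<close>.\<close>
  define D where "D = \<bar>\<Prod>i<4. \<beta> - real i\<bar> / 24 * 2 powr \<bar>\<beta> - 4\<bar>"
  have der: "(d m has_real_derivative d (Suc m) t) (at t)" if "- (1/2) \<le> t" for m t
    unfolding d_def using that by (auto intro!: derivative_eq_intros simp: algebra_simps)
  have bnd: "(1 + t) powr (\<beta> - 4) \<le> 2 powr \<bar>\<beta> - 4\<bar>" if "- (1/2) \<le> t" "t \<le> 1/2" for t
  proof (cases "0 \<le> \<beta> - 4")
    case True
    then show ?thesis using that by (intro order_trans[OF powr_mono2[of "\<beta> - 4" "1 + t" 2]]) auto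
  next
    case False
    then have "(1 + t) powr (\<beta> - 4) \<le> (1/2) powr (\<beta> - 4)" using that by (intro powr_mono2') auto
    also have "\<dots> = 2 powr \<bar>\<beta> - 4\<bar>" using False by (simp add: powr_divide powr_minus_divide[symmetric])
    finally show ?thesis .
  qed
  have "\<bar>(1 + x) powr \<beta> - (1 + \<beta> * x + \<beta> * (\<beta> - 1) / 2 * x ^ 2 + \<beta> * (\<beta> - 1) * (\<beta> - 2) / 6 * x ^ 3)\<bar> \<le> D * x ^ 4"
    if x: "\<bar>x\<bar> \<le> 1/2" for x
  proof (cases "x = 0")
    case True then show ?thesis by simp
  next
    case False
    have "\<exists>t. (if x < 0 then x < t \<and> t < 0 else 0 < t \<and> t < x) \<and>
        (1 + x) powr \<beta> = (\<Sum>m<4. d m 0 / fact m * (x - 0) ^ m) + d 4 t / fact 4 * (x - 0) ^ 4"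
      by (rule Taylor[where a = "-1/2" and b = "1/2"]) (use x False in \<open>auto intro: der simp del: of_nat_Suc, auto simp: d_def\<close>)
    then obtain t where t0: "if x < 0 then x < t \<and> t < 0 else 0 < t \<and> t < x" and
      eq: "(1 + x) powr \<beta> = (\<Sum>m<4. d m 0 / fact m * x ^ m) + d 4 t / fact 4 * x ^ 4"
      by auto
    have t: "\<bar>t\<bar> \<le> 1/2" using t0 x by (auto split: if_splits)
    have s: "(\<Sum>m<4. d m 0 / fact m * x ^ m)
        = 1 + \<beta> * x + \<beta> * (\<beta> - 1) / 2 * x ^ 2 + \<beta> * (\<beta> - 1) * (\<beta> - 2) / 6 * x ^ 3"
      by (simp add: d_def numeral_eq_Suc)
    have "\<bar>d 4 t / fact 4 * x ^ 4\<bar> \<le> D * x ^ 4"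
    proof -
      have "\<bar>d 4 t / fact 4 * x ^ 4\<bar> = \<bar>\<Prod>i<4. \<beta> - real i\<bar> / 24 * (1 + t) powr (\<beta> - 4) * x ^ 4"
        by (simp add: d_def abs_mult fact_numeral)
      also have "\<dots> \<le> D * x ^ 4"
        unfolding D_def using bnd[of t] t by (intro mult_right_mono mult_left_mono) auto
      finally show ?thesis .
    qed
    then show ?thesis unfolding eq s by simp
  qed
  moreover have "0 \<le> D" by (simp add: D_def)
  ultimately show ?thesis by blast
qed

definition second_diff :: "('a::real_vector \<Rightarrow> real) \<Rightarrow> 'a \<Rightarrow> 'a \<Rightarrow> real" where
  "second_diff f v z = f (z + v) + f (z - v) - 2 * f z"

text \<open>With \<open>r\<close>, \<open>a\<close>, \<open>b\<close> as in the proof, the squared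
  norms of \<open>z + v\<close> and \<open>z - v\<close> are \<open>r^2 * (1 + (b + a))\<close> and
  \<open>r^2 * (1 + (b - a))\<close>. When the two Taylor polynomials are added, odd powers of
  \<open>a\<close> cancel; the terms linear in \<open>b\<close> and quadratic in \<open>a\<close>
  are the two main terms, and all others are of order \<open>(norm v / r) ^ 4\<close>. The factor 8
  keeps the arguments below 1/2 in modulus.\<close>

lemma second_diff_norm_powr_expansion:
  fixes v :: "'a::euclidean_space" and \<gamma> :: real
  shows "\<exists>C\<ge>0. \<forall>z. 0 < norm z \<and> 8 * norm v \<le> norm z \<longrightarrow>
    \<bar>second_diff (\<lambda>z. norm z powr \<gamma>) v z
      - (\<gamma> * (norm v)\<^sup>2 * norm z powr (\<gamma> - 2) + \<gamma> * (\<gamma> - 2) * (z \<bullet> v)\<^sup>2 * norm z powr (\<gamma> - 4))\<bar>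
    \<le> C * norm z powr (\<gamma> - 4)"
proof -
  define \<beta> where "\<beta> = \<gamma> / 2"
  define k where "k = \<beta> * (\<beta> - 1) * (\<beta> - 2) / 6"
  define P where "P x = 1 + \<beta> * x + \<beta> * (\<beta> - 1) / 2 * x ^ 2 + k * x ^ 3" for x :: real
  obtain C where C: "0 \<le> C" "\<And>x. \<bar>x\<bar> \<le> 1/2 \<Longrightarrow> \<bar>(1 + x) powr \<beta> - P x\<bar> \<le> C * x ^ 4"
    using one_plus_powr_taylor[of \<beta>] unfolding P_def k_def by blast
  \<comment> \<open>In terms of \<open>T = norm v / norm z\<close>: \<open>b^2 = T ^ 4\<close> gives
    the first summand; \<open>2 * b ^ 3\<close> and \<open>6 * a^2 * b\<close> are at most
    \<open>2 * T ^ 4\<close> and \<open>24 * T ^ 4\<close>, which makes 26; the two Taylor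
    remainders at arguments up to \<open>3 * T\<close> give 81 each, which makes 162.\<close>
  define E where "E = (\<bar>\<beta> * (\<beta> - 1)\<bar> + 26 * \<bar>k\<bar> + 162 * C) * norm v ^ 4"
  have "\<bar>second_diff (\<lambda>z. norm z powr \<gamma>) v z
      - (\<gamma> * (norm v)\<^sup>2 * norm z powr (\<gamma> - 2) + \<gamma> * (\<gamma> - 2) * (z \<bullet> v)\<^sup>2 * norm z powr (\<gamma> - 4))\<bar>
    \<le> E * norm z powr (\<gamma> - 4)" if z: "0 < norm z" "8 * norm v \<le> norm z" for z
  proof -
    define r where "r = norm z"
    define T where "T = norm v / r"
    define a where "a = 2 * (z \<bullet> v) / r\<^sup>2"
    define b where "b = (norm v)\<^sup>2 / r\<^sup>2"
    have r: "0 < r" using z by (simp add: r_def)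
    have T: "0 \<le> T" "T \<le> 1/8" using z r by (auto simp: T_def r_def field_simps)
    have b: "b = T\<^sup>2" by (simp add: b_def T_def power_divide)
    have aT: "\<bar>a\<bar> \<le> 2 * T"
    proof -
      have "\<bar>z \<bullet> v\<bar> \<le> r * norm v" unfolding r_def by (rule Cauchy_Schwarz_ineq2)
      then have "2 * \<bar>z \<bullet> v\<bar> / r\<^sup>2 \<le> 2 * (r * norm v) / r\<^sup>2" by (intro divide_right_mono) auto
      then show ?thesis using r by (simp add: a_def T_def abs_mult power2_eq_square)
    qed
    have T2: "T\<^sup>2 \<le> T * (1/8)" unfolding power2_eq_square using T by (intro mult_left_mono) auto
    have ab: "\<bar>b + a\<bar> \<le> 3 * T" "\<bar>b - a\<bar> \<le> 3 * T" unfolding b using aT T T2 zero_le_power2[of T] by linarith+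
    have ab2: "\<bar>b + a\<bar> \<le> 1/2" "\<bar>b - a\<bar> \<le> 1/2" using ab T by auto
    have pw: "norm w powr \<gamma> = r powr \<gamma> * (1 + x) powr \<beta>" if "(norm w)\<^sup>2 = r\<^sup>2 * (1 + x)" "\<bar>x\<bar> \<le> 1/2" for w :: 'a and x
    proof -
      have "norm w powr \<gamma> = (norm w powr 2) powr \<beta>" by (simp only: \<beta>_def powr_powr) simp
      also have "\<dots> = ((norm w)\<^sup>2) powr \<beta>" by (cases "w = 0") (simp_all add: powr_numeral)
      also have "\<dots> = (r\<^sup>2) powr \<beta> * (1 + x) powr \<beta>" using that by (simp add: powr_mult)
      also have "(r\<^sup>2) powr \<beta> = r powr \<gamma>" using r by (simp add: \<beta>_def powr_powr flip: powr_numeral)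
      finally show ?thesis .
    qed
    have "(norm (z + v))\<^sup>2 = r\<^sup>2 * (1 + (b + a))"
      unfolding r_def a_def b_def using r
      by (simp add: r_def power2_norm_eq_inner inner_add_left inner_add_right inner_commute field_simps)
    then have p1: "norm (z + v) powr \<gamma> = r powr \<gamma> * (1 + (b + a)) powr \<beta>" using pw ab2 by blast
    have "(norm (z - v))\<^sup>2 = r\<^sup>2 * (1 + (b - a))"
      unfolding r_def a_def b_def using r
      by (simp add: r_def power2_norm_eq_inner inner_diff_left inner_diff_right inner_commute field_simps)
    then have p2: "norm (z - v) powr \<gamma> = r powr \<gamma> * (1 + (b - a)) powr \<beta>" using pw ab2 by blast
    have q1: "\<gamma> * (norm v)\<^sup>2 * norm z powr (\<gamma> - 2) = r powr \<gamma> * (2 * \<beta> * b)"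
      using r by (simp add: r_def[symmetric] b_def \<beta>_def powr_diff)
    have q2: "\<gamma> * (\<gamma> - 2) * (z \<bullet> v)\<^sup>2 * norm z powr (\<gamma> - 4) = r powr \<gamma> * (\<beta> * (\<beta> - 1) * a\<^sup>2)"
      using r by (simp add: r_def[symmetric] a_def \<beta>_def powr_diff power_divide power_mult_distrib field_simps)
    have poly: "P (b + a) + P (b - a) - 2 = 2 * \<beta> * b + \<beta> * (\<beta> - 1) * a\<^sup>2 + (\<beta> * (\<beta> - 1) * b\<^sup>2 + k * (2 * b ^ 3 + 6 * a\<^sup>2 * b))"
      unfolding P_def by (simp add: power2_eq_square power3_eq_cube field_simps)
    have a2: "a\<^sup>2 \<le> 4 * T\<^sup>2" using power_mono[OF aT, of 2] by (simp add: power_mult_distrib)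
    have b2: "b\<^sup>2 = T ^ 4" using b by (simp flip: power_mult)
    have b3: "0 \<le> b ^ 3" "b ^ 3 \<le> T ^ 4"
    proof -
      have "b ^ 3 = T ^ 4 * T\<^sup>2" using b by (simp flip: power_mult power_add)
      also have "\<dots> \<le> T ^ 4 * 1" using T T2 by (intro mult_left_mono) auto
      finally show "b ^ 3 \<le> T ^ 4" by simp
      show "0 \<le> b ^ 3" using b by simp
    qed
    have a2b: "0 \<le> a\<^sup>2 * b" "a\<^sup>2 * b \<le> 4 * T ^ 4"
    proof -
      have "a\<^sup>2 * b \<le> 4 * T\<^sup>2 * T\<^sup>2" unfolding b using a2 by (intro mult_right_mono) auto
      then show "a\<^sup>2 * b \<le> 4 * T ^ 4" by (simp add: power4_eq_xxxx power2_eq_square mult_ac)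
    qed (simp add: b)
    have pw4: "C * x ^ 4 \<le> 81 * C * T ^ 4" if "\<bar>x\<bar> \<le> 3 * T" for x
    proof -
      have "x ^ 4 \<le> (3 * T) ^ 4" using power_mono[OF that, of 4] by simp
      then show ?thesis using mult_left_mono[of "x ^ 4" "81 * T ^ 4" C] C(1) by (simp add: power_mult_distrib)
    qed
    have e1: "\<bar>(1 + (b + a)) powr \<beta> - P (b + a)\<bar> \<le> 81 * C * T ^ 4"
      and e2: "\<bar>(1 + (b - a)) powr \<beta> - P (b - a)\<bar> \<le> 81 * C * T ^ 4"
      using C(2) ab2 pw4 ab by (meson order_trans)+
    have e3: "\<bar>\<beta> * (\<beta> - 1) * b\<^sup>2\<bar> \<le> \<bar>\<beta> * (\<beta> - 1)\<bar> * T ^ 4" by (simp add: b2 abs_mult)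
    have e4: "\<bar>k * (2 * b ^ 3 + 6 * a\<^sup>2 * b)\<bar> \<le> 26 * \<bar>k\<bar> * T ^ 4"
    proof -
      have "\<bar>k * (2 * b ^ 3 + 6 * a\<^sup>2 * b)\<bar> = \<bar>k\<bar> * (2 * b ^ 3 + 6 * (a\<^sup>2 * b))"
        using b3 a2b by (simp add: abs_mult)
      also have "\<dots> \<le> \<bar>k\<bar> * (26 * T ^ 4)" using b3 a2b by (intro mult_left_mono) auto
      finally show ?thesis by simp
    qed
    define X where "X = (1 + (b + a)) powr \<beta> + (1 + (b - a)) powr \<beta> - 2 - (2 * \<beta> * b + \<beta> * (\<beta> - 1) * a\<^sup>2)"
    have X: "\<bar>X\<bar> \<le> (\<bar>\<beta> * (\<beta> - 1)\<bar> + 26 * \<bar>k\<bar> + 162 * C) * T ^ 4"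
      unfolding X_def distrib_right using e1 e2 e3 e4 poly by linarith
    have "second_diff (\<lambda>z. norm z powr \<gamma>) v z
      - (\<gamma> * (norm v)\<^sup>2 * norm z powr (\<gamma> - 2) + \<gamma> * (\<gamma> - 2) * (z \<bullet> v)\<^sup>2 * norm z powr (\<gamma> - 4)) = r powr \<gamma> * X"
      unfolding second_diff_def p1 p2 q1 q2 X_def by (simp add: r_def[symmetric] algebra_simps)
    then have "\<bar>second_diff (\<lambda>z. norm z powr \<gamma>) v z
      - (\<gamma> * (norm v)\<^sup>2 * norm z powr (\<gamma> - 2) + \<gamma> * (\<gamma> - 2) * (z \<bullet> v)\<^sup>2 * norm z powr (\<gamma> - 4))\<bar> = r powr \<gamma> * \<bar>X\<bar>"
      by (simp add: abs_mult)
    also have "\<dots> \<le> r powr \<gamma> * ((\<bar>\<beta> * (\<beta> - 1)\<bar> + 26 * \<bar>k\<bar> + 162 * C) * T ^ 4)"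
      using X by (intro mult_left_mono) auto
    also have "\<dots> = E * norm z powr (\<gamma> - 4)"
      using r by (simp add: E_def T_def r_def[symmetric] powr_diff power_divide)
    finally show ?thesis .
  qed
  moreover have "0 \<le> E" unfolding E_def using C by simp
  ultimately show ?thesis by blast
qed

text \<open>Cauchy-Schwarz bounds both main terms of the expansion by the power
  \<open>\<gamma> - 2\<close>; the added 1 forces \<open>norm z \<ge> 1\<close>, so that the
  remainder with power \<open>\<gamma> - 4\<close> is dominated too.\<close>

lemma second_diff_norm_powr_decay:
  fixes v :: "'a::euclidean_space" and \<gamma> :: real
  shows "\<exists>C\<ge>0. \<forall>z. 1 + 8 * norm v \<le> norm z \<longrightarrow>
    \<bar>second_diff (\<lambda>z. norm z powr \<gamma>) v z\<bar> \<le> C * norm z powr (\<gamma> - 2)"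
proof -
  obtain C where C: "0 \<le> C" "\<And>z::'a. 0 < norm z \<Longrightarrow> 8 * norm v \<le> norm z \<Longrightarrow>
    \<bar>second_diff (\<lambda>z. norm z powr \<gamma>) v z
      - (\<gamma> * (norm v)\<^sup>2 * norm z powr (\<gamma> - 2) + \<gamma> * (\<gamma> - 2) * (z \<bullet> v)\<^sup>2 * norm z powr (\<gamma> - 4))\<bar>
    \<le> C * norm z powr (\<gamma> - 4)"
    using second_diff_norm_powr_expansion[of v \<gamma>] by blast
  define D where "D = \<bar>\<gamma>\<bar> * (norm v)\<^sup>2 + \<bar>\<gamma> * (\<gamma> - 2)\<bar> * (norm v)\<^sup>2 + C"
  have "\<bar>second_diff (\<lambda>z. norm z powr \<gamma>) v z\<bar> \<le> D * norm z powr (\<gamma> - 2)" if z: "1 + 8 * norm v \<le> norm z" for z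
  proof -
    have z1: "1 \<le> norm z" "8 * norm v \<le> norm z" using z norm_ge_zero[of v] by linarith+
    then have "norm z > 0" by linarith
    have sq: "norm z powr (\<gamma> - 2) = (norm z)\<^sup>2 * norm z powr (\<gamma> - 4)"
      using z1 powr_add[of "norm z" "\<gamma> - 4" 2] by (simp add: mult.commute)
    have c1: "(z \<bullet> v)\<^sup>2 \<le> (norm v)\<^sup>2 * (norm z)\<^sup>2"
      using Cauchy_Schwarz_ineq[of z v] by (simp add: power2_norm_eq_inner mult.commute)
    have "\<bar>\<gamma> * (\<gamma> - 2) * (z \<bullet> v)\<^sup>2 * norm z powr (\<gamma> - 4)\<bar> = \<bar>\<gamma> * (\<gamma> - 2)\<bar> * (z \<bullet> v)\<^sup>2 * norm z powr (\<gamma> - 4)"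
      by (simp add: abs_mult)
    also have "\<dots> \<le> \<bar>\<gamma> * (\<gamma> - 2)\<bar> * ((norm v)\<^sup>2 * (norm z)\<^sup>2) * norm z powr (\<gamma> - 4)"
      using c1 by (intro mult_right_mono mult_left_mono) auto
    finally have t2: "\<bar>\<gamma> * (\<gamma> - 2) * (z \<bullet> v)\<^sup>2 * norm z powr (\<gamma> - 4)\<bar> \<le> \<bar>\<gamma> * (\<gamma> - 2)\<bar> * (norm v)\<^sup>2 * norm z powr (\<gamma> - 2)"
      by (simp add: sq mult_ac)
    have t1: "\<bar>\<gamma> * (norm v)\<^sup>2 * norm z powr (\<gamma> - 2)\<bar> = \<bar>\<gamma>\<bar> * (norm v)\<^sup>2 * norm z powr (\<gamma> - 2)"
      by (simp add: abs_mult)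
    have t3: "C * norm z powr (\<gamma> - 4) \<le> C * norm z powr (\<gamma> - 2)"
      using C(1) z1 by (intro mult_left_mono powr_mono) auto
    show ?thesis
      using C(2)[OF \<open>norm z > 0\<close> z1(2)] t1 t2 t3 unfolding D_def distrib_right by linarith
  qed
  moreover have "0 \<le> D" unfolding D_def using C by simp
  ultimately show ?thesis by blast
qed

section \<open>Integrability and integral of second differences\<close>

lemma norm_powr_translate_integrable_cball:
  fixes p :: "'a::euclidean_space"
  assumes "- real DIM('a) < q"
  shows "integrable lebesgue (\<lambda>z. norm (z - p) powr q * indicator (cball 0 r) z)"
proof -
  \<comment> \<open>The ball recentred at the singularity \<open>p\<close> has to contain the
    original one; the absolute value and the 1 keep its radius positive for every
    \<open>r\<close>.\<close>
  define R where "R = \<bar>r\<bar> + norm p + 1"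
  have "0 < R" by (simp add: R_def add_nonneg_pos)
  then have "integrable lebesgue (\<lambda>z::'a. norm z powr q * indicator (cball 0 R) z)"
    by (rule norm_powr_integrable_ball[OF _ assms])
  from integrable_scale_translate[OF this, of 1 "- p"]
  have i: "integrable lebesgue (\<lambda>z. norm (z - p) powr q * indicator (cball 0 R) (z - p))" by simp
  show ?thesis
  proof (rule Bochner_Integration.integrable_bound[OF i])
    have "norm (z - p) \<le> R" if "norm z \<le> r" for z
      using norm_triangle_ineq4[of z p] that by (simp add: R_def)
    then show "AE z in lebesgue. norm (norm (z - p) powr q * indicator (cball 0 r) z) \<le> norm (norm (z - p) powr q * indicator (cball 0 R) (z - p))"
      by (intro AE_I2) (auto simp: indicator_def)
    show "(\<lambda>z. norm (z - p) powr q * indicator (cball 0 r) z) \<in> borel_measurable lebesgue"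
      by (intro measurable_completion borel_measurable_times borel_measurable_indicator) auto
  qed
qed

lemma borel_measurable_second_diff_norm_powr [measurable]:
  "second_diff (\<lambda>z::'a::euclidean_space. norm z powr \<gamma>) v \<in> borel_measurable borel"
  unfolding second_diff_def[abs_def] by measurable

text \<open>Near 0 and the two shifted singularities each power is integrable because
  \<open>\<gamma> > - n\<close>. At infinity no single one is; only the two orders gained by the
  difference help, since \<open>\<gamma> - 2 < - n\<close>.\<close>

lemma second_diff_norm_powr_integrable:
  fixes v :: "'a::euclidean_space"
  assumes "- real DIM('a) < \<gamma>" "\<gamma> < 2 - real DIM('a)"
  shows "integrable lebesgue (second_diff (\<lambda>z. norm z powr \<gamma>) v)"
proof -
  define r where "r = 1 + 8 * norm v"
  obtain C where C: "0 \<le> C" "\<And>z. r \<le> norm z \<Longrightarrow> \<bar>second_diff (\<lambda>z. norm z powr \<gamma>) v z\<bar> \<le> C * norm z powr (\<gamma> - 2)"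
    using second_diff_norm_powr_decay[of v \<gamma>] r_def by blast
  have m: "second_diff (\<lambda>z. norm z powr \<gamma>) v \<in> borel_measurable lebesgue"
    by (intro measurable_completion) simp
  let ?I = "\<lambda>w z. norm (z - w) powr \<gamma> * indicator (cball 0 r) z"
  have i1: "integrable lebesgue (\<lambda>z. ?I (- v) z + ?I v z + 2 * ?I 0 z)"
    by (intro Bochner_Integration.integrable_add integrable_mult_right norm_powr_translate_integrable_cball assms)
  have i2: "integrable lebesgue (\<lambda>z. C * (norm z powr (\<gamma> - 2) * indicator {z::'a. r \<le> norm z} z))"
    by (intro integrable_mult_right norm_powr_integrable_outside) (use assms in \<open>auto simp: r_def add_pos_nonneg\<close>)
  show ?thesis
  proof (rule Bochner_Integration.integrable_bound[OF Bochner_Integration.integrable_add[OF i1 i2] m], rule AE_I2)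
    fix z :: 'a
    show "norm (second_diff (\<lambda>z. norm z powr \<gamma>) v z) \<le> norm ((?I (- v) z + ?I v z + 2 * ?I 0 z) + C * (norm z powr (\<gamma> - 2) * indicator {z. r \<le> norm z} z))"
    proof (cases "r \<le> norm z")
      case True
      then have "\<bar>second_diff (\<lambda>z. norm z powr \<gamma>) v z\<bar> \<le> C * norm z powr (\<gamma> - 2)" using C by blast
      moreover have "0 \<le> ?I (- v) z + ?I v z + 2 * ?I 0 z" by simp
      moreover have e: "indicator {z. r \<le> norm z} z = (1::real)" using True by simp
      ultimately show ?thesis unfolding e real_norm_def by linarith
    next
      case False
      then have "(?I (- v) z + ?I v z + 2 * ?I 0 z) + C * (norm z powr (\<gamma> - 2) * indicator {z. r \<le> norm z} z)
        = norm (z + v) powr \<gamma> + norm (z - v) powr \<gamma> + 2 * norm z powr \<gamma>" by (simp add: indicator_def)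
      moreover have "\<bar>second_diff (\<lambda>z. norm z powr \<gamma>) v z\<bar> \<le> norm (z + v) powr \<gamma> + norm (z - v) powr \<gamma> + 2 * norm z powr \<gamma>"
        unfolding second_diff_def using powr_ge_zero[of "norm (z + v)" \<gamma>] powr_ge_zero[of "norm (z - v)" \<gamma>] powr_ge_zero[of "norm z" \<gamma>]
        by linarith
      ultimately show ?thesis by (metis real_norm_def abs_ge_self order_trans)
    qed
  qed
qed

lemma second_diff_norm_powr_scale:
  assumes "0 < h"
  shows "second_diff (\<lambda>z::'a::real_normed_vector. norm z powr \<gamma>) (h *\<^sub>R v) (h *\<^sub>R z) = h powr \<gamma> * second_diff (\<lambda>z. norm z powr \<gamma>) v z"
  using assms unfolding second_diff_def scaleR_add_right[symmetric] scaleR_diff_right[symmetric]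
  by (simp add: powr_mult right_diff_distrib distrib_left)

text \<open>The second difference in direction \<open>2 v\<close> is a sum of four translates of the one in direction
  \<open>v\<close>, but by homogeneity its integral is only \<open>2 powr (n + \<gamma>) < 4\<close> times as large.\<close>

lemma second_diff_norm_powr_integral_zero:
  fixes v :: "'a::euclidean_space"
  assumes \<gamma>: "- real DIM('a) < \<gamma>" "\<gamma> < 2 - real DIM('a)"
  shows "(LINT z|lebesgue. second_diff (\<lambda>z. norm z powr \<gamma>) v z) = 0"
proof -
  let ?F = "\<lambda>v::'a. second_diff (\<lambda>z. norm z powr \<gamma>) v"
  have i: "integrable lebesgue (?F v)" for v by (rule second_diff_norm_powr_integrable[OF \<gamma>])
  have m: "?F v \<in> borel_measurable lebesgue" for v using i by auto
  have it: "integrable lebesgue (\<lambda>z. ?F v (z + w))" for w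
    using integrable_scale_translate[OF i[of v], of 1 w] by (simp add: add.commute)
  have tr: "(LINT z|lebesgue. ?F v (z + w)) = (LINT z|lebesgue. ?F v z)" for w
    using integral_scale_translate[OF m, of 1 v w] by (simp add: add.commute)
  have "?F (2 *\<^sub>R v) z = ?F v (z + v) + 2 * ?F v z + ?F v (z - v)" for z
    by (simp add: second_diff_def scaleR_2 algebra_simps)
  then have "(LINT z|lebesgue. ?F (2 *\<^sub>R v) z) = (LINT z|lebesgue. ?F v (z + v) + 2 * ?F v z + ?F v (z + - v))"
    by simp
  also have "\<dots> = (LINT z|lebesgue. ?F v (z + v)) + 2 * (LINT z|lebesgue. ?F v z) + (LINT z|lebesgue. ?F v (z + - v))"
    using i it by (simp del: add_uminus_conv_diff)
  finally have four: "(LINT z|lebesgue. ?F (2 *\<^sub>R v) z) = 4 * (LINT z|lebesgue. ?F v z)"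
    by (simp only: tr)
  have "(LINT z|lebesgue. ?F (2 *\<^sub>R v) z) = 2 ^ DIM('a) * (LINT z|lebesgue. ?F (2 *\<^sub>R v) (2 *\<^sub>R z))"
    using integral_scale_translate[OF m, of 2 "2 *\<^sub>R v" 0] by simp
  also have "\<dots> = 2 ^ DIM('a) * (2 powr \<gamma> * (LINT z|lebesgue. ?F v z))"
    by (simp add: second_diff_norm_powr_scale)
  also have "\<dots> = 2 powr (DIM('a) + \<gamma>) * (LINT z|lebesgue. ?F v z)"
    by (simp add: powr_add powr_realpow)
  finally have "(4 - 2 powr (DIM('a) + \<gamma>)) * (LINT z|lebesgue. ?F v z) = 0"
    using four by (simp add: algebra_simps)
  \<comment> \<open>Strictness matters: for \<open>n = 1\<close> and \<open>\<gamma> = 1\<close> the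
    second difference with \<open>v \<noteq> 0\<close> is a tent function, whose integral is
    positive.\<close>
  moreover have "2 powr (DIM('a) + \<gamma>) < 2 powr 2" using \<gamma> by (intro powr_less_mono) auto
  ultimately show ?thesis by simp
qed

section \<open>Isotropic stencils\<close>

text \<open>The weighted second moments are those of the identity, so the weighted sum of second
  derivatives along the stencil vectors is the Laplacian. One vector of each opposite pair suffices,
  because \<open>second_diff\<close> uses both signs.\<close>

locale isotropic_stencil =
  fixes S :: "'a::euclidean_space set" and a :: "'a \<Rightarrow> real"
  assumes finite_S: "finite S"
    and isotropic: "\<And>z. (\<Sum>v\<in>S. a v * (z \<bullet> v)\<^sup>2) = (norm z)\<^sup>2"
begin

text \<open>The trace of the quadratic form in \<open>isotropic\<close>, computed on the basis
  vectors.\<close>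

lemma sum_weights_norm: "(\<Sum>v\<in>S. a v * (norm v)\<^sup>2) = DIM('a)"
proof -
  have "(norm v)\<^sup>2 = (\<Sum>b\<in>Basis. (b \<bullet> v)\<^sup>2)" for v :: 'a
    unfolding power2_norm_eq_inner by (subst euclidean_inner) (simp add: power2_eq_square inner_commute)
  then have "(\<Sum>v\<in>S. a v * (norm v)\<^sup>2) = (\<Sum>v\<in>S. \<Sum>b\<in>Basis. a v * (b \<bullet> v)\<^sup>2)"
    by (simp add: sum_distrib_left)
  also have "\<dots> = (\<Sum>b\<in>Basis. \<Sum>v\<in>S. a v * (b \<bullet> v)\<^sup>2)" by (rule sum.swap)
  also have "\<dots> = DIM('a)" by (simp add: isotropic)
  finally show ?thesis .
qed

text \<open>This is \<open>h^2\<close> times the discrete Laplacian of the Riesz kernel. The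
  division is left out so that rescaling yields the single factor
  \<open>h powr \<gamma>\<close>.\<close>

definition kernel :: "real \<Rightarrow> real \<Rightarrow> 'a \<Rightarrow> real" where
  "kernel \<gamma> h z = (\<Sum>v\<in>S. a v * second_diff (\<lambda>z. norm z powr \<gamma>) (h *\<^sub>R v) z)"

lemma kernel_minus: "kernel \<gamma> h (- z) = kernel \<gamma> h z"
proof -
  have "norm (- z + w) = norm (z - w)" "norm (- z - w) = norm (z + w)" for w
  proof -
    have "- z + w = - (z - w)" "- z - w = - (z + w)" by simp_all
    then show "norm (- z + w) = norm (z - w)" "norm (- z - w) = norm (z + w)" by (simp_all only: norm_minus_cancel)
  qed
  then show ?thesis by (simp add: kernel_def second_diff_def add.commute)
qed

lemma kernel_scale:
  assumes "0 < h"
  shows "kernel \<gamma> h (h *\<^sub>R z) = h powr \<gamma> * kernel \<gamma> 1 z"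
  unfolding kernel_def using assms by (simp add: second_diff_norm_powr_scale sum_distrib_left mult_ac)

lemma borel_measurable_kernel [measurable]: "kernel \<gamma> h \<in> borel_measurable borel"
  unfolding kernel_def[abs_def] by measurable

lemma kernel_integrable:
  assumes "- real DIM('a) < \<gamma>" "\<gamma> < 2 - real DIM('a)"
  shows "integrable lebesgue (kernel \<gamma> h)"
  unfolding kernel_def[abs_def] using second_diff_norm_powr_integrable[OF assms] by simp

lemma kernel_integral_zero:
  assumes "- real DIM('a) < \<gamma>" "\<gamma> < 2 - real DIM('a)"
  shows "(LINT z|lebesgue. kernel \<gamma> h z) = 0"
  unfolding kernel_def
  using second_diff_norm_powr_integrable[OF assms] second_diff_norm_powr_integral_zero[OF assms]
  by (simp add: Bochner_Integration.integral_sum)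

text \<open>Isotropy and its trace collapse the main terms of all expansions to the exact Laplacian
  of \<open>norm z powr \<gamma>\<close>, so only the remainders are left.\<close>

lemma kernel_far:
  shows "\<exists>C R. 0 \<le> C \<and> 0 < R \<and> (\<forall>z. R \<le> norm z \<longrightarrow>
    \<bar>\<gamma> * (\<gamma> + real DIM('a) - 2) * norm z powr (\<gamma> - 2) - kernel \<gamma> 1 z\<bar> \<le> C * norm z powr (\<gamma> - 4))"
proof -
  let ?T = "\<lambda>v z. \<gamma> * (norm v)\<^sup>2 * norm z powr (\<gamma> - 2) + \<gamma> * (\<gamma> - 2) * (z \<bullet> v)\<^sup>2 * norm z powr (\<gamma> - 4)"
  obtain C where C0: "\<And>v. 0 \<le> C v" and C: "\<And>v z::'a. 0 < norm z \<Longrightarrow> 8 * norm v \<le> norm z \<Longrightarrow>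
    \<bar>second_diff (\<lambda>z. norm z powr \<gamma>) v z - ?T v z\<bar> \<le> C v * norm z powr (\<gamma> - 4)"
    using second_diff_norm_powr_expansion[where 'a = 'a and \<gamma> = \<gamma>] by metis
  \<comment> \<open>The sum dominates every \<open>8 * norm v\<close>, and the 1 keeps
    \<open>z\<close> away from 0.\<close>
  define R where "R = 1 + (\<Sum>v\<in>S. 8 * norm v)"
  define D where "D = (\<Sum>v\<in>S. \<bar>a v\<bar> * C v)"
  have "\<bar>\<gamma> * (\<gamma> + real DIM('a) - 2) * norm z powr (\<gamma> - 2) - kernel \<gamma> 1 z\<bar> \<le> D * norm z powr (\<gamma> - 4)"
    if z: "R \<le> norm z" for z
  proof -
    have "0 \<le> (\<Sum>v\<in>S. 8 * norm v)" by (intro sum_nonneg) auto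
    then have z0: "0 < norm z" using z unfolding R_def by linarith
    have zv: "8 * norm v \<le> norm z" if "v \<in> S" for v
      using member_le_sum[OF that, of "\<lambda>v. 8 * norm v"] finite_S z by (simp add: R_def)
    have sq: "(norm z)\<^sup>2 * norm z powr (\<gamma> - 4) = norm z powr (\<gamma> - 2)"
      using z0 powr_add[of "norm z" "\<gamma> - 4" 2] by (simp add: mult.commute)
    have "(\<Sum>v\<in>S. a v * ?T v z) = \<gamma> * norm z powr (\<gamma> - 2) * (\<Sum>v\<in>S. a v * (norm v)\<^sup>2)
        + \<gamma> * (\<gamma> - 2) * norm z powr (\<gamma> - 4) * (\<Sum>v\<in>S. a v * (z \<bullet> v)\<^sup>2)"
      unfolding sum_distrib_left sum.distrib[symmetric] by (intro sum.cong refl) (simp add: algebra_simps)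
    also have "\<dots> = \<gamma> * DIM('a) * norm z powr (\<gamma> - 2) + \<gamma> * (\<gamma> - 2) * ((norm z)\<^sup>2 * norm z powr (\<gamma> - 4))"
      by (simp add: isotropic sum_weights_norm)
    also have "\<dots> = \<gamma> * (\<gamma> + real DIM('a) - 2) * norm z powr (\<gamma> - 2)"
      unfolding sq by (simp add: algebra_simps)
    finally have "\<bar>\<gamma> * (\<gamma> + real DIM('a) - 2) * norm z powr (\<gamma> - 2) - kernel \<gamma> 1 z\<bar>
      = \<bar>\<Sum>v\<in>S. a v * (?T v z - second_diff (\<lambda>z. norm z powr \<gamma>) v z)\<bar>"
      by (simp add: kernel_def right_diff_distrib sum_subtractf)
    also have "\<dots> \<le> (\<Sum>v\<in>S. \<bar>a v * (?T v z - second_diff (\<lambda>z. norm z powr \<gamma>) v z)\<bar>)" by (rule sum_abs)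
    also have "\<dots> \<le> (\<Sum>v\<in>S. \<bar>a v\<bar> * (C v * norm z powr (\<gamma> - 4)))"
      using C[OF z0 zv] by (intro sum_mono) (simp add: abs_mult abs_minus_commute mult_left_mono)
    also have "\<dots> = D * norm z powr (\<gamma> - 4)" by (simp add: D_def sum_distrib_right mult_ac)
    finally show ?thesis .
  qed
  moreover have "0 \<le> D" unfolding D_def by (intro sum_nonneg) (simp add: C0)
  moreover have "0 < R" unfolding R_def by (intro add_pos_nonneg sum_nonneg) auto
  ultimately show ?thesis by blast
qed

text \<open>The lower bound on \<open>\<beta>\<close> makes the power
  \<open>\<gamma> - 2 + \<beta>\<close> integrable at 0, the upper bound makes the remainder
  \<open>\<gamma> - 4 + \<beta>\<close> integrable at infinity. The kernel may have further
  singularities at the stencil points, but it is integrable as a whole and its weight is at most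
  \<open>R powr \<beta>\<close> on the ball because \<open>\<beta> \<ge> 0\<close>.\<close>

lemma kernel_defect_integrable:
  assumes \<gamma>: "- real DIM('a) < \<gamma>" "\<gamma> < 2 - real DIM('a)"
    and \<beta>: "0 \<le> \<beta>" "2 - \<gamma> - real DIM('a) < \<beta>" "\<beta> < 4 - \<gamma> - real DIM('a)"
  shows "integrable lebesgue (\<lambda>z. \<bar>\<gamma> * (\<gamma> + real DIM('a) - 2) * norm z powr (\<gamma> - 2) - kernel \<gamma> 1 z\<bar> * norm z powr \<beta>)"
proof -
  let ?k = "\<gamma> * (\<gamma> + real DIM('a) - 2)"
  obtain C R where C: "0 \<le> C" "0 < R" and far:
    "\<And>z. R \<le> norm z \<Longrightarrow> \<bar>?k * norm z powr (\<gamma> - 2) - kernel \<gamma> 1 z\<bar> \<le> C * norm z powr (\<gamma> - 4)"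
    using kernel_far[of \<gamma>] by blast
  define f where "f z = \<bar>?k * norm z powr (\<gamma> - 2) - kernel \<gamma> 1 z\<bar> * norm z powr \<beta>" for z
  have m: "f \<in> borel_measurable lebesgue"
    unfolding f_def[abs_def] by (intro measurable_completion) simp
  have i: "integrable lebesgue (\<lambda>z. \<bar>?k\<bar> * (norm z powr (\<gamma> - 2 + \<beta>) * indicator (cball 0 R) z)
      + R powr \<beta> * \<bar>kernel \<gamma> 1 z\<bar> + C * (norm z powr (\<gamma> - 4 + \<beta>) * indicator {z. R \<le> norm z} z))"
    using C \<beta>
    by (intro Bochner_Integration.integrable_add integrable_mult_right norm_powr_integrable_ball
        norm_powr_integrable_outside integrable_abs kernel_integrable[OF \<gamma>]) auto
  have "integrable lebesgue f"
  proof (rule Bochner_Integration.integrable_bound[OF i m], rule AE_I2)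
    fix z :: 'a
    have "f z \<le> \<bar>?k\<bar> * (norm z powr (\<gamma> - 2 + \<beta>) * indicator (cball 0 R) z)
      + R powr \<beta> * \<bar>kernel \<gamma> 1 z\<bar> + C * (norm z powr (\<gamma> - 4 + \<beta>) * indicator {z. R \<le> norm z} z)" (is "_ \<le> ?A + ?B + ?C")
    proof (cases "R \<le> norm z")
      case True
      have "f z \<le> C * norm z powr (\<gamma> - 4) * norm z powr \<beta>"
        unfolding f_def using far[OF True] by (intro mult_right_mono) auto
      also have "\<dots> = ?C" using True by (simp add: powr_add)
      finally have "f z \<le> ?C" .
      moreover have "0 \<le> ?A" "0 \<le> ?B" by auto
      ultimately show ?thesis by linarith
    next
      case False
      then have z: "norm z \<le> R" by simp
      have "f z \<le> (\<bar>?k * norm z powr (\<gamma> - 2)\<bar> + \<bar>kernel \<gamma> 1 z\<bar>) * norm z powr \<beta>"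
        unfolding f_def by (intro mult_right_mono) auto
      also have "\<dots> = \<bar>?k\<bar> * norm z powr (\<gamma> - 2 + \<beta>) + norm z powr \<beta> * \<bar>kernel \<gamma> 1 z\<bar>"
        by (simp only: powr_add abs_mult[of ?k] distrib_right abs_of_nonneg[OF powr_ge_zero]) (simp add: mult_ac)
      also have "norm z powr \<beta> * \<bar>kernel \<gamma> 1 z\<bar> \<le> ?B"
        using z \<beta> by (intro mult_right_mono powr_mono2) auto
      finally show ?thesis using False z by (simp add: indicator_def)
    qed
    moreover have "0 \<le> f z" by (simp add: f_def)
    ultimately show "norm (f z) \<le> norm (?A + ?B + ?C)" by simp
  qed
  then show ?thesis by (simp add: f_def[abs_def])
qed

section \<open>Dependence on the mesh size by homogeneity\<close>

lemma kernel_defect_scale: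
  fixes h k \<gamma> \<beta> :: real
  assumes h: "0 < h"
  shows "\<bar>k * norm (h *\<^sub>R z) powr (\<gamma> - 2) - kernel \<gamma> h (h *\<^sub>R z) / h\<^sup>2\<bar> * norm (h *\<^sub>R z) powr \<beta>
    = h powr (\<gamma> - 2 + \<beta>) * (\<bar>k * norm z powr (\<gamma> - 2) - kernel \<gamma> 1 z\<bar> * norm z powr \<beta>)" (is "?l = ?r")
proof -
  have e: "h powr \<gamma> / h\<^sup>2 = h powr (\<gamma> - 2)" using h by (simp add: powr_diff)
  have "?l = \<bar>k * (h powr (\<gamma> - 2) * norm z powr (\<gamma> - 2)) - h powr \<gamma> / h\<^sup>2 * kernel \<gamma> 1 z\<bar> * (h powr \<beta> * norm z powr \<beta>)"
    using h by (simp add: kernel_scale powr_mult)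
  also have "k * (h powr (\<gamma> - 2) * norm z powr (\<gamma> - 2)) - h powr \<gamma> / h\<^sup>2 * kernel \<gamma> 1 z
     = h powr (\<gamma> - 2) * (k * norm z powr (\<gamma> - 2) - kernel \<gamma> 1 z)"
    unfolding e by (simp add: algebra_simps)
  finally show ?thesis by (simp add: abs_mult powr_add mult_ac)
qed

text \<open>Both terms in the bracket are homogeneous of degree \<open>\<gamma> - 2\<close> when
  \<open>z\<close> and \<open>h\<close> are scaled together; the weight adds \<open>\<beta>\<close>
  and the Jacobian adds \<open>n\<close>. For \<open>\<gamma> = 2 - n - 2 * s\<close> the exponent
  becomes \<open>\<beta> - 2 * s\<close>.\<close>

lemma kernel_defect_integral_scale:
  fixes h k \<gamma> \<beta> :: real
  assumes h: "0 < h"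
  shows "(LINT z|lebesgue. \<bar>k * norm z powr (\<gamma> - 2) - kernel \<gamma> h z / h\<^sup>2\<bar> * norm z powr \<beta>)
    = h powr (DIM('a) + \<gamma> - 2 + \<beta>) * (LINT z|lebesgue. \<bar>k * norm z powr (\<gamma> - 2) - kernel \<gamma> 1 z\<bar> * norm z powr \<beta>)"
proof -
  have m: "(\<lambda>z. \<bar>k * norm z powr (\<gamma> - 2) - kernel \<gamma> h z / h\<^sup>2\<bar> * norm z powr \<beta>) \<in> borel_measurable lebesgue"
    by (intro measurable_completion) simp
  show ?thesis
    using integral_scale_translate[OF m, of h 0] h
    by (simp only: kernel_defect_scale[OF h] add_0_left) (simp add: powr_add powr_diff powr_realpow)
qed

lemma kernel_defect_integrable_scale:
  fixes h k \<gamma> \<beta> :: real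
  assumes h: "0 < h"
    and i: "integrable lebesgue (\<lambda>z. \<bar>k * norm z powr (\<gamma> - 2) - kernel \<gamma> 1 z\<bar> * norm z powr \<beta>)"
  shows "integrable lebesgue (\<lambda>z. \<bar>k * norm z powr (\<gamma> - 2) - kernel \<gamma> h z / h\<^sup>2\<bar> * norm z powr \<beta>)"
proof -
  have eq: "\<bar>k * norm z powr (\<gamma> - 2) - kernel \<gamma> h z / h\<^sup>2\<bar> * norm z powr \<beta> = h powr (\<gamma> - 2 + \<beta>) *
      (\<bar>k * norm (0 + (1 / h) *\<^sub>R z) powr (\<gamma> - 2) - kernel \<gamma> 1 (0 + (1 / h) *\<^sub>R z)\<bar> * norm (0 + (1 / h) *\<^sub>R z) powr \<beta>)" for z
    using kernel_defect_scale[OF h, of k "(1 / h) *\<^sub>R z" \<gamma> \<beta>] h by simp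
  have "1 / h \<noteq> 0" using h by simp
  show ?thesis unfolding eq
    by (intro integrable_mult_right integrable_scale_translate[OF i \<open>1 / h \<noteq> 0\<close>])
qed

lemma kernel_abs_scale:
  fixes h \<gamma> :: real
  assumes h: "0 < h"
  shows "(LINT z|lebesgue. \<bar>kernel \<gamma> h z\<bar> / h\<^sup>2) = h powr (DIM('a) + \<gamma> - 2) * (LINT z|lebesgue. \<bar>kernel \<gamma> 1 z\<bar>)"
proof -
  have m: "(\<lambda>z. \<bar>kernel \<gamma> h z\<bar> / h\<^sup>2) \<in> borel_measurable lebesgue" by (intro measurable_completion) simp
  show ?thesis
    using integral_scale_translate[OF m, of h 0] h
    by (simp add: kernel_scale abs_mult powr_add powr_diff powr_realpow)
qed

end

section \<open>Consistency of the discretised singular integral\<close>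

text \<open>The functional equation of Gamma, used at \<open>n/2 + s\<close> and at
  \<open>2 - s\<close>. The factor is \<open>\<gamma> * (\<gamma> + n - 2)\<close> for
  \<open>\<gamma> = 2 - n - 2 * s\<close>: off the origin, the Laplacian of the normalised Riesz
  kernel is the normalised kernel of the fractional Laplacian.\<close>

lemma frac_const_shift:
  assumes "0 < s" "s < 1" "real n / 2 + s \<noteq> 1" "1 \<le> n"
  shows "frac_const n s = 2 * s * (real n + 2 * s - 2) * frac_const n (s - 1)"
proof -
  have ni: "real n / 2 + s - 1 \<notin> \<int>\<^sub>\<le>\<^sub>0"
  proof
    assume "real n / 2 + s - 1 \<in> \<int>\<^sub>\<le>\<^sub>0"
    then obtain m :: nat where m: "real n / 2 + s - 1 = - real m" by (auto elim!: nonpos_Ints_cases')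
    \<comment> \<open>The argument exceeds -1/2, so 0 is the only pole within reach, and the third
      assumption excludes it.\<close>
    have "real n \<ge> 1" using assms by simp
    then have "real m < 1" using m assms(1) by linarith
    then have "m = 0" by simp
    then have "real m = 0" by simp
    then show False using m assms(3) by linarith
  qed
  have g1: "Gamma (real n / 2 + s) = (real n / 2 + s - 1) * Gamma (real n / 2 + s - 1)"
    using Gamma_plus1[OF ni] by simp
  have "1 - s \<notin> \<int>\<^sub>\<le>\<^sub>0" using assms by (auto dest: nonpos_Ints_nonpos)
  then have g2: "Gamma (2 - s) = (1 - s) * Gamma (1 - s)"
    using Gamma_plus1[of "1 - s"] by (simp add: algebra_simps)
  have p: "2 powr (2 * s) = 4 * 2 powr (2 * (s - 1))"
    by (simp add: right_diff_distrib powr_diff)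
  have nz: "1 - s \<noteq> 0" "Gamma (1 - s) \<noteq> 0" "pi powr (real n / 2) \<noteq> 0"
    using assms less_imp_neq[OF Gamma_real_pos[of "1 - s"]] by auto
  have "frac_const n s = 4 * 2 powr (2 * (s - 1)) * s * ((real n / 2 + s - 1) * Gamma (real n / 2 + s - 1)) / (pi powr (real n / 2) * Gamma (1 - s))"
    using assms by (simp add: frac_const_def p g1)
  moreover have "frac_const n (s - 1) = 2 powr (2 * (s - 1)) * (1 - s) * Gamma (real n / 2 + s - 1) / (pi powr (real n / 2) * ((1 - s) * Gamma (1 - s)))"
    using assms g2 by (simp add: frac_const_def add_diff_eq left_diff_distrib right_diff_distrib minus_divide_left)
  moreover have "X * (1 - s) * G / (P * ((1 - s) * Y)) = X * G / (P * Y)" for X G P Y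
    using nz(1) by simp
  moreover have "4 * X * s * ((real n / 2 + s - 1) * G) / Q = 2 * s * (real n + 2 * s - 2) * (X * G / Q)" for X G Q
    by (simp add: algebra_simps diff_divide_distrib add_divide_distrib)
  ultimately show ?thesis by simp
qed

text \<open>Averaging the truncated integral with its reflection removes the part of the increment
  of \<open>u\<close> that is odd in \<open>z\<close>. What remains is of order
  \<open>\<beta> - n - 2 * s > - n\<close> at 0, so the principal value is an ordinary integral, by
  dominated convergence.\<close>

lemma frac_laplacian_eq_integral:
  fixes u :: "'a::euclidean_space \<Rightarrow> real"
  assumes s: "0 < s" and \<beta>: "2 * s < \<beta>"
    and u: "u \<in> borel_measurable lebesgue" "AE y in lebesgue. \<bar>u y\<bar> \<le> B"
    and D: "AE z in lebesgue. \<bar>u x - (u (x + z) + u (x - z)) / 2\<bar> \<le> M * norm z powr \<beta>"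
  shows "integrable lebesgue (\<lambda>z. norm z powr (- real DIM('a) - 2 * s) * (u x - (u (x + z) + u (x - z)) / 2))"
    and "frac_laplacian s u x = frac_const DIM('a) s *
      (LINT z|lebesgue. norm z powr (- real DIM('a) - 2 * s) * (u x - (u (x + z) + u (x - z)) / 2))"
proof -
  define w :: "'a \<Rightarrow> real" where "w z = norm z powr (- real DIM('a) - 2 * s)" for z
  define F where "F z = w z * (u x - (u (x + z) + u (x - z)) / 2)" for z
  have wm: "w \<in> borel_measurable lebesgue" unfolding w_def[abs_def] by (intro measurable_completion) simp
  have up: "(\<lambda>z. u (x + z)) \<in> borel_measurable lebesgue" "AE z in lebesgue. \<bar>u (x + z)\<bar> \<le> B"
    using borel_measurable_scale_translate[OF u(1), of 1 x] AE_scale_translate[OF u(2), of 1 x] by simp_all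
  have um: "(\<lambda>z. u (x - z)) \<in> borel_measurable lebesgue" "AE z in lebesgue. \<bar>u (x - z)\<bar> \<le> B"
    using borel_measurable_scale_translate[OF u(1), of "-1" x] AE_scale_translate[OF u(2), of "-1" x] by simp_all
  have Fm: "F \<in> borel_measurable lebesgue" unfolding F_def[abs_def] using wm up um by measurable
  have near: "AE z in lebesgue. norm z \<le> 1 \<longrightarrow> \<bar>F z\<bar> \<le> M * norm z powr (\<beta> - real DIM('a) - 2 * s)"
    using D
  proof eventually_elim
    case (elim z)
    have "\<bar>F z\<bar> \<le> w z * (M * norm z powr \<beta>)"
      unfolding F_def abs_mult using elim by (intro mult_mono) (auto simp: w_def)
    also have "\<dots> = M * norm z powr (\<beta> - real DIM('a) - 2 * s)"
      by (simp add: w_def powr_add[symmetric] mult.left_commute algebra_simps)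
    finally show ?case by simp
  qed
  have far: "AE z in lebesgue. 1 \<le> norm z \<longrightarrow> \<bar>F z\<bar> \<le> (\<bar>u x\<bar> + B) * norm z powr (- real DIM('a) - 2 * s)"
    using up(2) um(2)
  proof eventually_elim
    case (elim z)
    then have "\<bar>(u (x + z) + u (x - z)) / 2\<bar> \<le> B" by (simp add: abs_le_iff; linarith)
    then have "\<bar>u x - (u (x + z) + u (x - z)) / 2\<bar> \<le> \<bar>u x\<bar> + B" by linarith
    then have "\<bar>F z\<bar> \<le> w z * (\<bar>u x\<bar> + B)"
      unfolding F_def abs_mult by (intro mult_mono) (auto simp: w_def)
    then show ?case by (simp add: w_def mult.commute)
  qed
  have Fi: "integrable lebesgue F"
    by (rule integrable_norm_powr_bounds[OF Fm _ _ _ near far]) (use s \<beta> in auto)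
  then show "integrable lebesgue (\<lambda>z. norm z powr (- real DIM('a) - 2 * s) * (u x - (u (x + z) + u (x - z)) / 2))"
    by (simp add: F_def[abs_def] w_def)
  have cut: "(LINT y:{y. \<epsilon> < dist x y}|lebesgue. (u x - u y) / norm (x - y) powr (real DIM('a) + 2 * s))
      = (LINT z|lebesgue. indicator {z. \<epsilon> < norm z} z * F z)" if \<epsilon>: "0 < \<epsilon>" for \<epsilon>
  proof -
    \<comment> \<open>With a ball cut out, boundedness of \<open>u\<close> alone makes the
      unsymmetrised integrand integrable; this justifies reflecting it and taking the mean.\<close>
    define G where "G z = indicator {z. \<epsilon> < norm z} z * (w z * (u x - u (x + z)))" for z
    have sm: "{z::'a. \<epsilon> < norm z} \<in> sets lebesgue" by simp
    have Gm: "G \<in> borel_measurable lebesgue" unfolding G_def[abs_def] using wm up sm by measurable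
    have Gfar: "AE z in lebesgue. \<bar>G z\<bar> \<le> (\<bar>u x\<bar> + B) * (norm z powr (- real DIM('a) - 2 * s) * indicator {z. \<epsilon> \<le> norm z} z)"
      using up(2)
    proof eventually_elim
      case (elim z)
      then have "\<bar>u x - u (x + z)\<bar> \<le> \<bar>u x\<bar> + B" "0 \<le> \<bar>u x\<bar> + B" by linarith+
      then show ?case unfolding G_def by (auto simp: indicator_def abs_mult w_def mult.commute intro!: mult_right_mono)
    qed
    have Gi: "integrable lebesgue G"
    proof (rule Bochner_Integration.integrable_bound[OF _ Gm])
      show "integrable lebesgue (\<lambda>z::'a. (\<bar>u x\<bar> + B) * (norm z powr (- real DIM('a) - 2 * s) * indicator {z. \<epsilon> \<le> norm z} z))"
        using s \<epsilon> by (intro integrable_mult_right norm_powr_integrable_outside) auto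
      show "AE z in lebesgue. norm (G z) \<le> norm ((\<bar>u x\<bar> + B) * (norm z powr (- real DIM('a) - 2 * s) * indicator {z. \<epsilon> \<le> norm z} z))"
        using Gfar by eventually_elim auto
    qed
    have Gi': "integrable lebesgue (\<lambda>z. G (- z))"
      using integrable_scale_translate[OF Gi, of "-1" 0] by simp
    have Geq: "(LINT z|lebesgue. G z) = (LINT z|lebesgue. G (- z))"
      using integral_scale_translate[OF Gm, of "-1" 0] by simp
    define H where "H y = indicator {y. \<epsilon> < dist x y} y * ((u x - u y) / norm (x - y) powr (real DIM('a) + 2 * s))" for y
    have HG: "H (x + z) = G z" for z
    proof -
      have "norm z powr (- real DIM('a) - 2 * s) = inverse (norm z powr (real DIM('a) + 2 * s))"
        by (simp add: powr_minus[symmetric])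
      then show ?thesis by (simp add: H_def G_def dist_norm indicator_def w_def divide_inverse)
    qed
    have "H = (\<lambda>y. G (- x + 1 *\<^sub>R y))" using HG[of "y - x" for y] by (intro ext) simp
    then have Hm: "H \<in> borel_measurable lebesgue" using borel_measurable_scale_translate[OF Gm, of 1 "- x"] by simp
    have "(LINT y:{y. \<epsilon> < dist x y}|lebesgue. (u x - u y) / norm (x - y) powr (real DIM('a) + 2 * s)) = (LINT y|lebesgue. H y)"
      by (simp add: set_lebesgue_integral_def H_def)
    also have "\<dots> = (LINT z|lebesgue. G z)"
      using integral_scale_translate[OF Hm, of 1 x] by (simp add: HG)
    also have "\<dots> = (LINT z|lebesgue. (G z + G (- z)) / 2)"
      using Gi Gi' Geq by simp
    also have "\<dots> = (LINT z|lebesgue. indicator {z. \<epsilon> < norm z} z * F z)"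
      by (intro Bochner_Integration.integral_cong refl) (simp add: G_def F_def w_def indicator_def field_simps)
    finally show ?thesis .
  qed
  \<comment> \<open>The truncation radius is written as \<open>inverse t\<close> with
    \<open>t\<close> tending to infinity, to fit dominated convergence along
    \<open>at_top\<close>.\<close>
  have "((\<lambda>t. LINT z|lebesgue. indicator {z. inverse t < norm z} z * F z) \<longlongrightarrow> (LINT z|lebesgue. F z)) at_top"
  proof (rule integral_dominated_convergence_at_top[where w = "\<lambda>z. \<bar>F z\<bar>"])
    show "AE z in lebesgue. ((\<lambda>t. indicator {z. inverse t < norm z} z * F z) \<longlongrightarrow> F z) at_top"
    proof (rule AE_I2)
      fix z :: 'a
      show "((\<lambda>t. indicator {z. inverse t < norm z} z * F z) \<longlongrightarrow> F z) at_top"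
      \<comment> \<open>The origin is cut out for every positive \<open>t\<close>, which is
        consistent with the limit since \<open>w 0 = 0\<close>.\<close>
      proof (cases "z = 0")
        case True
        then show ?thesis by (simp add: F_def w_def)
      next
        case False
        then have "eventually (\<lambda>t. inverse t < norm z) at_top"
          using order_tendstoD(2)[OF tendsto_inverse_0_at_top[OF filterlim_ident], of "norm z"] by simp
        then have "eventually (\<lambda>t. indicator {z. inverse t < norm z} z * F z = F z) at_top"
          by eventually_elim simp
        then show ?thesis by (rule tendsto_eventually)
      qed
    qed
    show "(\<lambda>z. indicator {z. inverse t < norm z} z * F z) \<in> borel_measurable lebesgue" for t :: real
      using Fm by (intro borel_measurable_times borel_measurable_indicator) auto
    show "\<forall>\<^sub>F t in at_top. AE z in lebesgue. norm (indicator {z. inverse t < norm z} z * F z) \<le> \<bar>F z\<bar>"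
      by (intro always_eventually allI AE_I2) (simp add: indicator_def)
  qed (use Fm Fi in auto)
  then have "((\<lambda>\<epsilon>. LINT z|lebesgue. indicator {z. \<epsilon> < norm z} z * F z) \<longlongrightarrow> (LINT z|lebesgue. F z)) (at_right 0)"
    by (simp add: filterlim_at_right_to_top)
  then have "((\<lambda>\<epsilon>. LINT y:{y. \<epsilon> < dist x y}|lebesgue. (u x - u y) / norm (x - y) powr (real DIM('a) + 2 * s)) \<longlongrightarrow> (LINT z|lebesgue. F z)) (at_right 0)"
    by (rule Lim_transform_eventually) (use cut in \<open>auto simp: eventually_at_right_less eventually_at_filter\<close>)
  then have "Lim (at_right 0) (\<lambda>\<epsilon>. LINT y:{y. \<epsilon> < dist x y}|lebesgue. (u x - u y) / norm (x - y) powr (real DIM('a) + 2 * s)) = (LINT z|lebesgue. F z)"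
    by (intro tendsto_Lim) auto
  then show "frac_laplacian s u x = frac_const DIM('a) s *
      (LINT z|lebesgue. norm z powr (- real DIM('a) - 2 * s) * (u x - (u (x + z) + u (x - z)) / 2))"
    by (simp add: frac_laplacian_def F_def w_def)
qed

section \<open>Potentials of bounded functions with bounded support\<close>

lemma integrable_mult_bounded:
  fixes f g :: "'b \<Rightarrow> real"
  assumes f: "integrable M f" and g: "g \<in> borel_measurable M" "AE x in M. \<bar>g x\<bar> \<le> B"
  shows "integrable M (\<lambda>x. f x * g x)"
proof (rule Bochner_Integration.integrable_bound)
  show "integrable M (\<lambda>x. B * f x)" using f by simp
  show "AE x in M. norm (f x * g x) \<le> norm (B * f x)"
    using g(2)
  proof eventually_elim
    case (elim x)
    then have "\<bar>f x\<bar> * \<bar>g x\<bar> \<le> \<bar>f x\<bar> * \<bar>B\<bar>" by (intro mult_left_mono) auto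
    then show ?case by (simp add: abs_mult mult.commute)
  qed
qed (use f g in auto)

text \<open>The kernel is in general only locally integrable and grows for
  \<open>\<gamma> > 0\<close>; the bounded support of \<open>U\<close> confines the integral to a
  ball.\<close>

lemma norm_powr_potential_integrable:
  fixes U :: "'a::euclidean_space \<Rightarrow> real"
  assumes \<gamma>: "- real DIM('a) < \<gamma>"
    and U: "U \<in> borel_measurable lebesgue" "AE y in lebesgue. \<bar>U y\<bar> \<le> B"
      "AE y in lebesgue. r < norm y \<longrightarrow> U y = 0"
  shows "integrable lebesgue (\<lambda>y. norm (p - y) powr \<gamma> * U y)"
proof (rule Bochner_Integration.integrable_bound)
  show "integrable lebesgue (\<lambda>y. norm (y - p) powr \<gamma> * indicator (cball 0 r) y * U y)"
    by (rule integrable_mult_bounded[OF norm_powr_translate_integrable_cball[OF \<gamma>] U(1,2)])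
  show "AE y in lebesgue. norm (norm (p - y) powr \<gamma> * U y) \<le> norm (norm (y - p) powr \<gamma> * indicator (cball 0 r) y * U y)"
    using U(3) by eventually_elim (auto simp: indicator_def norm_minus_commute not_le)
  have "(\<lambda>y. norm (p - y) powr \<gamma>) \<in> borel_measurable lebesgue" by (intro measurable_completion) simp
  then show "(\<lambda>y. norm (p - y) powr \<gamma> * U y) \<in> borel_measurable lebesgue" using U(1) by simp
qed

text \<open>Since the kernel of the discrete operator has integral zero and is even, both operators can be
  written in terms of \<open>u x - (u (x + z) + u (x - z)) / 2\<close>; the rest of the error comes from
  replacing \<open>u\<close> by its interpolant \<open>U\<close>.\<close>

theorem (in isotropic_stencil) consistency:
  fixes s \<beta> h M M' x
  defines "\<gamma> \<equiv> 2 - real DIM('a) - 2 * s"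
  defines "k \<equiv> \<gamma> * (\<gamma> + real DIM('a) - 2)"
  defines "c \<equiv> frac_const DIM('a) (s - 1)"
  assumes s: "0 < s" "s < 1" "real DIM('a) / 2 + s \<noteq> 1" and \<beta>: "2 * s < \<beta>" "\<beta> \<le> 2" and h: "0 < h"
    and u: "u \<in> borel_measurable lebesgue" "AE y in lebesgue. \<bar>u y\<bar> \<le> B"
    and D: "AE z in lebesgue. \<bar>u x - (u (x + z) + u (x - z)) / 2\<bar> \<le> M * norm z powr \<beta>"
    and U: "U \<in> borel_measurable lebesgue" "AE y in lebesgue. \<bar>U y\<bar> \<le> B'"
      "AE y in lebesgue. r < norm y \<longrightarrow> U y = 0"
    and Uu: "AE y in lebesgue. \<bar>U y - u y\<bar> \<le> M' * h powr \<beta>"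
  shows "\<bar>frac_laplacian s u x
      + (\<Sum>v\<in>S. a v * second_diff (\<lambda>p. c * (LINT y|lebesgue. norm (p - y) powr \<gamma> * U y)) (h *\<^sub>R v) x) / h\<^sup>2\<bar>
    \<le> \<bar>c\<bar> * (M * (LINT z|lebesgue. \<bar>k * norm z powr (\<gamma> - 2) - kernel \<gamma> 1 z\<bar> * norm z powr \<beta>)
            + M' * (LINT z|lebesgue. \<bar>kernel \<gamma> 1 z\<bar>)) * h powr (\<beta> - 2 * s)"
proof -
  define I where "I p = (LINT y|lebesgue. norm (p - y) powr \<gamma> * U y)" for p
  define D where "D z = u x - (u (x + z) + u (x - z)) / 2" for z
  define E1 where "E1 = (LINT z|lebesgue. \<bar>k * norm z powr (\<gamma> - 2) - kernel \<gamma> 1 z\<bar> * norm z powr \<beta>)"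
  define E2 where "E2 = (LINT z|lebesgue. \<bar>kernel \<gamma> 1 z\<bar>)"
  let ?q = "kernel \<gamma> h"
  have \<gamma>: "- real DIM('a) < \<gamma>" "\<gamma> < 2 - real DIM('a)" using s by (auto simp: \<gamma>_def)
  note pot = norm_powr_potential_integrable[OF \<gamma>(1) U]
  have qi: "integrable lebesgue ?q" by (rule kernel_integrable[OF \<gamma>])
  then have qm: "?q \<in> borel_measurable lebesgue" by auto
  have qi': "integrable lebesgue (\<lambda>y. ?q (x - y))" using integrable_scale_translate[OF qi, of "-1" x] by simp
  have up: "(\<lambda>z. u (x + z)) \<in> borel_measurable lebesgue" "AE z in lebesgue. \<bar>u (x + z)\<bar> \<le> B"
    using borel_measurable_scale_translate[OF u(1), of 1 x] AE_scale_translate[OF u(2), of 1 x] by simp_all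
  have um: "(\<lambda>z. u (x - z)) \<in> borel_measurable lebesgue" "AE z in lebesgue. \<bar>u (x - z)\<bar> \<le> B"
    using borel_measurable_scale_translate[OF u(1), of "-1" x] AE_scale_translate[OF u(2), of "-1" x] by simp_all
  have qup: "integrable lebesgue (\<lambda>z. ?q z * u (x + z))" by (rule integrable_mult_bounded[OF qi up])
  have qum: "integrable lebesgue (\<lambda>z. ?q z * u (x - z))" by (rule integrable_mult_bounded[OF qi um])
  have Um: "(\<lambda>y. U y - u y) \<in> borel_measurable lebesgue" using U(1) u(1) by simp
  have qU: "integrable lebesgue (\<lambda>y. ?q (x - y) * (U y - u y))" by (rule integrable_mult_bounded[OF qi' Um Uu])
  have qu: "integrable lebesgue (\<lambda>y. ?q (x - y) * u y)" by (rule integrable_mult_bounded[OF qi' u])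
  \<comment> \<open>The stencil acts on the base point \<open>p\<close>; moved under the integral,
    it turns the Riesz kernel into \<open>kernel\<close>. The translates may be split since each is
    integrable against \<open>U\<close>.\<close>
  have disc: "(\<Sum>v\<in>S. a v * second_diff (\<lambda>p. c * I p) (h *\<^sub>R v) x) = c * (LINT y|lebesgue. ?q (x - y) * U y)"
  proof -
    have "(LINT y|lebesgue. ?q (x - y) * U y) = (LINT y|lebesgue. (\<Sum>v\<in>S. a v * (norm (x + h *\<^sub>R v - y) powr \<gamma> * U y
        + norm (x - h *\<^sub>R v - y) powr \<gamma> * U y - 2 * (norm (x - y) powr \<gamma> * U y))))"
      unfolding kernel_def second_diff_def sum_distrib_right
      by (intro Bochner_Integration.integral_cong refl sum.cong) (simp add: algebra_simps)
    also have "\<dots> = (\<Sum>v\<in>S. a v * (I (x + h *\<^sub>R v) + I (x - h *\<^sub>R v) - 2 * I x))"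
      unfolding I_def using pot by (simp add: Bochner_Integration.integral_sum)
    finally show ?thesis by (simp add: second_diff_def sum_distrib_left right_diff_distrib distrib_left mult_ac)
  qed
  have split: "(LINT y|lebesgue. ?q (x - y) * U y) = (LINT y|lebesgue. ?q (x - y) * (U y - u y)) + (LINT y|lebesgue. ?q (x - y) * u y)"
    using qU qu by (subst Bochner_Integration.integral_add[symmetric]) (simp_all add: algebra_simps)
  have qDi: "integrable lebesgue (\<lambda>z. ?q z * D z)"
  proof -
    have "integrable lebesgue (\<lambda>z. u x * ?q z - (?q z * u (x + z) + ?q z * u (x - z)) / 2)"
      using qi qup qum by simp
    then show ?thesis by (simp add: D_def algebra_simps add_divide_distrib)
  qed
  \<comment> \<open>The convolution is computed with \<open>y = x + z\<close> and with
    \<open>y = x - z\<close>, and the mean is taken; the constant \<open>u x\<close> may then be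
    inserted because the kernel integrates to zero.\<close>
  have qD: "(LINT y|lebesgue. ?q (x - y) * u y) = - (LINT z|lebesgue. ?q z * D z)"
  proof -
    have m: "(\<lambda>y. ?q (x - y) * u y) \<in> borel_measurable lebesgue" using qu by auto
    have e1: "(LINT y|lebesgue. ?q (x - y) * u y) = (LINT z|lebesgue. ?q z * u (x + z))"
      using integral_scale_translate[OF m, of 1 x] by (simp add: kernel_minus)
    have e2: "(LINT y|lebesgue. ?q (x - y) * u y) = (LINT z|lebesgue. ?q z * u (x - z))"
      using integral_scale_translate[OF m, of "-1" x] by simp
    have "(LINT z|lebesgue. ?q z * D z) = (LINT z|lebesgue. u x * ?q z - (?q z * u (x + z) + ?q z * u (x - z)) / 2)"
      by (intro Bochner_Integration.integral_cong refl) (simp add: D_def algebra_simps add_divide_distrib)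
    also have "\<dots> = u x * (LINT z|lebesgue. ?q z) - ((LINT z|lebesgue. ?q z * u (x + z)) + (LINT z|lebesgue. ?q z * u (x - z))) / 2"
      using qi qup qum by simp
    also have "\<dots> = - (LINT y|lebesgue. ?q (x - y) * u y)"
      using e1 e2 kernel_integral_zero[OF \<gamma>] by simp
    finally show ?thesis by simp
  qed
  \<comment> \<open>Now both operators carry the same factor \<open>c\<close>, and their kernels can
    be subtracted.\<close>
  have kc: "frac_const DIM('a) s = k * c"
    using frac_const_shift[OF s, of] by (simp add: k_def c_def \<gamma>_def algebra_simps)
  have expo: "- real DIM('a) - 2 * s = \<gamma> - 2" by (simp add: \<gamma>_def)
  note fl = frac_laplacian_eq_integral[OF s(1) \<beta>(1) u \<open>AE z in lebesgue. \<bar>u x - (u (x + z) + u (x - z)) / 2\<bar> \<le> M * norm z powr \<beta>\<close>,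
      unfolded expo, folded D_def]
  define A where "A = (LINT z|lebesgue. (k * norm z powr (\<gamma> - 2) - ?q z / h\<^sup>2) * D z)"
  define A' where "A' = (LINT y|lebesgue. ?q (x - y) * (U y - u y) / h\<^sup>2)"
  have Ai: "integrable lebesgue (\<lambda>z. (k * norm z powr (\<gamma> - 2) - ?q z / h\<^sup>2) * D z)"
    and A: "A = k * (LINT z|lebesgue. norm z powr (\<gamma> - 2) * D z) - (LINT z|lebesgue. ?q z * D z) / h\<^sup>2"
  proof -
    have e: "(k * norm z powr (\<gamma> - 2) - ?q z / h\<^sup>2) * D z = k * (norm z powr (\<gamma> - 2) * D z) - ?q z * D z / h\<^sup>2" for z
      by (simp add: algebra_simps)
    show "integrable lebesgue (\<lambda>z. (k * norm z powr (\<gamma> - 2) - ?q z / h\<^sup>2) * D z)"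
      unfolding e using fl(1) qDi by simp
    show "A = k * (LINT z|lebesgue. norm z powr (\<gamma> - 2) * D z) - (LINT z|lebesgue. ?q z * D z) / h\<^sup>2"
      unfolding A_def e using fl(1) qDi by simp
  qed
  have A': "A' = (LINT y|lebesgue. ?q (x - y) * (U y - u y)) / h\<^sup>2"
    unfolding A'_def by simp
  have total: "frac_laplacian s u x + (\<Sum>v\<in>S. a v * second_diff (\<lambda>p. c * I p) (h *\<^sub>R v) x) / h\<^sup>2 = c * (A + A')"
    unfolding disc split qD fl(2) kc A A' by (simp add: algebra_simps add_divide_distrib diff_divide_distrib)
  \<comment> \<open>Since \<open>n + \<gamma> - 2 = - 2 * s\<close>, both parts of the error carry
    the same power of \<open>h\<close>.\<close>
  have hA: "h powr (DIM('a) + \<gamma> - 2 + \<beta>) = h powr (\<beta> - 2 * s)" "h powr (DIM('a) + \<gamma> - 2) * h powr \<beta> = h powr (\<beta> - 2 * s)"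
    by (simp_all add: \<gamma>_def powr_add[symmetric])
  have "\<bar>A\<bar> \<le> (LINT z|lebesgue. \<bar>(k * norm z powr (\<gamma> - 2) - ?q z / h\<^sup>2) * D z\<bar>)"
    unfolding A_def using integral_norm_bound[of lebesgue "\<lambda>z. (k * norm z powr (\<gamma> - 2) - ?q z / h\<^sup>2) * D z"] by simp
  also have "\<dots> \<le> (LINT z|lebesgue. M * (\<bar>k * norm z powr (\<gamma> - 2) - ?q z / h\<^sup>2\<bar> * norm z powr \<beta>))"
  proof (rule integral_mono_AE)
    have "0 \<le> \<beta>" using s \<beta> by simp
    then have "integrable lebesgue (\<lambda>z. \<bar>k * norm z powr (\<gamma> - 2) - kernel \<gamma> 1 z\<bar> * norm z powr \<beta>)"
      unfolding k_def using s \<beta> by (intro kernel_defect_integrable[OF \<gamma>]) (auto simp: \<gamma>_def)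
    then show "integrable lebesgue (\<lambda>z. M * (\<bar>k * norm z powr (\<gamma> - 2) - ?q z / h\<^sup>2\<bar> * norm z powr \<beta>))"
      by (intro integrable_mult_right kernel_defect_integrable_scale[OF h])
    show "AE z in lebesgue. \<bar>(k * norm z powr (\<gamma> - 2) - ?q z / h\<^sup>2) * D z\<bar> \<le> M * (\<bar>k * norm z powr (\<gamma> - 2) - ?q z / h\<^sup>2\<bar> * norm z powr \<beta>)"
      using D unfolding D_def[symmetric]
    proof eventually_elim
      case (elim z)
      then show ?case
        using mult_left_mono[OF elim, of "\<bar>k * norm z powr (\<gamma> - 2) - ?q z / h\<^sup>2\<bar>"] by (simp add: abs_mult mult_ac)
    qed
  qed (use Ai in auto)
  also have "\<dots> = M * E1 * h powr (\<beta> - 2 * s)"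
    by (simp add: kernel_defect_integral_scale[OF h] hA E1_def)
  finally have A_le: "\<bar>A\<bar> \<le> M * E1 * h powr (\<beta> - 2 * s)" .
  have "\<bar>A'\<bar> \<le> (LINT y|lebesgue. \<bar>?q (x - y) * (U y - u y) / h\<^sup>2\<bar>)"
    unfolding A'_def using integral_norm_bound[of lebesgue "\<lambda>y. ?q (x - y) * (U y - u y) / h\<^sup>2"] by simp
  also have "\<dots> \<le> (LINT y|lebesgue. M' * h powr \<beta> * (\<bar>?q (x - y)\<bar> / h\<^sup>2))"
  proof (rule integral_mono_AE)
    show "integrable lebesgue (\<lambda>y. M' * h powr \<beta> * (\<bar>?q (x - y)\<bar> / h\<^sup>2))" using qi' by simp
    show "AE y in lebesgue. \<bar>?q (x - y) * (U y - u y) / h\<^sup>2\<bar> \<le> M' * h powr \<beta> * (\<bar>?q (x - y)\<bar> / h\<^sup>2)"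
      using Uu
    proof eventually_elim
      case (elim y)
      then show ?case
        using mult_left_mono[OF elim, of "\<bar>?q (x - y)\<bar> / h\<^sup>2"] by (simp add: abs_mult mult_ac)
    qed
  qed (use qU in auto)
  also have "\<dots> = M' * h powr \<beta> * (LINT z|lebesgue. \<bar>?q z\<bar> / h\<^sup>2)"
  proof -
    have m: "(\<lambda>z. \<bar>?q z\<bar> / h\<^sup>2) \<in> borel_measurable lebesgue" using qm by simp
    have "(LINT z|lebesgue. \<bar>?q z\<bar> / h\<^sup>2) = (LINT y|lebesgue. \<bar>?q (x - y)\<bar> / h\<^sup>2)"
      using integral_scale_translate[OF m, of "-1" x] by (simp del: integral_divide_zero)
    then show ?thesis by (simp only: integral_mult_right_zero)
  qed
  also have "\<dots> = M' * E2 * (h powr (DIM('a) + \<gamma> - 2) * h powr \<beta>)"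
    unfolding kernel_abs_scale[OF h] E2_def by simp
  finally have A'_le: "\<bar>A'\<bar> \<le> M' * E2 * h powr (\<beta> - 2 * s)" unfolding hA .
  have "\<bar>c * (A + A')\<bar> \<le> \<bar>c\<bar> * (M * E1 * h powr (\<beta> - 2 * s) + M' * E2 * h powr (\<beta> - 2 * s))"
    unfolding abs_mult using A_le A'_le by (intro mult_left_mono) auto
  then show ?thesis
    unfolding total[symmetric] unfolding I_def E1_def E2_def by (simp add: algebra_simps)
qed

section \<open>Interpolation of Hoelder differentiable functions\<close>

text \<open>The mean value theorem on the segment turns the remainder into the inner product of
  \<open>z - y\<close> with a difference of gradients at two points no farther apart than
  \<open>y\<close> and \<open>z\<close>.\<close>

lemma holder_gradient_remainder:
  fixes u :: "'a::euclidean_space \<Rightarrow> real"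
  assumes U: "convex U" "y \<in> U" "z \<in> U" and \<alpha>: "0 < \<alpha>" and K: "0 \<le> K"
    and der: "\<And>x. x \<in> U \<Longrightarrow> GDERIV u x :> G x"
    and hol: "\<And>x y. x \<in> U \<Longrightarrow> y \<in> U \<Longrightarrow> norm (G x - G y) \<le> K * dist x y powr \<alpha>"
  shows "\<bar>u z - u y - G y \<bullet> (z - y)\<bar> \<le> K * norm (z - y) powr (1 + \<alpha>)"
proof -
  define p where "p t = y + t *\<^sub>R (z - y)" for t
  have pU: "p t \<in> U" if "0 \<le> t" "t \<le> 1" for t
    using convexD_alt[OF U that] by (simp add: p_def algebra_simps)
  have "((\<lambda>t. u (p t)) has_real_derivative (z - y) \<bullet> G (p t)) (at t)" if t: "0 \<le> t" "t \<le> 1" for t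
  proof -
    have "(u has_derivative (\<lambda>h. h \<bullet> G (p t))) (at (p t))"
      using der[OF pU[OF t]] by (simp add: gderiv_def)
    moreover have "(p has_derivative (\<lambda>h. h *\<^sub>R (z - y))) (at t)"
      unfolding p_def[abs_def] by (auto intro!: derivative_eq_intros)
    ultimately have "((\<lambda>t. u (p t)) has_derivative (\<lambda>h. (h *\<^sub>R (z - y)) \<bullet> G (p t))) (at t)"
      using has_derivative_compose by blast
    then show ?thesis by (simp add: has_field_derivative_def mult_commute_abs)
  qed
  then obtain t where t: "0 < t" "t < 1" and eq: "u (p 1) - u (p 0) = (1 - 0) * ((z - y) \<bullet> G (p t))"
    using MVT2[of 0 1 "\<lambda>t. u (p t)" "\<lambda>t. (z - y) \<bullet> G (p t)"] by auto
  have "u z - u y - G y \<bullet> (z - y) = (z - y) \<bullet> (G (p t) - G y)"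
    using eq by (simp add: p_def inner_diff_right inner_commute)
  then have "\<bar>u z - u y - G y \<bullet> (z - y)\<bar> \<le> norm (z - y) * norm (G (p t) - G y)"
    using Cauchy_Schwarz_ineq2 by simp
  also have "\<dots> \<le> norm (z - y) * (K * norm (z - y) powr \<alpha>)"
  proof (intro mult_left_mono)
    have "dist (p t) y \<le> norm (z - y)" using t by (simp add: p_def dist_norm mult_left_le_one_le)
    then have "dist (p t) y powr \<alpha> \<le> norm (z - y) powr \<alpha>" using \<alpha> by (intro powr_mono2) auto
    then show "norm (G (p t) - G y) \<le> K * norm (z - y) powr \<alpha>"
      using hol[OF pU U(2), of t] t K by (meson less_imp_le mult_left_mono order_trans)
  qed auto
  also have "\<dots> = K * norm (z - y) powr (1 + \<alpha>)"
    by (cases "z = y") (simp_all add: powr_add)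
  finally show ?thesis .
qed

text \<open>As \<open>y\<close> is the barycentre, the linear terms at \<open>y\<close> average to
  zero and only Hoelder remainders are left. Locating only the points of nonzero weight allows sums
  over the entire grid.\<close>

lemma holder_convex_combination:
  fixes u :: "'a::euclidean_space \<Rightarrow> real"
  assumes U: "convex U" "y \<in> U" and \<alpha>: "0 < \<alpha>" and K: "0 \<le> K"
    and der: "\<And>x. x \<in> U \<Longrightarrow> GDERIV u x :> G x"
    and hol: "\<And>x y. x \<in> U \<Longrightarrow> y \<in> U \<Longrightarrow> norm (G x - G y) \<le> K * dist x y powr \<alpha>"
    and w: "\<And>i. i \<in> I \<Longrightarrow> 0 \<le> w i" "(\<Sum>i\<in>I. w i) = 1" "(\<Sum>i\<in>I. w i *\<^sub>R p i) = y"
    and p: "\<And>i. i \<in> I \<Longrightarrow> w i \<noteq> 0 \<Longrightarrow> p i \<in> U \<and> norm (p i - y) \<le> d"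
  shows "\<bar>(\<Sum>i\<in>I. w i * u (p i)) - u y\<bar> \<le> K * d powr (1 + \<alpha>)"
proof -
  have "(\<Sum>i\<in>I. w i * (G y \<bullet> (p i - y))) = G y \<bullet> (\<Sum>i\<in>I. w i *\<^sub>R (p i - y))"
    by (simp add: inner_sum_right)
  also have "(\<Sum>i\<in>I. w i *\<^sub>R (p i - y)) = 0"
    using w by (simp add: scaleR_diff_right sum_subtractf scaleR_left.sum[symmetric])
  finally have lin: "(\<Sum>i\<in>I. w i * (G y \<bullet> (p i - y))) = 0" by simp
  have "(\<Sum>i\<in>I. w i * u (p i)) - u y = (\<Sum>i\<in>I. w i * (u (p i) - u y - G y \<bullet> (p i - y)))"
    using w lin by (simp add: right_diff_distrib sum_subtractf sum_distrib_right[symmetric])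
  then have "\<bar>(\<Sum>i\<in>I. w i * u (p i)) - u y\<bar> \<le> (\<Sum>i\<in>I. \<bar>w i * (u (p i) - u y - G y \<bullet> (p i - y))\<bar>)"
    using sum_abs by simp
  also have "\<dots> \<le> (\<Sum>i\<in>I. w i * (K * d powr (1 + \<alpha>)))"
  proof (rule sum_mono)
    fix i assume i: "i \<in> I"
    show "\<bar>w i * (u (p i) - u y - G y \<bullet> (p i - y))\<bar> \<le> w i * (K * d powr (1 + \<alpha>))"
    proof (cases "w i = 0")
      case False
      then have p': "p i \<in> U" "norm (p i - y) \<le> d" using p i by auto
      have "\<bar>u (p i) - u y - G y \<bullet> (p i - y)\<bar> \<le> K * norm (p i - y) powr (1 + \<alpha>)"
        by (rule holder_gradient_remainder[OF U p'(1) \<alpha> K der hol])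
      also have "\<dots> \<le> K * d powr (1 + \<alpha>)" using K \<alpha> p' by (intro mult_left_mono powr_mono2) auto
      finally show ?thesis using w(1)[OF i] by (simp add: abs_mult mult_left_mono)
    qed simp
  qed
  also have "\<dots> = K * d powr (1 + \<alpha>)" using w by (simp add: sum_distrib_right[symmetric])
  finally show ?thesis .
qed

section \<open>Piecewise linear interpolation on the grid\<close>

lemma hat1_grid_combination:
  assumes L: "0 < L" and N: "1 \<le> N" and y: "- L \<le> y" "y \<le> L"
  obtains k t where "k \<in> {0..int N - 1}" "0 \<le> t" "t \<le> 1" "y = node L N k + t * mesh L N"
    "\<And>f::int \<Rightarrow> real. (\<Sum>i\<in>{0..int N}. hat1 (mesh L N) (y - node L N i) * f i) = (1 - t) * f k + t * f (k + 1)"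
proof -
  define h where "h = mesh L N"
  have h: "0 < h" using L N by (simp add: h_def mesh_def)
  have hN: "h * N = 2 * L" using N by (simp add: h_def mesh_def)
  \<comment> \<open>The minimum assigns the right end point \<open>y = L\<close> to the last cell,
    with \<open>t = 1\<close>, so that \<open>k + 1\<close> is always a grid index.\<close>
  define k where "k = min \<lfloor>(y + L) / h\<rfloor> (int N - 1)"
  define t where "t = (y + L) / h - of_int k"
  have k0: "0 \<le> k" using h y N by (simp add: k_def)
  have q: "(y + L) / h \<le> N" using h y hN by (simp add: pos_divide_le_eq mult.commute)
  have t: "0 \<le> t" "t \<le> 1"
  proof -
    have "of_int k \<le> (y + L) / h" unfolding k_def by (simp add: min_def) linarith
    then show "0 \<le> t" by (simp add: t_def)
    have "(y + L) / h \<le> of_int k + 1"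
    proof (cases "\<lfloor>(y + L) / h\<rfloor> \<le> int N - 1")
      case True
      then have "k = \<lfloor>(y + L) / h\<rfloor>" by (simp add: k_def)
      then show ?thesis by linarith
    next
      case False
      then have "k = int N - 1" by (simp add: k_def)
      then show ?thesis using q by simp
    qed
    then show "t \<le> 1" by (simp add: t_def)
  qed
  have yk: "y = node L N k + t * h"
    using h by (simp add: node_def h_def[symmetric] t_def left_diff_distrib)
  \<comment> \<open>In units of \<open>h\<close> the offset of \<open>y\<close> from node
    \<open>i\<close> is \<open>k - i + t\<close>, of modulus at least 1 unless \<open>i\<close> is
    an end of the cell.\<close>
  have hat: "hat1 h (y - node L N i) = (if i = k then 1 - t else if i = k + 1 then t else 0)" for i
  proof -
    have d: "y - node L N i = (of_int (k - i) + t) * h"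
      unfolding yk node_def h_def[symmetric] by (simp add: algebra_simps)
    consider "i = k" | "i = k + 1" | "i < k" | "k + 1 < i" by linarith
    then show ?thesis
    proof cases
      case 1
      then have e: "y - node L N i = t * h" using d by simp
      show ?thesis unfolding hat1_def e using 1 t h by (auto simp: abs_mult)
    next
      case 2
      then have e: "y - node L N i = - ((1 - t) * h)" using d by (simp add: algebra_simps)
      have "hat1 h (- ((1 - t) * h)) = t" unfolding hat1_def using t h by (auto simp: abs_mult)
      then show ?thesis unfolding e using 2 by simp
    next
      case 3
      then have "1 \<le> of_int (k - i) + t" using t by simp
      then have "h \<le> \<bar>(of_int (k - i) + t) * h\<bar>" using h by (simp add: abs_mult)
      then show ?thesis unfolding hat1_def d using 3 by simp
    next
      case 4
      then have "of_int (k - i) \<le> (- 2 :: real)" using of_int_le_iff[of "k - i" "-2", where 'a = real] by simp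
      then have "1 \<le> \<bar>of_int (k - i) + t\<bar>" using t by linarith
      then have "h \<le> \<bar>(of_int (k - i) + t) * h\<bar>" using h by (simp add: abs_mult)
      then show ?thesis unfolding hat1_def d using 4 by simp
    qed
  qed
  have kN: "k \<le> int N - 1" by (simp add: k_def)
  have "(\<Sum>i\<in>{0..int N}. hat1 h (y - node L N i) * f i) = (1 - t) * f k + t * f (k + 1)" for f :: "int \<Rightarrow> real"
  proof -
    have "(\<Sum>i\<in>{0..int N}. hat1 h (y - node L N i) * f i) = (\<Sum>i\<in>{k, k + 1}. hat1 h (y - node L N i) * f i)"
      using k0 kN by (intro sum.mono_neutral_right) (auto simp: hat)
    then show ?thesis by (simp add: hat)
  qed
  then show ?thesis using that[of k t] k0 kN t yk by (simp add: h_def)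
qed

text \<open>Linear interpolation reproduces affine functions: the combination formula is read for
  constant \<open>f\<close> and for \<open>f\<close> the node positions.\<close>

lemma hat1_partition_of_unity:
  assumes "0 < L" "1 \<le> N" "- L \<le> y" "y \<le> L"
  shows "(\<Sum>i\<in>{0..int N}. hat1 (mesh L N) (y - node L N i)) = 1"
    and "(\<Sum>i\<in>{0..int N}. hat1 (mesh L N) (y - node L N i) * node L N i) = y"
proof -
  obtain k t where k: "y = node L N k + t * mesh L N"
    "\<And>f::int \<Rightarrow> real. (\<Sum>i\<in>{0..int N}. hat1 (mesh L N) (y - node L N i) * f i) = (1 - t) * f k + t * f (k + 1)"
    using hat1_grid_combination[OF assms] by metis
  show "(\<Sum>i\<in>{0..int N}. hat1 (mesh L N) (y - node L N i)) = 1"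
    using k(2)[of "\<lambda>_. 1"] by simp
  show "(\<Sum>i\<in>{0..int N}. hat1 (mesh L N) (y - node L N i) * node L N i) = y"
  proof -
    have "(1 - t) * node L N k + t * node L N (k + 1) = y"
      unfolding k(1) by (simp add: node_def algebra_simps)
    then show ?thesis using k(2)[of "node L N"] by simp
  qed
qed

lemma hat1_nonneg: "0 < h \<Longrightarrow> 0 \<le> hat1 h y"
  by (auto simp: hat1_def)

section \<open>The grid error for Hoelder differentiable functions\<close>

lemma mem_cube: "x \<in> cube L \<longleftrightarrow> (\<forall>b\<in>Basis. \<bar>x \<bullet> b\<bar> \<le> L)"
  unfolding cube_def mem_box by (auto simp: abs_le_iff)

lemma mem_open_cube: "x \<in> open_cube L \<longleftrightarrow> (\<forall>b\<in>Basis. \<bar>x \<bullet> b\<bar> < L)"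
  unfolding open_cube_def mem_box by (auto simp: abs_less_iff)

lemma cube_sets [measurable]: "cube L \<in> sets borel"
  by (simp add: cube_def)

lemma closed_cube_subset_open_cube: "0 < \<delta> \<Longrightarrow> cube L \<subseteq> open_cube (L + \<delta>)"
  by (force simp: mem_cube mem_open_cube)

lemma translate_in_open_cube:
  assumes "x \<in> cube L" "norm z < \<delta>"
  shows "x + z \<in> open_cube (L + \<delta>)"
  unfolding mem_open_cube
proof
  fix b :: 'a assume b: "b \<in> Basis"
  have "\<bar>x \<bullet> b\<bar> \<le> L" using assms b by (simp add: mem_cube)
  moreover have "\<bar>z \<bullet> b\<bar> < \<delta>" using Basis_le_norm[OF b, of z] assms by simp
  ultimately show "\<bar>(x + z) \<bullet> b\<bar> < L + \<delta>" by (simp add: inner_add_left)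
qed

text \<open>The hypotheses in arbitrary dimension, shared by both schemes. \<open>u\<close> and
  \<open>g\<close> are related almost everywhere only, whereas on the open cube the values of
  \<open>u\<close> count pointwise, since they are sampled at nodes.\<close>

locale holder_problem =
  fixes L \<delta> \<alpha> :: real and g u :: "'a::euclidean_space \<Rightarrow> real"
  assumes L: "0 < L" and \<delta>: "0 < \<delta>" and \<alpha>: "0 < \<alpha>" "\<alpha> \<le> 1"
    and g: "Linfty g" "bounded_support g" "AE x in lebesgue. x \<in> cube L \<longrightarrow> g x = 0"
    and ug: "AE x in lebesgue. x \<notin> cube L \<longrightarrow> u x = g x"
    and u: "C1_holder_closure \<alpha> (open_cube (L + \<delta>)) u"
begin

lemma cube_subset: "cube L \<subseteq> open_cube (L + \<delta>)"
  using closed_cube_subset_open_cube[OF \<delta>] .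

lemma gradient:
  obtains G K where "0 \<le> K" "\<And>x. x \<in> open_cube (L + \<delta>) \<Longrightarrow> GDERIV u x :> G x"
    "\<And>x y. x \<in> open_cube (L + \<delta>) \<Longrightarrow> y \<in> open_cube (L + \<delta>) \<Longrightarrow> norm (G x - G y) \<le> K * dist x y powr \<alpha>"
proof -
  obtain G K where G: "\<And>x. x \<in> open_cube (L + \<delta>) \<Longrightarrow> GDERIV u x :> G x"
    "\<And>x y. x \<in> open_cube (L + \<delta>) \<Longrightarrow> y \<in> open_cube (L + \<delta>) \<Longrightarrow> norm (G x - G y) \<le> K * dist x y powr \<alpha>"
    using u unfolding C1_holder_closure_def by blast
  have "norm (G x - G y) \<le> \<bar>K\<bar> * dist x y powr \<alpha>" if "x \<in> open_cube (L + \<delta>)" "y \<in> open_cube (L + \<delta>)" for x y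
    using order_trans[OF G(2)[OF that] mult_right_mono[of K "\<bar>K\<bar>" "dist x y powr \<alpha>"]] by simp
  then show ?thesis using that[of "\<bar>K\<bar>" G] G(1) by simp
qed

text \<open>\<open>K\<close> is the Hoelder constant of the gradient, fixed before grid, weights and
  point, hence independent of the mesh. The index type stays open for integers in dimension one and
  pairs in dimension two.\<close>

lemma interpolation_bound:
  obtains K where "0 \<le> K" "\<And>(I::'i set) w p y d. y \<in> cube L \<Longrightarrow> (\<And>i. i \<in> I \<Longrightarrow> 0 \<le> w i) \<Longrightarrow> (\<Sum>i\<in>I. w i) = 1 \<Longrightarrow>
    (\<Sum>i\<in>I. w i *\<^sub>R p i) = y \<Longrightarrow> (\<And>i. i \<in> I \<Longrightarrow> w i \<noteq> 0 \<Longrightarrow> p i \<in> cube L \<and> norm (p i - y) \<le> d) \<Longrightarrow>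
    \<bar>(\<Sum>i\<in>I. w i * u (p i)) - u y\<bar> \<le> K * d powr (1 + \<alpha>)"
proof -
  obtain G K where G: "0 \<le> K" "\<And>x. x \<in> open_cube (L + \<delta>) \<Longrightarrow> GDERIV u x :> G x"
    "\<And>x y. x \<in> open_cube (L + \<delta>) \<Longrightarrow> y \<in> open_cube (L + \<delta>) \<Longrightarrow> norm (G x - G y) \<le> K * dist x y powr \<alpha>"
    using gradient by metis
  have "convex (open_cube (L + \<delta>) :: 'a set)" by (simp add: open_cube_def convex_box)
  note comb = holder_convex_combination[OF this _ \<alpha>(1) G]
  show ?thesis
  proof (rule that[OF G(1)])
    fix I :: "'i set" and w :: "'i \<Rightarrow> real" and p :: "'i \<Rightarrow> 'a" and y :: 'a and d :: real
    assume "y \<in> cube L" "\<And>i. i \<in> I \<Longrightarrow> 0 \<le> w i" "(\<Sum>i\<in>I. w i) = 1" "(\<Sum>i\<in>I. w i *\<^sub>R p i) = y"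
      "\<And>i. i \<in> I \<Longrightarrow> w i \<noteq> 0 \<Longrightarrow> p i \<in> cube L \<and> norm (p i - y) \<le> d"
    then show "\<bar>(\<Sum>i\<in>I. w i * u (p i)) - u y\<bar> \<le> K * d powr (1 + \<alpha>)"
      using cube_subset by (intro comb) auto
  qed
qed

lemma measurable_g: "g \<in> borel_measurable lebesgue"
  using g(1) by (simp add: Linfty_def)

lemma bounded_on_cube: obtains B where "0 \<le> B" "\<And>x. x \<in> open_cube (L + \<delta>) \<Longrightarrow> \<bar>u x\<bar> \<le> B"
proof -
  have "bounded (u ` closure (open_cube (L + \<delta>)))" using u unfolding C1_holder_closure_def by blast
  then obtain B where "\<And>x. x \<in> closure (open_cube (L + \<delta>)) \<Longrightarrow> \<bar>u x\<bar> \<le> B"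
    unfolding bounded_iff by auto
  then have "\<bar>u x\<bar> \<le> \<bar>B\<bar>" if "x \<in> open_cube (L + \<delta>)" for x
    using that closure_subset[of "open_cube (L + \<delta>) :: 'a set"] by fastforce
  then show ?thesis using that[of "\<bar>B\<bar>"] by simp
qed

text \<open>Almost everywhere, \<open>u\<close> is glued from a continuous function on the cube and
  \<open>g\<close> outside; completeness of \<open>lebesgue\<close> transfers measurability.\<close>

lemma measurable_u: "u \<in> borel_measurable lebesgue"
proof -
  have "continuous_on (cube L) u"
    using u cube_subset closure_subset[of "open_cube (L + \<delta>) :: 'a set"]
    unfolding C1_holder_closure_def by (meson continuous_on_subset subset_trans)
  then have "(\<lambda>x. indicator (cube L) x *\<^sub>R u x) \<in> borel_measurable borel"
    by (intro borel_measurable_continuous_on_indicator) auto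
  then have m: "(\<lambda>x. indicator (cube L) x *\<^sub>R u x) \<in> borel_measurable lebesgue"
    by (intro measurable_completion) simp
  have "(indicator (- cube L) :: 'a \<Rightarrow> real) \<in> borel_measurable lebesgue"
    by (intro measurable_completion) auto
  then have "(\<lambda>x. indicator (cube L) x *\<^sub>R u x + indicator (- cube L) x * g x) \<in> borel_measurable lebesgue"
    using m measurable_g by (intro borel_measurable_add borel_measurable_times)
  moreover have "AE x in lebesgue. indicator (cube L) x *\<^sub>R u x + indicator (- cube L) x * g x = u x"
    using ug by eventually_elim (auto simp: indicator_def)
  ultimately show ?thesis by (rule borel_measurable_AE)
qed

lemma AE_bounded_u: obtains B where "0 \<le> B" "AE x in lebesgue. \<bar>u x\<bar> \<le> B" "\<And>x. x \<in> open_cube (L + \<delta>) \<Longrightarrow> \<bar>u x\<bar> \<le> B"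
proof -
  obtain B where B: "0 \<le> B" "\<And>x. x \<in> open_cube (L + \<delta>) \<Longrightarrow> \<bar>u x\<bar> \<le> B" using bounded_on_cube by blast
  obtain M where M: "AE x in lebesgue. \<bar>g x\<bar> \<le> M" using g(1) by (auto simp: Linfty_def)
  have "AE x in lebesgue. \<bar>u x\<bar> \<le> max B M"
    using ug M
  proof eventually_elim
    case (elim x)
    then show ?case using B(2)[of x] cube_subset by (cases "x \<in> cube L") fastforce+
  qed
  then show ?thesis using that[of "max B M"] B by fastforce
qed

text \<open>For \<open>norm z < \<delta>\<close> both \<open>x + z\<close> and \<open>x - z\<close>
  stay in the open cube, and the gradient terms of the two expansions at \<open>x\<close> cancel.
  Beyond, the trivial bound \<open>2 * B\<close> is at most
  \<open>2 * B * (norm z / \<delta>) powr (1 + \<alpha>)\<close>.\<close>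

lemma symmetric_difference_bound:
  obtains M where "0 \<le> M" "\<And>x. x \<in> cube L \<Longrightarrow>
    AE z in lebesgue. \<bar>u x - (u (x + z) + u (x - z)) / 2\<bar> \<le> M * norm z powr (1 + \<alpha>)"
proof -
  obtain G K where G: "0 \<le> K" "\<And>x. x \<in> open_cube (L + \<delta>) \<Longrightarrow> GDERIV u x :> G x"
    "\<And>x y. x \<in> open_cube (L + \<delta>) \<Longrightarrow> y \<in> open_cube (L + \<delta>) \<Longrightarrow> norm (G x - G y) \<le> K * dist x y powr \<alpha>"
    using gradient by metis
  obtain B where B: "0 \<le> B" "AE x in lebesgue. \<bar>u x\<bar> \<le> B" "\<And>x. x \<in> open_cube (L + \<delta>) \<Longrightarrow> \<bar>u x\<bar> \<le> B"
    using AE_bounded_u by blast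
  have conv: "convex (open_cube (L + \<delta>) :: 'a set)" by (simp add: open_cube_def convex_box)
  define M where "M = K + 2 * B / \<delta> powr (1 + \<alpha>)"
  have "AE z in lebesgue. \<bar>u x - (u (x + z) + u (x - z)) / 2\<bar> \<le> M * norm z powr (1 + \<alpha>)" if x: "x \<in> cube L" for x
  proof -
    have "AE z in lebesgue. \<bar>u (x + z)\<bar> \<le> B" "AE z in lebesgue. \<bar>u (x - z)\<bar> \<le> B"
      using AE_scale_translate[OF B(2), of 1 x] AE_scale_translate[OF B(2), of "-1" x] by simp_all
    then show ?thesis
    proof eventually_elim
      case (elim z)
      have xU: "x \<in> open_cube (L + \<delta>)" using x cube_subset by blast
      show ?case
      proof (cases "norm z < \<delta>")
        case True
        have xp: "x + z \<in> open_cube (L + \<delta>)" using translate_in_open_cube[OF x True] .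
        have xm: "x - z \<in> open_cube (L + \<delta>)" using translate_in_open_cube[OF x, of "- z" \<delta>] True by simp
        have "\<bar>u (x + z) - u x - G x \<bullet> (x + z - x)\<bar> \<le> K * norm (x + z - x) powr (1 + \<alpha>)"
          by (rule holder_gradient_remainder[OF conv xU xp \<alpha>(1) G])
        moreover have "\<bar>u (x - z) - u x - G x \<bullet> (x - z - x)\<bar> \<le> K * norm (x - z - x) powr (1 + \<alpha>)"
          by (rule holder_gradient_remainder[OF conv xU xm \<alpha>(1) G])
        ultimately have "\<bar>u (x + z) - u x - G x \<bullet> z\<bar> \<le> K * norm z powr (1 + \<alpha>)"
          "\<bar>u (x - z) - u x + G x \<bullet> z\<bar> \<le> K * norm z powr (1 + \<alpha>)" by simp_all
        then have "\<bar>u x - (u (x + z) + u (x - z)) / 2\<bar> \<le> K * norm z powr (1 + \<alpha>)"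
          by (simp add: abs_le_iff field_simps; linarith)
        also have "\<dots> \<le> M * norm z powr (1 + \<alpha>)"
          unfolding M_def using B(1) by (intro mult_right_mono) auto
        finally show ?thesis .
      next
        case False
        have "\<bar>u x\<bar> \<le> B" using B(3) xU by blast
        then have "\<bar>u x - (u (x + z) + u (x - z)) / 2\<bar> \<le> 2 * B"
          using elim by (simp add: abs_le_iff field_simps; linarith)
        also have "\<dots> = 2 * B / \<delta> powr (1 + \<alpha>) * \<delta> powr (1 + \<alpha>)" using \<delta> by simp
        also have "\<dots> \<le> M * norm z powr (1 + \<alpha>)"
          using False \<delta> \<alpha> B(1) G(1) unfolding M_def by (intro mult_mono powr_mono2) auto
        finally show ?thesis .
      qed
    qed
  qed
  moreover have "0 \<le> M" using G(1) B(1) by (simp add: M_def)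
  ultimately show ?thesis using that by blast
qed

text \<open>\<open>W\<close> stands for the interpolant extended by zero, so that
  \<open>W + g\<close> approximates \<open>u\<close> on the whole space. \<open>C\<close> is fixed
  before \<open>h\<close>, \<open>x\<close> and \<open>W\<close>, hence uniform over all grids and
  nodes.\<close>

lemma grid_error_bound:
  fixes S :: "'a set"
  assumes S: "isotropic_stencil S a"
    and s: "0 < s" "s < 1" "real DIM('a) / 2 + s \<noteq> 1" "2 * s - 1 < \<alpha>"
  obtains C where "0 < C" "\<And>h x W. 0 < h \<Longrightarrow> x \<in> cube L \<Longrightarrow> W \<in> borel_measurable lebesgue \<Longrightarrow>
    (\<And>y. y \<notin> cube L \<Longrightarrow> W y = 0) \<Longrightarrow> (\<And>y. y \<in> cube L \<Longrightarrow> \<bar>W y - u y\<bar> \<le> M' * h powr (1 + \<alpha>)) \<Longrightarrow>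
    \<bar>frac_laplacian s u x + (\<Sum>v\<in>S. a v * second_diff (\<lambda>p. frac_const DIM('a) (s - 1) *
        (LINT y|lebesgue. norm (p - y) powr (2 - real DIM('a) - 2 * s) * (W y + g y))) (h *\<^sub>R v) x) / h\<^sup>2\<bar>
    \<le> C * h powr (1 + \<alpha> - 2 * s)"
proof -
  interpret isotropic_stencil S a by (rule S)
  obtain M where M: "0 \<le> M" "\<And>x. x \<in> cube L \<Longrightarrow>
    AE z in lebesgue. \<bar>u x - (u (x + z) + u (x - z)) / 2\<bar> \<le> M * norm z powr (1 + \<alpha>)"
    using symmetric_difference_bound by blast
  obtain B where B: "AE x in lebesgue. \<bar>u x\<bar> \<le> B" using AE_bounded_u by blast
  obtain r where r: "AE x in lebesgue. norm x > r \<longrightarrow> g x = 0" using g(2) by (auto simp: bounded_support_def)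
  have "bounded (cube L :: 'a set)" by (simp add: cube_def)
  then obtain r' where r': "\<And>x::'a. x \<in> cube L \<Longrightarrow> norm x \<le> r'" unfolding bounded_iff by blast
  define \<gamma> where "\<gamma> = 2 - real DIM('a) - 2 * s"
  define C where "C = \<bar>frac_const DIM('a) (s - 1)\<bar> *
    (M * (LINT z|lebesgue. \<bar>\<gamma> * (\<gamma> + real DIM('a) - 2) * norm z powr (\<gamma> - 2) - kernel \<gamma> 1 z\<bar> * norm z powr (1 + \<alpha>))
            + M' * (LINT z|lebesgue. \<bar>kernel \<gamma> 1 z\<bar>))"
  have "\<bar>frac_laplacian s u x + (\<Sum>v\<in>S. a v * second_diff (\<lambda>p. frac_const DIM('a) (s - 1) *
        (LINT y|lebesgue. norm (p - y) powr (2 - real DIM('a) - 2 * s) * (W y + g y))) (h *\<^sub>R v) x) / h\<^sup>2\<bar>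
    \<le> (\<bar>C\<bar> + 1) * h powr (1 + \<alpha> - 2 * s)"
    if h: "0 < h" and x: "x \<in> cube L" and Wm: "W \<in> borel_measurable lebesgue"
      and W0: "\<And>y. y \<notin> cube L \<Longrightarrow> W y = 0" and W: "\<And>y. y \<in> cube L \<Longrightarrow> \<bar>W y - u y\<bar> \<le> M' * h powr (1 + \<alpha>)"
    for h x W
  proof -
    \<comment> \<open>The sign of \<open>M'\<close> is not assumed. The bound must be nonnegative to
      hold outside the cube, where the error is zero; its value at the origin shows this.\<close>
    have "0 \<in> cube L" using L by (simp add: mem_cube)
    then have M'0: "0 \<le> M' * h powr (1 + \<alpha>)" using W by (metis abs_ge_zero order_trans)
    have err: "AE y in lebesgue. \<bar>(W y + g y) - u y\<bar> \<le> M' * h powr (1 + \<alpha>)"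
      using ug g(3)
    proof eventually_elim
      case (elim y)
      then show ?case using W[of y] W0[of y] M'0 by (cases "y \<in> cube L") auto
    qed
    have bd: "AE y in lebesgue. \<bar>W y + g y\<bar> \<le> B + M' * h powr (1 + \<alpha>)"
      using err B by eventually_elim linarith
    have supp: "AE y in lebesgue. max r r' < norm y \<longrightarrow> W y + g y = 0"
      using r
    proof eventually_elim
      case (elim y)
      then show ?case using r'[of y] W0[of y] by (cases "y \<in> cube L") auto
    qed
    have m: "(\<lambda>y. W y + g y) \<in> borel_measurable lebesgue" using Wm measurable_g by simp
    have "\<bar>frac_laplacian s u x + (\<Sum>v\<in>S. a v * second_diff (\<lambda>p. frac_const DIM('a) (s - 1) *
        (LINT y|lebesgue. norm (p - y) powr (2 - real DIM('a) - 2 * s) * (W y + g y))) (h *\<^sub>R v) x) / h\<^sup>2\<bar>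
      \<le> C * h powr (1 + \<alpha> - 2 * s)"
      unfolding C_def \<gamma>_def
      by (rule consistency[OF s(1-3) _ _ h measurable_u B M(2)[OF x] m bd supp err]) (use s \<alpha> in auto)
    \<comment> \<open>Absolute value and added 1 make the constant strictly positive.\<close>
    also have "\<dots> \<le> (\<bar>C\<bar> + 1) * h powr (1 + \<alpha> - 2 * s)" by (intro mult_right_mono) auto
    finally show ?thesis .
  qed
  then show ?thesis using that[of "\<bar>C\<bar> + 1"] by (auto simp: add_nonneg_pos)
qed

end

text \<open>\<open>I\<close> is meant for interior nodes, whose hat potentials produce the weights
  of the scheme; \<open>J\<close> for boundary nodes, whose potentials together with that of
  \<open>g\<close> form the known term \<open>R\<close>.\<close>

lemma (in holder_problem) potential_decomposition:
  assumes \<gamma>: "- real DIM('a) < \<gamma>" and J: "finite I" "finite J" "I \<inter> J = {}"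
    and \<phi>: "\<And>j. j \<in> I \<union> J \<Longrightarrow> integrable lebesgue (\<lambda>y. norm (p - y) powr \<gamma> * \<phi> j y)"
  shows "(LINT y|lebesgue. norm (p - y) powr \<gamma> * ((\<Sum>j\<in>I \<union> J. U j * \<phi> j y) + g y))
    = (\<Sum>j\<in>I. (LINT y|lebesgue. norm (p - y) powr \<gamma> * \<phi> j y) * U j)
      + ((LINT y|lebesgue. norm (p - y) powr \<gamma> * g y) + (\<Sum>j\<in>J. LINT y|lebesgue. norm (p - y) powr \<gamma> * (U j * \<phi> j y)))"
proof -
  obtain B where B: "AE y in lebesgue. \<bar>g y\<bar> \<le> B" using g(1) by (auto simp: Linfty_def)
  obtain r where r: "AE y in lebesgue. r < norm y \<longrightarrow> g y = 0" using g(2) by (auto simp: bounded_support_def)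
  have gi: "integrable lebesgue (\<lambda>y. norm (p - y) powr \<gamma> * g y)"
    by (rule norm_powr_potential_integrable[OF \<gamma> measurable_g B r])
  have i: "integrable lebesgue (\<lambda>y. U j * (norm (p - y) powr \<gamma> * \<phi> j y))" if "j \<in> I \<union> J" for j
    using \<phi>[OF that] by simp
  have "(LINT y|lebesgue. norm (p - y) powr \<gamma> * ((\<Sum>j\<in>I \<union> J. U j * \<phi> j y) + g y))
    = (LINT y|lebesgue. (\<Sum>j\<in>I \<union> J. U j * (norm (p - y) powr \<gamma> * \<phi> j y)) + norm (p - y) powr \<gamma> * g y)"
    by (intro Bochner_Integration.integral_cong refl) (simp add: distrib_left sum_distrib_left mult_ac)
  also have "\<dots> = (\<Sum>j\<in>I \<union> J. LINT y|lebesgue. U j * (norm (p - y) powr \<gamma> * \<phi> j y)) + (LINT y|lebesgue. norm (p - y) powr \<gamma> * g y)"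
    using i gi by (subst Bochner_Integration.integral_add) (auto simp: Bochner_Integration.integral_sum intro!: Bochner_Integration.integrable_sum)
  also have "\<dots> = (\<Sum>j\<in>I. LINT y|lebesgue. U j * (norm (p - y) powr \<gamma> * \<phi> j y))
     + (\<Sum>j\<in>J. LINT y|lebesgue. U j * (norm (p - y) powr \<gamma> * \<phi> j y)) + (LINT y|lebesgue. norm (p - y) powr \<gamma> * g y)"
    using J by (simp add: sum.union_disjoint)
  also have "(\<Sum>j\<in>I. LINT y|lebesgue. U j * (norm (p - y) powr \<gamma> * \<phi> j y)) = (\<Sum>j\<in>I. (LINT y|lebesgue. norm (p - y) powr \<gamma> * \<phi> j y) * U j)"
    by (simp only: integral_mult_right_zero mult.commute)
  also have "(\<Sum>j\<in>J. LINT y|lebesgue. U j * (norm (p - y) powr \<gamma> * \<phi> j y)) = (\<Sum>j\<in>J. LINT y|lebesgue. norm (p - y) powr \<gamma> * (U j * \<phi> j y))"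
    by (simp only: mult.left_commute)
  finally show ?thesis by (simp only: add_ac)
qed

section \<open>The one-dimensional scheme\<close>

lemma mesh_pos: "0 < L \<Longrightarrow> 1 \<le> N \<Longrightarrow> 0 < mesh L N"
  by (simp add: mesh_def)

lemma node_mem_interval:
  assumes "0 < L" "1 \<le> N" "i \<in> {0..int N}"
  shows "node L N i \<in> {- L..L}"
proof -
  have h: "0 < mesh L N" using assms mesh_pos by simp
  have "of_int i * mesh L N \<le> of_int (int N) * mesh L N"
    using assms h by (intro mult_right_mono) auto
  also have "\<dots> = 2 * L" using assms by (simp add: mesh_def)
  finally show ?thesis using assms h by (simp add: node_def)
qed

lemma hat1_le_1: "0 < h \<Longrightarrow> hat1 h y \<le> 1"
  by (auto simp: hat1_def)

lemma hat1_minus: "hat1 h (- y) = hat1 h y"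
  by (simp add: hat1_def)

lemma borel_measurable_hat1 [measurable]: "hat1 h \<in> borel_measurable borel"
  unfolding hat1_def[abs_def] by measurable

lemma cube_real: "(cube L :: real set) = {- L..L}"
  by (auto simp: mem_cube abs_le_iff)

lemma phi1_in_cube:
  assumes "y \<in> cube L" "0 < L" "1 \<le> N"
  shows "phi1 L N i y = hat1 (mesh L N) (y - node L N i)"
  using assms by (auto simp: phi1_def hat1_def indicator_def node_def algebra_simps)

lemma phi1_outside_cube: "y \<notin> cube L \<Longrightarrow> phi1 L N i y = 0"
  by (simp add: phi1_def)

text \<open>The support of an interior hat ends at neighbouring nodes, which are in
  \<open>[-L, L]\<close>, so outside the cube both sides vanish.\<close>

lemma phi1_interior:
  assumes "i \<in> interior1 N" "0 < L"
  shows "phi1 L N i y = hat1 (mesh L N) (y - node L N i)"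
proof (cases "y \<in> cube L")
  case True
  then show ?thesis using assms by (intro phi1_in_cube) (auto simp: interior1_def)
next
  case False
  have N: "1 \<le> N" using assms by (auto simp: interior1_def)
  have "node L N (i - 1) \<in> {- L..L}" "node L N (i + 1) \<in> {- L..L}"
    using node_mem_interval[OF assms(2) N, of "i - 1"] node_mem_interval[OF assms(2) N, of "i + 1"] assms(1)
    by (auto simp: interior1_def)
  then have "\<not> \<bar>y - node L N i\<bar> < mesh L N"
    using False by (auto simp: cube_real node_def algebra_simps)
  then show ?thesis using False by (simp add: phi1_outside_cube hat1_def)
qed

lemma borel_measurable_phi1 [measurable]: "phi1 L N i \<in> borel_measurable borel"
  unfolding phi1_def[abs_def] by measurable

lemma lap1_add: "lap1 h (\<lambda>k. v k + w k) i = lap1 h v i + lap1 h w i"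
  by (simp add: lap1_def algebra_simps add_divide_distrib diff_divide_distrib)

lemma lap1_sum:
  "finite I \<Longrightarrow> lap1 h (\<lambda>k. \<Sum>j\<in>I. v j k * c j) i = (\<Sum>j\<in>I. lap1 h (v j) i * c j)"
proof (induction I rule: finite_induct)
  case empty
  then show ?case by (simp add: lap1_def)
next
  case (insert j I)
  have "lap1 h (\<lambda>k. v j k * c j) i = lap1 h (v j) i * c j"
    by (simp add: lap1_def algebra_simps)
  then show ?case using insert by (simp add: lap1_add)
qed

text \<open>Second differences are symmetric and commute with \<open>k -> j - k\<close>. This reads
  the weight at \<open>j - i\<close> as a discrete Laplacian, taken at \<open>i\<close>, of the
  potential of the \<open>j\<close>-th hat.\<close>

lemma lap1_reflect: "lap1 h (\<lambda>k. v (j - k)) i = lap1 h v (j - i)"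
  by (simp add: lap1_def algebra_simps)

text \<open>The substitution of \<open>x_j - y\<close> for \<open>y\<close>, with \<open>x_j\<close>
  the node of index \<open>j\<close>, turns the distance into that of \<open>omega1\<close> up to
  sign; the hat is even and vanishes outside \<open>[-h, h]\<close>.\<close>

lemma omega1_eq_potential:
  assumes j: "j \<in> interior1 N" and L: "0 < L"
  shows "omega1 s (mesh L N) (j - i) = frac_const 1 (s - 1) *
    (LINT y|lebesgue. norm (node L N i - y) powr (1 - 2 * s) * phi1 L N j y)"
proof -
  define h where "h = mesh L N"
  define f where "f y = norm (node L N i - y) powr (1 - 2 * s) * phi1 L N j y" for y
  have m: "f \<in> borel_measurable lebesgue"
    unfolding f_def[abs_def] by (intro measurable_completion) simp
  have "f (node L N j + (-1) *\<^sub>R y) = indicator {-h..h} y *\<^sub>R (\<bar>of_int (j - i) * h - y\<bar> powr (1 - 2 * s) * hat1 h y)" for y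
  proof -
    have "node L N i - (node L N j + (-1) *\<^sub>R y) = - (of_int (j - i) * h - y)"
      by (simp add: node_def h_def algebra_simps)
    then have e: "norm (node L N i - (node L N j + (-1) *\<^sub>R y)) = \<bar>of_int (j - i) * h - y\<bar>"
      by (simp only: norm_minus_cancel real_norm_def)
    have "phi1 L N j (node L N j + (-1) *\<^sub>R y) = hat1 h y"
      using phi1_interior[OF j L] by (simp add: h_def hat1_minus)
    then show ?thesis unfolding f_def e by (auto simp: indicator_def hat1_def)
  qed
  then have "(LINT y|lebesgue. f y) = (LINT y:{-h..h}|lebesgue. \<bar>of_int (j - i) * h - y\<bar> powr (1 - 2 * s) * hat1 h y)"
    using integral_scale_translate[OF m, of "-1" "node L N j"] by (simp add: set_lebesgue_integral_def)
  then show ?thesis by (simp add: omega1_def f_def h_def)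
qed

lemma error1_bound:
  assumes "holder_problem L \<delta> \<alpha> g u" and s: "0 < s" "s < 1" "s \<noteq> 1 / 2" "2 * s - 1 < \<alpha>"
  shows "\<exists>C>0. \<forall>N\<ge>1. \<forall>i\<in>interior1 N. \<bar>error1 s L N g u i\<bar> \<le> C * mesh L N powr (1 + \<alpha> - 2 * s)"
proof -
  interpret holder_problem L \<delta> \<alpha> g u by fact
  have iso: "isotropic_stencil {1::real} (\<lambda>_. 1)"
    by unfold_locales (simp_all add: power2_eq_square)
  have s': "real DIM(real) / 2 + s \<noteq> 1" using s by simp
  show ?thesis
  proof (rule interpolation_bound[where 'i = int])
    fix K assume K: "\<And>(I::int set) w p y d. y \<in> cube L \<Longrightarrow> (\<And>i. i \<in> I \<Longrightarrow> 0 \<le> w i) \<Longrightarrow> (\<Sum>i\<in>I. w i) = 1 \<Longrightarrow>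
      (\<Sum>i\<in>I. w i *\<^sub>R p i) = y \<Longrightarrow> (\<And>i. i \<in> I \<Longrightarrow> w i \<noteq> 0 \<Longrightarrow> p i \<in> cube L \<and> norm (p i - y) \<le> d) \<Longrightarrow>
      \<bar>(\<Sum>i\<in>I. w i * u (p i)) - u y\<bar> \<le> K * d powr (1 + \<alpha>)"
    show ?thesis
    proof (rule grid_error_bound[OF iso s(1,2) s' s(4), of K])
      fix C assume C: "0 < C" "\<And>h x W. 0 < h \<Longrightarrow> x \<in> cube L \<Longrightarrow> W \<in> borel_measurable lebesgue \<Longrightarrow>
        (\<And>y. y \<notin> cube L \<Longrightarrow> W y = 0) \<Longrightarrow> (\<And>y. y \<in> cube L \<Longrightarrow> \<bar>W y - u y\<bar> \<le> K * h powr (1 + \<alpha>)) \<Longrightarrow>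
        \<bar>frac_laplacian s u x + (\<Sum>v\<in>{1}. 1 * second_diff (\<lambda>p. frac_const DIM(real) (s - 1) *
            (LINT y|lebesgue. norm (p - y) powr (2 - real DIM(real) - 2 * s) * (W y + g y))) (h *\<^sub>R v) x) / h\<^sup>2\<bar>
        \<le> C * h powr (1 + \<alpha> - 2 * s)"
      have "\<bar>error1 s L N g u i\<bar> \<le> C * mesh L N powr (1 + \<alpha> - 2 * s)" if N: "1 \<le> N" and i: "i \<in> interior1 N" for N i
      proof -
        define h where "h = mesh L N"
        define W where "W y = (\<Sum>j\<in>{0..int N}. u (node L N j) * phi1 L N j y)" for y
        \<comment> \<open>At the nodes, the scheme is minus the second difference quotient of this
          potential.\<close>
        define V where "V p = frac_const 1 (s - 1) * (LINT y|lebesgue. norm (p - y) powr (1 - 2 * s) * (W y + g y))" for p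
        have h: "0 < h" using mesh_pos[OF L N] by (simp add: h_def)
        have Wm: "W \<in> borel_measurable lebesgue"
          unfolding W_def[abs_def] by (intro measurable_completion) simp
        have W0: "W y = 0" if "y \<notin> cube L" for y
          using that by (simp add: W_def phi1_outside_cube)
        have Wu: "\<bar>W y - u y\<bar> \<le> K * h powr (1 + \<alpha>)" if y: "y \<in> cube L" for y
        proof -
          have y': "- L \<le> y" "y \<le> L" using y by (auto simp: cube_real)
          have "W y = (\<Sum>j\<in>{0..int N}. hat1 h (y - node L N j) * u (node L N j))"
            by (simp add: W_def phi1_in_cube[OF y L N] h_def mult.commute)
          moreover have "\<bar>(\<Sum>j\<in>{0..int N}. hat1 h (y - node L N j) * u (node L N j)) - u y\<bar> \<le> K * h powr (1 + \<alpha>)"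
          proof (rule K[OF y])
            show "(\<Sum>j\<in>{0..int N}. hat1 h (y - node L N j)) = 1" "(\<Sum>j\<in>{0..int N}. hat1 h (y - node L N j) *\<^sub>R node L N j) = y"
              using hat1_partition_of_unity[OF L N y'] by (simp_all add: h_def)
            show "node L N j \<in> cube L \<and> norm (node L N j - y) \<le> h" if "j \<in> {0..int N}" "hat1 h (y - node L N j) \<noteq> 0" for j
              using node_mem_interval[OF L N that(1)] that(2)
              by (auto simp: cube_real hat1_def abs_minus_commute split: if_splits)
          qed (simp add: hat1_nonneg h)
          ultimately show ?thesis by simp
        qed
        have ix: "node L N i \<in> cube L"
          using node_mem_interval[OF L N, of i] i by (auto simp: cube_real interior1_def)
        \<comment> \<open>Stated for all integers \<open>k\<close>, because the second difference at
          an interior node may also read the potential at the two end nodes.\<close>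
        have V: "V (node L N k) = (\<Sum>j\<in>interior1 N. omega1 s h (j - k) * u (node L N j)) + R1 s L N g u k" for k
        proof -
          have i: "integrable lebesgue (\<lambda>y. norm (p - y) powr (1 - 2 * s) * phi1 L N j y)" for p j
          proof (rule norm_powr_potential_integrable[where B = 1 and r = L])
            show "phi1 L N j \<in> borel_measurable lebesgue" by (intro measurable_completion) simp
            show "AE y in lebesgue. \<bar>phi1 L N j y\<bar> \<le> 1"
              using hat1_le_1[OF h] hat1_nonneg[OF h] by (intro AE_I2) (auto simp: phi1_def h_def indicator_def)
            show "AE y in lebesgue. L < norm y \<longrightarrow> phi1 L N j y = 0"
              by (intro AE_I2 impI phi1_outside_cube) (auto simp: cube_real)
          qed (use s in simp)
          have J: "{0..int N} = interior1 N \<union> {0, int N}" "interior1 N \<inter> {0, int N} = {}" "finite (interior1 N)"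
            using N by (auto simp: interior1_def)
          have dim: "- real DIM(real) < 1 - 2 * s" using s by simp
          have "V (node L N k) = frac_const 1 (s - 1) * ((\<Sum>j\<in>interior1 N. (LINT y|lebesgue. norm (node L N k - y) powr (1 - 2 * s) * phi1 L N j y) * u (node L N j))
            + ((LINT y|lebesgue. norm (node L N k - y) powr (1 - 2 * s) * g y) + (\<Sum>j\<in>{0, int N}. LINT y|lebesgue. norm (node L N k - y) powr (1 - 2 * s) * (u (node L N j) * phi1 L N j y))))"
            unfolding V_def W_def J(1)
            by (subst potential_decomposition[OF dim J(3) _ J(2) i]) auto
          \<comment> \<open>The decomposition is applied without interior nodes and read backwards,
            to merge the terms into the single integral of \<open>R1\<close>;
            \<open>N \<ge> 1\<close> keeps the indices \<open>0\<close> and \<open>N\<close>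
            distinct.\<close>
          also have "(LINT y|lebesgue. norm (node L N k - y) powr (1 - 2 * s) * g y) + (\<Sum>j\<in>{0, int N}. LINT y|lebesgue. norm (node L N k - y) powr (1 - 2 * s) * (u (node L N j) * phi1 L N j y))
            = (LINT y|lebesgue. \<bar>node L N k - y\<bar> powr (1 - 2 * s) * (u (node L N 0) * phi1 L N 0 y + u (node L N (int N)) * phi1 L N (int N) y + g y))"
            using potential_decomposition[OF dim, of "{}" "{0, int N}" "node L N k" "phi1 L N" "\<lambda>j. u (node L N j)"] i N
            by simp
          finally show ?thesis
            using L by (simp add: R1_def omega1_eq_potential distrib_left sum_distrib_left h_def mult_ac cong: sum.cong)
        qed
        have "disc_frac_laplacian1 s L N g u i = lap1 h (\<lambda>k. (\<Sum>j\<in>interior1 N. omega1 s h (j - k) * u (node L N j)) + R1 s L N g u k) i"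
          unfolding disc_frac_laplacian1_def h_def[symmetric] lap1_add
          by (subst lap1_sum) (simp_all add: interior1_def lap1_reflect)
        also have "\<dots> = - (second_diff V (h *\<^sub>R 1) (node L N i) / h\<^sup>2)"
          unfolding V[symmetric] lap1_def second_diff_def by (simp add: node_def h_def[symmetric] algebra_simps)
        finally have "error1 s L N g u i = frac_laplacian s u (node L N i) + (\<Sum>v\<in>{1}. 1 * second_diff V (h *\<^sub>R v) (node L N i)) / h\<^sup>2"
          by (simp add: error1_def)
        then show ?thesis
          using C(2)[OF h ix Wm W0 Wu] unfolding V_def h_def[symmetric] by simp
      qed
      then show ?thesis using C(1) by blast
    qed
  qed
qed

section \<open>The two-dimensional scheme\<close>

lemma cube_real2: "(cube L :: (real \<times> real) set) = {- L..L} \<times> {- L..L}"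
  by (auto simp: mem_cube Basis_prod_def abs_le_iff)

text \<open>Hat and truncation are both products, so measurability, bounds and values carry over
  from dimension one.\<close>

lemma phi2_eq: "phi2 L N (i, j) (x, y) = phi1 L N i x * phi1 L N j y"
  by (auto simp: phi2_def phi1_def hat2_def hat1_def node2_def indicator_def cube_real cube_real2)

lemma phi2_outside_cube: "z \<notin> cube L \<Longrightarrow> phi2 L N k z = 0"
  by (cases k) (simp add: phi2_def)

lemma borel_measurable_phi2 [measurable]: "phi2 L N k \<in> borel_measurable borel"
proof -
  obtain i j where k: "k = (i, j)" by (cases k)
  have "phi2 L N k = (\<lambda>z. phi1 L N i (fst z) * phi1 L N j (snd z))"
    by (auto simp: k phi2_eq)
  moreover have "(\<lambda>z::real \<times> real. phi1 L N i (fst z) * phi1 L N j (snd z)) \<in> borel_measurable borel"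
    unfolding borel_prod[symmetric] by measurable
  ultimately show ?thesis by simp
qed

lemma node2_shift: "node2 L N (i + a, j + b) = node2 L N (i, j) + mesh L N *\<^sub>R (of_int a, of_int b)"
  by (simp add: node2_def node_def algebra_simps)

lemma lap2_add: "lap2 \<theta> h (\<lambda>k. v k + w k) i = lap2 \<theta> h v i + lap2 \<theta> h w i"
  by (cases i) (simp add: lap2_def lap2_1_def lap2_2_def field_simps add_divide_distrib diff_divide_distrib)

lemma lap2_cmult: "lap2 \<theta> h (\<lambda>k. v k * c) i = lap2 \<theta> h v i * c"
  by (cases i) (simp add: lap2_def lap2_1_def lap2_2_def algebra_simps add_divide_distrib diff_divide_distrib)

lemma lap2_sum:
  "finite I \<Longrightarrow> lap2 \<theta> h (\<lambda>k. \<Sum>j\<in>I. v j k * c j) i = (\<Sum>j\<in>I. lap2 \<theta> h (v j) i * c j)"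
proof (induction I rule: finite_induct)
  case empty
  then show ?case by (cases i) (simp add: lap2_def lap2_1_def lap2_2_def)
next
  case (insert j I)
  then show ?case by (simp add: lap2_add lap2_cmult)
qed

lemma lap2_reflect: "lap2 \<theta> h (\<lambda>k. v (j - k)) i = lap2 \<theta> h v (j - i)"
  by (cases i; cases j) (simp add: lap2_def lap2_1_def lap2_2_def algebra_simps)

text \<open>Weights of the nine-point stencil, listed for one vector of each pair \<open>\<plusminus>v\<close>.\<close>

definition stencil2 :: "(real \<times> real) set" where
  "stencil2 = {(1, 0), (0, 1), (1, 1), (1, -1)}"

definition weight2 :: "real \<Rightarrow> real \<times> real \<Rightarrow> real" where
  "weight2 \<theta> v = (if v = (1, 0) \<or> v = (0, 1) then \<theta> else (1 - \<theta>) / 2)"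

text \<open>The mixed terms of \<open>(x + y)^2\<close> and \<open>(x - y)^2\<close> cancel, so the
  diagonals contribute \<open>(1 - \<theta>) * (x^2 + y^2)\<close>. The halved weight comes from the
  \<open>2 * h^2\<close> in \<open>lap2_2\<close>: diagonal neighbours are farther by a factor
  \<open>sqrt 2\<close>.\<close>

lemma isotropic_stencil2: "isotropic_stencil stencil2 (weight2 \<theta>)"
proof
  fix z :: "real \<times> real"
  obtain x y where z: "z = (x, y)" by (cases z)
  have "(\<Sum>v\<in>stencil2. weight2 \<theta> v * (z \<bullet> v)\<^sup>2) = \<theta> * x\<^sup>2 + (\<theta> * y\<^sup>2 + ((1 - \<theta>) / 2 * (x + y)\<^sup>2 + (1 - \<theta>) / 2 * (x - y)\<^sup>2))"
    by (simp add: stencil2_def weight2_def z)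
  also have "\<dots> = x\<^sup>2 + y\<^sup>2"
    by (simp add: power2_eq_square field_simps)
  finally show "(\<Sum>v\<in>stencil2. weight2 \<theta> v * (z \<bullet> v)\<^sup>2) = (norm z)\<^sup>2"
    by (simp add: z norm_prod_def)
qed (simp add: stencil2_def)

text \<open>The eight neighbours form four opposite pairs; the central term
  \<open>4 * v (i, j)\<close> of each five-point formula is shared by two of them.\<close>

lemma lap2_eq_second_diff:
  "lap2 \<theta> (mesh L N) (\<lambda>k. V (node2 L N k)) (i, j) =
    - ((\<Sum>v\<in>stencil2. weight2 \<theta> v * second_diff V (mesh L N *\<^sub>R v) (node2 L N (i, j))) / (mesh L N)\<^sup>2)"
proof -
  define h where "h = mesh L N"
  define P where "P = node2 L N (i, j)"
  have sh: "node2 L N (i + a, j + b) = P + h *\<^sub>R (of_int a, of_int b)" for a b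
    by (simp add: node2_shift P_def h_def)
  have n: "node2 L N (i - 1, j) = P - h *\<^sub>R (1, 0)" "node2 L N (i + 1, j) = P + h *\<^sub>R (1, 0)"
    "node2 L N (i, j + 1) = P + h *\<^sub>R (0, 1)" "node2 L N (i, j - 1) = P - h *\<^sub>R (0, 1)"
    "node2 L N (i - 1, j - 1) = P - h *\<^sub>R (1, 1)" "node2 L N (i + 1, j + 1) = P + h *\<^sub>R (1, 1)"
    "node2 L N (i + 1, j - 1) = P + h *\<^sub>R (1, -1)" "node2 L N (i - 1, j + 1) = P - h *\<^sub>R (1, -1)"
    using sh[of "-1" 0] sh[of 1 0] sh[of 0 1] sh[of 0 "-1"] sh[of "-1" "-1"] sh[of 1 1] sh[of 1 "-1"] sh[of "-1" 1]
    by (simp_all add: prod_eq_iff)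
  have S: "(\<Sum>v\<in>stencil2. weight2 \<theta> v * second_diff V (h *\<^sub>R v) P) =
      \<theta> * second_diff V (h *\<^sub>R (1, 0)) P + (\<theta> * second_diff V (h *\<^sub>R (0, 1)) P
      + ((1 - \<theta>) / 2 * second_diff V (h *\<^sub>R (1, 1)) P + (1 - \<theta>) / 2 * second_diff V (h *\<^sub>R (1, -1)) P))"
    unfolding stencil2_def weight2_def by (simp del: scaleR_Pair)
  show ?thesis
    unfolding h_def[symmetric] P_def[symmetric] S
    unfolding lap2_def lap2_1_def lap2_2_def case_prod_conv n h_def[symmetric] P_def[symmetric] second_diff_def
    by (simp add: algebra_simps add_divide_distrib diff_divide_distrib del: scaleR_Pair)
qed

text \<open>Translation by node \<open>k\<close> without reflection, since \<open>omega2\<close>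
  adds the integration variable where \<open>omega1\<close> subtracts it.\<close>

lemma omega2_eq_potential:
  assumes k: "k \<in> interior2 N" and L: "0 < L"
  shows "omega2 s (mesh L N) (k - i) = frac_const 2 (s - 1) *
    (LINT z|lebesgue. norm (node2 L N i - z) powr (- 2 * s) * phi2 L N k z)"
proof -
  define h where "h = mesh L N"
  obtain p q i1 i2 where kk: "k = (p, q)" "i = (i1, i2)" by (cases k; cases i)
  have pq: "p \<in> interior1 N" "q \<in> interior1 N" using k by (auto simp: kk interior1_def interior2_def)
  define f where "f z = norm (node2 L N i - z) powr (- 2 * s) * phi2 L N k z" for z
  have m: "f \<in> borel_measurable lebesgue"
    unfolding f_def[abs_def] by (intro measurable_completion) simp
  have "f (node2 L N k + 1 *\<^sub>R z) = indicator ({-h..h} \<times> {-h..h}) z *\<^sub>R (norm ((of_int (p - i1) * h, of_int (q - i2) * h) + z) powr (- 2 * s) * hat2 h z)" for z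
  proof -
    obtain x y where z: "z = (x, y)" by (cases z)
    have "node2 L N i - (node2 L N k + 1 *\<^sub>R z) = - ((of_int (p - i1) * h, of_int (q - i2) * h) + z)"
      by (simp add: node2_def node_def h_def kk z algebra_simps)
    then have e: "norm (node2 L N i - (node2 L N k + 1 *\<^sub>R z)) = norm ((of_int (p - i1) * h, of_int (q - i2) * h) + z)"
      by (simp only: norm_minus_cancel)
    have "phi2 L N k (node2 L N k + 1 *\<^sub>R z) = hat1 h x * hat1 h y"
      using phi1_interior[OF pq(1) L] phi1_interior[OF pq(2) L] by (simp add: kk z node2_def phi2_eq h_def)
    also have "\<dots> = indicator ({-h..h} \<times> {-h..h}) z * hat2 h z"
      by (auto simp: z hat1_def hat2_def indicator_def)
    finally show ?thesis unfolding f_def e by simp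
  qed
  then have "(LINT z|lebesgue. f z) = (LINT z:{-h..h} \<times> {-h..h}|lebesgue. norm ((of_int (p - i1) * h, of_int (q - i2) * h) + z) powr (- 2 * s) * hat2 h z)"
    using integral_scale_translate[OF m, of 1 "node2 L N k"] by (simp add: set_lebesgue_integral_def)
  then show ?thesis by (simp add: omega2_def f_def h_def kk)
qed

lemma grid2_eq_interior_un_boundary:
  "{0..int N} \<times> {0..int N} = interior2 N \<union> boundary2 N" "interior2 N \<inter> boundary2 N = {}"
  "finite (interior2 N)" "finite (boundary2 N)"
proof -
  show "{0..int N} \<times> {0..int N} = interior2 N \<union> boundary2 N" "interior2 N \<inter> boundary2 N = {}"
    by (auto simp: interior2_def boundary2_def)
  then have "boundary2 N \<subseteq> {0..int N} \<times> {0..int N}" by blast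
  then show "finite (boundary2 N)" by (rule finite_subset) simp
qed (simp add: interior2_def)

lemma error2_bound:
  assumes "holder_problem L \<delta> \<alpha> g u" and s: "0 < s" "s < 1" "2 * s - 1 < \<alpha>"
  shows "\<exists>C>0. \<forall>N\<ge>1. \<forall>k\<in>interior2 N. \<bar>error2 \<theta> s L N g u k\<bar> \<le> C * mesh L N powr (1 + \<alpha> - 2 * s)"
proof -
  interpret holder_problem L \<delta> \<alpha> g u by fact
  have d2: "DIM(real \<times> real) = 2" by simp
  have s': "real DIM(real \<times> real) / 2 + s \<noteq> 1" using s by simp
  have d\<gamma>: "2 - real DIM(real \<times> real) - 2 * s = - 2 * s" by simp
  show ?thesis
  proof (rule interpolation_bound[where 'i = "int \<times> int"])
    fix K assume K: "\<And>(I::(int \<times> int) set) w p y d. y \<in> cube L \<Longrightarrow> (\<And>i. i \<in> I \<Longrightarrow> 0 \<le> w i) \<Longrightarrow> (\<Sum>i\<in>I. w i) = 1 \<Longrightarrow>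
      (\<Sum>i\<in>I. w i *\<^sub>R p i) = y \<Longrightarrow> (\<And>i. i \<in> I \<Longrightarrow> w i \<noteq> 0 \<Longrightarrow> p i \<in> cube L \<and> norm (p i - y) \<le> d) \<Longrightarrow>
      \<bar>(\<Sum>i\<in>I. w i * u (p i)) - u y\<bar> \<le> K * d powr (1 + \<alpha>)"
    show ?thesis
    \<comment> \<open>The factor \<open>2 powr (1 + \<alpha>)\<close> arises because nodes of
      nonzero weight are only known to lie within \<open>2 * h\<close> of the point, by adding the
      two coordinate distances.\<close>
    proof (rule grid_error_bound[OF isotropic_stencil2 s(1,2) s' s(3), of "K * 2 powr (1 + \<alpha>)" \<theta>])
      fix C assume C: "0 < C" "\<And>h x W. 0 < h \<Longrightarrow> x \<in> cube L \<Longrightarrow> W \<in> borel_measurable lebesgue \<Longrightarrow>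
        (\<And>y. y \<notin> cube L \<Longrightarrow> W y = 0) \<Longrightarrow> (\<And>y. y \<in> cube L \<Longrightarrow> \<bar>W y - u y\<bar> \<le> K * 2 powr (1 + \<alpha>) * h powr (1 + \<alpha>)) \<Longrightarrow>
        \<bar>frac_laplacian s u x + (\<Sum>v\<in>stencil2. weight2 \<theta> v * second_diff (\<lambda>p. frac_const DIM(real \<times> real) (s - 1) *
            (LINT y|lebesgue. norm (p - y) powr (2 - real DIM(real \<times> real) - 2 * s) * (W y + g y))) (h *\<^sub>R v) x) / h\<^sup>2\<bar>
        \<le> C * h powr (1 + \<alpha> - 2 * s)"
      have "\<bar>error2 \<theta> s L N g u k\<bar> \<le> C * mesh L N powr (1 + \<alpha> - 2 * s)" if N: "1 \<le> N" and k: "k \<in> interior2 N" for N k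
      proof -
        define h where "h = mesh L N"
        define W where "W y = (\<Sum>j\<in>{0..int N} \<times> {0..int N}. u (node2 L N j) * phi2 L N j y)" for y
        define V where "V p = frac_const 2 (s - 1) * (LINT y|lebesgue. norm (p - y) powr (- 2 * s) * (W y + g y))" for p
        have h: "0 < h" using mesh_pos[OF L N] by (simp add: h_def)
        have Wm: "W \<in> borel_measurable lebesgue"
          unfolding W_def[abs_def] by (intro measurable_completion) simp
        have W0: "W y = 0" if "y \<notin> cube L" for y
          using that by (simp add: W_def phi2_outside_cube)
        have node2_cube: "node2 L N j \<in> cube L" if "j \<in> {0..int N} \<times> {0..int N}" for j
          using that node_mem_interval[OF L N] by (auto simp: cube_real2 node2_def)
        have Wu: "\<bar>W y - u y\<bar> \<le> K * 2 powr (1 + \<alpha>) * h powr (1 + \<alpha>)" if y: "y \<in> cube L" for y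
        proof -
          obtain y1 y2 where yy: "y = (y1, y2)" by (cases y)
          have y': "- L \<le> y1" "y1 \<le> L" "- L \<le> y2" "y2 \<le> L" using y by (auto simp: cube_real2 yy)
          define w where "w = (\<lambda>(i, j). hat1 h (y1 - node L N i) * hat1 h (y2 - node L N j))"
          have "phi2 L N j y = w j" for j
            using y' by (cases j) (simp add: yy phi2_eq phi1_in_cube[OF _ L N] cube_real w_def h_def)
          then have "W y = (\<Sum>j\<in>{0..int N} \<times> {0..int N}. w j * u (node2 L N j))"
            by (simp add: W_def mult.commute)
          moreover have "\<bar>(\<Sum>j\<in>{0..int N} \<times> {0..int N}. w j * u (node2 L N j)) - u y\<bar> \<le> K * (2 * h) powr (1 + \<alpha>)"
          proof (rule K[OF y])
            note pu = hat1_partition_of_unity[OF L N, folded h_def]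
            show w1: "(\<Sum>j\<in>{0..int N} \<times> {0..int N}. w j) = 1"
              using pu(1)[OF y'(1,2)] pu(1)[OF y'(3,4)]
              by (simp add: w_def sum.cartesian_product[symmetric] sum_product[symmetric])
            \<comment> \<open>Each coordinate of the barycentre factors into the first moment in its
              own variable and the total weight, which is 1, in the other.\<close>
            have "(\<Sum>j\<in>{0..int N} \<times> {0..int N}. w j * node L N (fst j)) = (\<Sum>i\<in>{0..int N}. hat1 h (y1 - node L N i) * node L N i) * (\<Sum>j\<in>{0..int N}. hat1 h (y2 - node L N j))"
              unfolding sum_product sum.cartesian_product by (intro sum.cong refl) (auto simp: w_def)
            then have m1: "(\<Sum>j\<in>{0..int N} \<times> {0..int N}. w j * node L N (fst j)) = y1"
              using pu y' by simp
            have "(\<Sum>j\<in>{0..int N} \<times> {0..int N}. w j * node L N (snd j)) = (\<Sum>i\<in>{0..int N}. hat1 h (y1 - node L N i)) * (\<Sum>j\<in>{0..int N}. hat1 h (y2 - node L N j) * node L N j)"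
              unfolding sum_product sum.cartesian_product by (intro sum.cong refl) (auto simp: w_def)
            then have m2: "(\<Sum>j\<in>{0..int N} \<times> {0..int N}. w j * node L N (snd j)) = y2"
              using pu y' by simp
            have "w j *\<^sub>R node2 L N j = (w j * node L N (fst j), w j * node L N (snd j))" for j
              by (cases j) (simp add: node2_def)
            then have "(\<Sum>j\<in>{0..int N} \<times> {0..int N}. w j *\<^sub>R node2 L N j)
                = (\<Sum>j\<in>{0..int N} \<times> {0..int N}. (w j * node L N (fst j), w j * node L N (snd j)))"
              by (simp only:)
            also have "\<dots> = y" by (simp add: yy m1 m2 prod_eq_iff fst_sum snd_sum)
            finally show "(\<Sum>j\<in>{0..int N} \<times> {0..int N}. w j *\<^sub>R node2 L N j) = y" .
            show "0 \<le> w j" for j by (cases j) (simp add: w_def hat1_nonneg h)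
            show "node2 L N j \<in> cube L \<and> norm (node2 L N j - y) \<le> 2 * h" if j: "j \<in> {0..int N} \<times> {0..int N}" "w j \<noteq> 0" for j
            proof
              obtain j1 j2 where jj: "j = (j1, j2)" by (cases j)
              have "\<bar>node L N j1 - y1\<bar> < h" "\<bar>node L N j2 - y2\<bar> < h"
                using j(2) by (auto simp: w_def jj hat1_def abs_minus_commute split: if_splits)
              moreover have "norm (node2 L N j - y) \<le> \<bar>node L N j1 - y1\<bar> + \<bar>node L N j2 - y2\<bar>"
                using norm_Pair_le[of "node L N j1 - y1" "node L N j2 - y2"] by (simp add: node2_def jj yy)
              ultimately show "norm (node2 L N j - y) \<le> 2 * h" by simp
            qed (rule node2_cube[OF j(1)])
          qed
          ultimately show ?thesis using h by (simp add: powr_mult mult.assoc)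
        qed
        have ix: "node2 L N k \<in> cube L"
          using k by (intro node2_cube) (auto simp: interior2_def)
        obtain r where r: "\<And>z::real \<times> real. z \<in> cube L \<Longrightarrow> norm z \<le> r"
          using bounded_cbox[of "- (L *\<^sub>R One)" "L *\<^sub>R One :: real \<times> real"] unfolding cube_def bounded_iff by blast
        have V: "V (node2 L N l) = (\<Sum>j\<in>interior2 N. omega2 s h (j - l) * u (node2 L N j)) + R2 s L N g u l" for l
        proof -
          have i: "integrable lebesgue (\<lambda>y. norm (p - y) powr (- 2 * s) * phi2 L N j y)" for p j
          proof (rule norm_powr_potential_integrable[where B = 1 and r = r])
            show "phi2 L N j \<in> borel_measurable lebesgue" by (intro measurable_completion) simp
            have "\<bar>phi1 L N i x\<bar> \<le> 1" for i x
              using hat1_le_1[OF h] hat1_nonneg[OF h] by (auto simp: phi1_def h_def indicator_def)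
            then have "\<bar>phi2 L N j y\<bar> \<le> 1" for y
              by (cases j; cases y) (auto simp: phi2_eq abs_mult intro: mult_le_one)
            then show "AE y in lebesgue. \<bar>phi2 L N j y\<bar> \<le> 1" by simp
            show "AE y in lebesgue. r < norm y \<longrightarrow> phi2 L N j y = 0"
              using r by (intro AE_I2 impI phi2_outside_cube) (auto simp: not_le[symmetric])
          qed (use s in simp)
          have dim: "- real DIM(real \<times> real) < - 2 * s" using s by simp
          have "V (node2 L N l) = frac_const 2 (s - 1) * ((\<Sum>j\<in>interior2 N. (LINT y|lebesgue. norm (node2 L N l - y) powr (- 2 * s) * phi2 L N j y) * u (node2 L N j))
            + ((LINT y|lebesgue. norm (node2 L N l - y) powr (- 2 * s) * g y) + (\<Sum>j\<in>boundary2 N. LINT y|lebesgue. norm (node2 L N l - y) powr (- 2 * s) * (u (node2 L N j) * phi2 L N j y))))"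
            unfolding V_def W_def grid2_eq_interior_un_boundary(1)
            by (subst potential_decomposition[OF dim grid2_eq_interior_un_boundary(3,4,2) i]) auto
          then show ?thesis
            using L by (simp add: R2_def omega2_eq_potential distrib_left sum_distrib_left h_def mult_ac cong: sum.cong)
        qed
        obtain i j where ij: "k = (i, j)" by (cases k)
        have "disc_frac_laplacian2 \<theta> s L N g u k = lap2 \<theta> h (\<lambda>l. (\<Sum>j\<in>interior2 N. omega2 s h (j - l) * u (node2 L N j)) + R2 s L N g u l) k"
          unfolding lap2_add
          by (subst lap2_sum[OF grid2_eq_interior_un_boundary(3)])
            (simp only: lap2_reflect, simp add: disc_frac_laplacian2_def ij h_def interior2_def sum.cartesian_product case_prod_unfold minus_prod_def)
        also have "\<dots> = - ((\<Sum>v\<in>stencil2. weight2 \<theta> v * second_diff V (h *\<^sub>R v) (node2 L N k)) / h\<^sup>2)"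
          unfolding V[symmetric] unfolding ij h_def by (rule lap2_eq_second_diff)
        finally have "error2 \<theta> s L N g u k = frac_laplacian s u (node2 L N k) + (\<Sum>v\<in>stencil2. weight2 \<theta> v * second_diff V (h *\<^sub>R v) (node2 L N k)) / h\<^sup>2"
          by (simp add: error2_def)
        then show ?thesis
          using C(2)[OF h ix Wm W0 Wu, unfolded d\<gamma> d2] unfolding V_def h_def[symmetric] by simp
      qed
      then show ?thesis using C(1) by blast
    qed
  qed
qed

section \<open>The error estimate\<close>

text \<open>The maximum norm is at most \<open>E\<close> and the discrete \<open>l2\<close> norm at
  most \<open>sqrt A * E\<close>; the factor \<open>1 + sqrt A\<close> dominates both.\<close>

lemma grid_norm_bounds:
  assumes I: "finite I" "real (card I) * h ^ n \<le> A" and h: "0 < h" and E: "0 \<le> E" "\<And>i. i \<in> I \<Longrightarrow> \<bar>v i\<bar> \<le> E"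
  shows "grid_norm_inf I v \<le> (1 + sqrt A) * E" "grid_norm_2 n h I v \<le> (1 + sqrt A) * E"
proof -
  have "0 \<le> real (card I) * h ^ n" using h by simp
  then have A: "0 \<le> A" using I(2) by linarith
  have "grid_norm_inf I v \<le> E"
    unfolding grid_norm_inf_def using I(1) E by (intro Max.boundedI) auto
  moreover have "0 \<le> sqrt A * E" using A E(1) by simp
  ultimately show "grid_norm_inf I v \<le> (1 + sqrt A) * E" by (simp add: distrib_right)
  have "(\<Sum>i\<in>I. \<bar>v i\<bar>\<^sup>2) \<le> (\<Sum>i\<in>I. E\<^sup>2)" using E(2) by (intro sum_mono power_mono) auto
  then have "h ^ n * (\<Sum>i\<in>I. \<bar>v i\<bar>\<^sup>2) \<le> h ^ n * (real (card I) * E\<^sup>2)"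
    using h by (intro mult_left_mono) auto
  also have "\<dots> = (real (card I) * h ^ n) * E\<^sup>2" by (simp only: mult_ac)
  also have "\<dots> \<le> A * E\<^sup>2" using I(2) by (rule mult_right_mono) simp
  finally have "grid_norm_2 n h I v \<le> sqrt (A * E\<^sup>2)" unfolding grid_norm_2_def by (rule real_sqrt_le_mono)
  also have "\<dots> = sqrt A * E" using E by (simp add: real_sqrt_mult)
  also have "\<dots> \<le> (1 + sqrt A) * E" using E by (simp add: distrib_right)
  finally show "grid_norm_2 n h I v \<le> (1 + sqrt A) * E" .
qed

text \<open>At most \<open>N ^ n\<close> points, each carrying volume \<open>h ^ n\<close>, have
  total volume at most \<open>(2 * L) ^ n\<close>, whatever \<open>N\<close> is.\<close>

lemma grid_norms_estimate:
  assumes L: "0 < L" and fin: "\<And>N. finite (I N)" and card: "\<And>N. N \<ge> 1 \<Longrightarrow> card (I N) \<le> N ^ n"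
    and E: "\<exists>C>0. \<forall>N\<ge>1. \<forall>i\<in>I N. \<bar>e N i\<bar> \<le> C * mesh L N powr \<beta>"
  shows "\<exists>C>0. \<forall>N\<ge>1. P N \<longrightarrow> grid_norm_inf (I N) (e N) \<le> C * mesh L N powr \<beta> \<and>
    grid_norm_2 n (mesh L N) (I N) (e N) \<le> C * mesh L N powr \<beta>"
proof -
  obtain C where C: "C > 0" "\<And>N i. N \<ge> 1 \<Longrightarrow> i \<in> I N \<Longrightarrow> \<bar>e N i\<bar> \<le> C * mesh L N powr \<beta>"
    using E by blast
  define D where "D = (1 + sqrt ((2 * L) ^ n)) * C"
  have "grid_norm_inf (I N) (e N) \<le> D * mesh L N powr \<beta> \<and> grid_norm_2 n (mesh L N) (I N) (e N) \<le> D * mesh L N powr \<beta>"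
    if N: "N \<ge> 1" for N
  proof -
    have h: "0 < mesh L N" using mesh_pos[OF L N] .
    have "real (card (I N)) \<le> real N ^ n" using of_nat_mono[OF card[OF N], where 'a = real] by simp
    then have "real (card (I N)) * mesh L N ^ n \<le> real N ^ n * mesh L N ^ n"
      using h by (intro mult_right_mono) auto
    also have "\<dots> = (real N * mesh L N) ^ n" by (rule power_mult_distrib[symmetric])
    also have "real N * mesh L N = 2 * L" using N by (simp add: mesh_def)
    finally have A: "real (card (I N)) * mesh L N ^ n \<le> (2 * L) ^ n" .
    have "0 \<le> C * mesh L N powr \<beta>" using C(1) by simp
    from grid_norm_bounds[OF fin A h this C(2)[OF N]] show ?thesis by (simp add: D_def mult.assoc)
  qed
  moreover have "D > 0" unfolding D_def using C(1) L by (intro mult_pos_pos add_pos_nonneg) auto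
  ultimately show ?thesis by blast
qed

theorem theorem3p1:
  fixes s L \<delta> \<alpha> :: real
  assumes "0 < s" and "s < 1" and "s \<noteq> 1 / 2"
    and "L > 0" and "\<delta> > 0"
    and "max 0 (2 * s - 1) < \<alpha>" and "\<alpha> \<le> 1"
  shows
    "(\<forall>(g :: real \<Rightarrow> real) (u :: real \<Rightarrow> real).
        Linfty g \<and> bounded_support g \<and>
        (AE x in lebesgue. x \<in> cube L \<longrightarrow> g x = 0) \<and>
        (AE x in lebesgue. x \<notin> cube L \<longrightarrow> u x = g x) \<and>
        C1_holder_closure \<alpha> (open_cube (L + \<delta>)) u \<longrightarrow>
        (\<exists>C>0. \<forall>N\<ge>1. 4 * mesh L N < \<delta> \<longrightarrow>
            grid_norm_inf (interior1 N) (error1 s L N g u) \<le> C * mesh L N powr (1 + \<alpha> - 2 * s) \<and>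
            grid_norm_2 1 (mesh L N) (interior1 N) (error1 s L N g u)
              \<le> C * mesh L N powr (1 + \<alpha> - 2 * s))) \<and>
     (\<forall>(\<theta> :: real) (g :: real \<times> real \<Rightarrow> real) (u :: real \<times> real \<Rightarrow> real).
        0 \<le> \<theta> \<and> \<theta> \<le> 1 \<and>
        Linfty g \<and> bounded_support g \<and>
        (AE x in lebesgue. x \<in> cube L \<longrightarrow> g x = 0) \<and>
        (AE x in lebesgue. x \<notin> cube L \<longrightarrow> u x = g x) \<and>
        C1_holder_closure \<alpha> (open_cube (L + \<delta>)) u \<longrightarrow>
        (\<exists>C>0. \<forall>N\<ge>1. 4 * mesh L N < \<delta> \<longrightarrow>
            grid_norm_inf (interior2 N) (error2 \<theta> s L N g u) \<le> C * mesh L N powr (1 + \<alpha> - 2 * s) \<and>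
            grid_norm_2 2 (mesh L N) (interior2 N) (error2 \<theta> s L N g u)
              \<le> C * mesh L N powr (1 + \<alpha> - 2 * s)))"
proof (intro conjI allI impI)
  have \<alpha>: "0 < \<alpha>" "2 * s - 1 < \<alpha>" using assms by auto
  fix g u :: "real \<Rightarrow> real"
  assume "Linfty g \<and> bounded_support g \<and>
        (AE x in lebesgue. x \<in> cube L \<longrightarrow> g x = 0) \<and>
        (AE x in lebesgue. x \<notin> cube L \<longrightarrow> u x = g x) \<and>
        C1_holder_closure \<alpha> (open_cube (L + \<delta>)) u"
  then have "holder_problem L \<delta> \<alpha> g u" using assms \<alpha> by (intro holder_problem.intro) auto
  \<comment> \<open>In dimension one, \<open>s \<noteq> 1 / 2\<close> is the condition
    \<open>n / 2 + s \<noteq> 1\<close> that keeps the Gamma factor for \<open>s - 1\<close> off its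
    pole.\<close>
  note bound = error1_bound[OF this assms(1-3) \<alpha>(2)]
  show "\<exists>C>0. \<forall>N\<ge>1. 4 * mesh L N < \<delta> \<longrightarrow>
            grid_norm_inf (interior1 N) (error1 s L N g u) \<le> C * mesh L N powr (1 + \<alpha> - 2 * s) \<and>
            grid_norm_2 1 (mesh L N) (interior1 N) (error1 s L N g u)
              \<le> C * mesh L N powr (1 + \<alpha> - 2 * s)"
    by (rule grid_norms_estimate[OF \<open>L > 0\<close> _ _ bound]) (simp_all add: interior1_def)
next
  have \<alpha>: "0 < \<alpha>" "2 * s - 1 < \<alpha>" using assms by auto
  fix \<theta> :: real and g u :: "real \<times> real \<Rightarrow> real"
  assume "0 \<le> \<theta> \<and> \<theta> \<le> 1 \<and>
        Linfty g \<and> bounded_support g \<and>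
        (AE x in lebesgue. x \<in> cube L \<longrightarrow> g x = 0) \<and>
        (AE x in lebesgue. x \<notin> cube L \<longrightarrow> u x = g x) \<and>
        C1_holder_closure \<alpha> (open_cube (L + \<delta>)) u"
  then have "holder_problem L \<delta> \<alpha> g u" using assms \<alpha> by (intro holder_problem.intro) auto
  note bound = error2_bound[OF this assms(1,2) \<alpha>(2), of \<theta>]
  have "(N - 1) * (N - 1) \<le> N\<^sup>2" for N :: nat by (simp add: power2_eq_square mult_mono)
  then show "\<exists>C>0. \<forall>N\<ge>1. 4 * mesh L N < \<delta> \<longrightarrow>
            grid_norm_inf (interior2 N) (error2 \<theta> s L N g u) \<le> C * mesh L N powr (1 + \<alpha> - 2 * s) \<and>
            grid_norm_2 2 (mesh L N) (interior2 N) (error2 \<theta> s L N g u)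
              \<le> C * mesh L N powr (1 + \<alpha> - 2 * s)"
    by (intro grid_norms_estimate[OF \<open>L > 0\<close> _ _ bound]) (simp_all add: interior2_def nat_diff_distrib)
qed

end
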